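(* As $n\to\infty$, $$\overline{\sigma_o\mathrm{mex}}(n)\sim\frac{\sqrt 2}{16}\,n^{-3/4}\exp\bigl(\pi\sqrt n\bigr),$$ that is, the ratio of the two sides tends to $1$.
   Context: An overpartition of a nonnegative integer $n$ is a non-increasing sequence of positive integers summing to $n$ in which the first occurrence of each distinct integer may (or may not) be overlined; $\overline{\mathcal P}(n)$ denotes the set of all overpartitions of $n$. For an overpartition $\lambda$, $\mathrm{mex}(\lambda)$ is the least positive integer that does not occur as a part of $\lambda$, where a value counts as occurring whether it appears overlined or non-overlined. Put $\mathrm{mex}_o(\lambda)=\mathrm{mex}(\lambda)$ if $\mathrm{mex}(\lambda)$ is odd and $\mathrm{mex}_o(\lambda)=0$ otherwise. Define $\overline{\sigma_o\mathrm{mex}}(n)=\sum_{\lambda\in\overline{\mathcal P}(n)}\mathrm{mex}_o(\lambda)$ for $n\ge 0$. *)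

theory Defs
  imports Complex_Main "HOL-Library.Landau_Symbols"
begin

text \<open>
  An overpartition is a list of pairs \<open>(k, b)\<close>, where \<open>k\<close> is the part and \<open>b\<close> says
  whether this occurrence of \<open>k\<close> is overlined. The last conjunct says that an overlined
  entry is the first occurrence of its value.
\<close>
definition overpartitions :: "nat \<Rightarrow> (nat \<times> bool) list set" where
  "overpartitions n =
     {l. sorted_wrt (\<ge>) (map fst l)
       \<and> (\<forall>k \<in> set (map fst l). k > 0)
       \<and> sum_list (map fst l) = n
       \<and> (\<forall>i < length l. snd (l ! i) \<longrightarrow> (\<forall>j < i. fst (l ! j) \<noteq> fst (l ! i)))}"

definition mex :: "(nat \<times> bool) list \<Rightarrow> nat" where
  "mex l = (LEAST m. m > 0 \<and> m \<notin> set (map fst l))"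

definition mex_odd :: "(nat \<times> bool) list \<Rightarrow> nat" where
  "mex_odd l = (if odd (mex l) then mex l else 0)"

definition sigma_mex_odd :: "nat \<Rightarrow> nat" where
  "sigma_mex_odd n = (\<Sum>l \<in> overpartitions n. mex_odd l)"

text \<open>The sum above ranges over a finite set, so it is not the default value 0.\<close>
lemma finite_overpartitions: "finite (overpartitions n)"
proof (rule finite_subset)
  have len: "length l \<le> sum_list (map fst l)" 
    if "\<forall>k \<in> set (map fst l). k > 0" for l :: "(nat \<times> bool) list"
    using that by (induction l) fastforce+
  show "overpartitions n \<subseteq> {l. set l \<subseteq> {..n} \<times> UNIV \<and> length l \<le> n}"
    using len by (force simp: overpartitions_def intro: member_le_sum_list)
  show "finite {l. set l \<subseteq> {..n} \<times> (UNIV :: bool set) \<and> length l \<le> n}"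
    by (rule finite_lists_length_le) auto
qed

end

theory Submission
  imports Defs "HOL-Probability.Probability" "HOL-Real_Asymp.Real_Asymp"
begin

text \<open>
  Let \<open>P(q) = \<Prod>\<^sub>k (1 + q\<^sup>k) / (1 - q\<^sup>k)\<close> be the generating function of overpartitions. Having mex
  equal to \<open>m\<close> is a condition on each part size separately (every \<open>k < m\<close> occurs, \<open>m\<close> does not),
  so the overpartitions with mex \<open>m\<close> have generating function \<open>P(q) c\<^sub>m(q)\<close> with the finite product
  \<open>c\<^sub>m(q) = \<Prod>\<^bsub>k<m\<^esub> 2 q\<^sup>k / (1 + q\<^sup>k) \<cdot> (1 - q\<^sup>m) / (1 + q\<^sup>m)\<close> (\<open>ovp_upto_mex_sums\<close>, for parts up to a cutoff). At
  \<open>q = exp (- t)\<close> this is the probability that a random overpartition, weighted by \<open>q\<close> to its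
  size, has mex \<open>m\<close>. The theorem follows from the saddle point method applied to the coefficient
  of \<open>P(q) G(q)\<close>, where \<open>G(q) = \<Sum> m c\<^sub>m(q)\<close> over odd \<open>m\<close>, on the circle of radius \<open>exp (- t)\<close> with
  \<open>t = \<pi> / (2 \<surd>n)\<close> and with the angle written as \<open>\<theta> = t\<^sup>3\<^sup>/\<^sup>2 u\<close>. There are four ingredients.

  Near the real axis \<open>P\<close> is compared with its values on the axis. The series
  \<open>log P(exp (- z)) = \<Sum> 2 / (j (exp (j z) - 1))\<close> over odd \<open>j\<close> has the polar part \<open>\<pi>\<^sup>2 / (4 z)\<close>. What
  remains differs between \<open>z\<close> and \<open>Re z\<close> by at most \<open>16 \<bar>Im z\<bar> / Re z\<close> in the sector
  \<open>\<bar>Im z\<bar> \<le> Re z\<close> (\<open>log_ovp_diff_bound\<close>), which is \<open>O(\<surd>t)\<close> at the relevant scale.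

  On the real axis, \<open>log P(exp (- t)) = \<pi>\<^sup>2 / (4 t) + \<onehalf> ln t - \<onehalf> ln (4 \<pi>) + o(1)\<close>
  (\<open>log_ovp_real_asymp\<close>). Indeed \<open>P(q) / P(q\<^sup>2)\<^sup>2\<close> is an alternating product of hyperbolic
  cotangents, which convexity compares with the Wallis product; that determines
  \<open>2 E(2 t) - E(t)\<close> for the error term \<open>E\<close>, and a doubling relation of this kind together with
  \<open>t E(t) \<rightarrow> 0\<close> forces \<open>E \<rightarrow> 0\<close>.

  The sum \<open>G\<close> is a Riemann sum: with \<open>x = i \<surd>t\<close> the term of \<open>m = 2 i + 1\<close> tends to
  \<open>2 x\<^sup>2 exp (- x\<^sup>2)\<close>, so that \<open>\<surd>t G \<rightarrow> \<surd>\<pi> / 2\<close>, also off the real axis at the relevant scale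
  (\<open>mex_weight_sum_limit\<close>).

  Finally, all local factors of \<open>P c\<^sub>m\<close> have non-negative coefficients, and all but one of them
  have the denominator \<open>1 - q\<^sup>k\<close>. Comparing \<open>\<bar>1 - q\<^sup>k\<bar>\<close> with \<open>1 - \<bar>q\<bar>\<^sup>k\<close> bounds the integrand, relative
  to its value at angle \<open>0\<close>, by a constant times \<open>1 / (1 + u\<^sup>2)\<close>, uniformly in \<open>m\<close>
  (\<open>sigma_integrand_bound\<close>). So dominated convergence applies to the whole circle at once. The
  limit of the integrand is \<open>exp (- \<pi>\<^sup>2 u\<^sup>2 / 4)\<close>, and collecting the constants gives \<open>\<surd>2 / 16\<close>.
\<close>

section \<open>Counting overpartitions with a given mex\<close>

text \<open>
  The conditions on an overpartition in a form that recurses on the list, so that prefixes can be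
  split off.
\<close>
fun wf_ovp :: "(nat \<times> bool) list \<Rightarrow> bool" where
  "wf_ovp [] = True"
| "wf_ovp (x # l) \<longleftrightarrow> fst x > 0 \<and> (\<forall>p\<in>set l. fst p \<le> fst x \<and> (snd p \<longrightarrow> fst p \<noteq> fst x)) \<and> wf_ovp l"

lemma overpartitions_eq: "overpartitions n = {l. wf_ovp l \<and> sum_list (map fst l) = n}"
proof -
  have ov: "(\<forall>i < length (x # l). snd ((x # l) ! i) \<longrightarrow> (\<forall>j < i. fst ((x # l) ! j) \<noteq> fst ((x # l) ! i))) \<longleftrightarrow>
     (\<forall>p\<in>set l. snd p \<longrightarrow> fst p \<noteq> fst x) \<and>
     (\<forall>i < length l. snd (l ! i) \<longrightarrow> (\<forall>j < i. fst (l ! j) \<noteq> fst (l ! i)))"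
    for x :: "nat \<times> bool" and l
    by (simp add: All_less_Suc2 all_set_conv_all_nth) metis
  have "(sorted_wrt (\<ge>) (map fst l) \<and> (\<forall>k \<in> set (map fst l). k > 0) \<and>
         (\<forall>i < length l. snd (l ! i) \<longrightarrow> (\<forall>j < i. fst (l ! j) \<noteq> fst (l ! i)))) \<longleftrightarrow> wf_ovp l" for l
  proof (induction l)
    case (Cons x l)
    show ?case
      unfolding ov wf_ovp.simps Cons.IH[symmetric] by auto
  qed simp
  then show ?thesis by (auto simp: overpartitions_def)
qed

text \<open>
  Parts of different size do not interact, so a list splits wherever the part size drops.
\<close>
lemma wf_ovp_append:
  assumes "\<And>p p'. p \<in> set b \<Longrightarrow> p' \<in> set l \<Longrightarrow> fst p' < fst p"
  shows "wf_ovp (b @ l) \<longleftrightarrow> wf_ovp b \<and> wf_ovp l"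
  using assms by (induction b) (auto, (metis less_imp_le less_irrefl)+)

definition blocks :: "nat \<Rightarrow> nat \<Rightarrow> (nat \<times> bool) list set" where
  "blocks k i = {b. wf_ovp b \<and> fst ` set b \<subseteq> {k} \<and> sum_list (map fst b) = i}"

text \<open>
  Only the first entry of a run of equal parts has a choice, hence two blocks for each positive
  multiplicity.
\<close>
lemma blocks_eq:
  assumes "k > 0"
  shows "blocks k i = (if i = 0 then {[]} else if k dvd i
           then (\<lambda>c. (k, c) # replicate (i div k - 1) (k, False)) ` UNIV else {})"
proof -
  have rep: "wf_ovp l \<and> fst ` set l \<subseteq> {k} \<and> (\<forall>p\<in>set l. \<not> snd p) \<longleftrightarrow> l = replicate (length l) (k, False)"
    for l
  proof (induction l)
    case (Cons x l)
    show ?case using assms Cons by (cases x) (auto simp: image_subset_iff)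
  qed simp
  have shape: "wf_ovp b \<and> fst ` set b \<subseteq> {k} \<longleftrightarrow>
      b = [] \<or> (\<exists>c j. b = (k, c) # replicate j (k, False))" for b
  proof (cases b)
    case (Cons x l)
    have "wf_ovp b \<and> fst ` set b \<subseteq> {k} \<longleftrightarrow> fst x = k \<and> (wf_ovp l \<and> fst ` set l \<subseteq> {k} \<and> (\<forall>p\<in>set l. \<not> snd p))"
      using assms unfolding Cons by fastforce
    also have "\<dots> \<longleftrightarrow> (\<exists>c j. b = (k, c) # replicate j (k, False))"
      unfolding rep Cons by (cases x) (auto)
    finally show ?thesis by (simp add: Cons)
  qed simp
  define B where "B c j = (k, c) # replicate j (k, False)" for c j
  have sum_B: "sum_list (map fst (B c j)) = k * Suc j" for c j
    by (simp add: B_def sum_list_replicate)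
  have "blocks k i = {b. (b = [] \<or> (\<exists>c j. b = B c j)) \<and> sum_list (map fst b) = i}"
    unfolding blocks_def B_def using shape by blast
  also have "\<dots> = (if i = 0 then {[]} else if k dvd i then (\<lambda>c. B c (i div k - 1)) ` UNIV else {})"
  proof (cases "k dvd i \<and> i \<noteq> 0")
    case True
    then obtain d where d: "i = k * Suc d" by (metis dvd_def mult_0_right not0_implies_Suc)
    have "k * Suc j = k * Suc d \<longleftrightarrow> j = d" for j
      using assms by (simp only: mult_cancel1) simp
    then have "{b. (b = [] \<or> (\<exists>c j. b = B c j)) \<and> sum_list (map fst b) = i} = range (\<lambda>c. B c d)"
      using assms by (auto simp: sum_B d simp del: mult_Suc_right)
    moreover have "i div k - 1 = d" using assms by (simp add: d del: mult_Suc_right)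
    ultimately show ?thesis using True by simp
  next
    case False
    then have "k * Suc j \<noteq> i" for j using assms by (metis dvd_triv_left mult_is_0 nat.distinct(1) not_gr_zero)
    then have "sum_list (map fst (B c j)) \<noteq> i" for c j by (simp only: sum_B) simp
    then have "{b. (b = [] \<or> (\<exists>c j. b = B c j)) \<and> sum_list (map fst b) = i} = {b. b = [] \<and> i = 0}"
      by force
    then show ?thesis using False by auto
  qed
  finally show ?thesis by (simp add: B_def)
qed

lemma finite_blocks: "k > 0 \<Longrightarrow> finite (blocks k i)"
  by (simp add: blocks_eq)

lemma card_blocks:
  assumes "k > 0"
  shows "card (blocks k i) = (if i = 0 then 1 else if k dvd i then 2 else 0)"
proof -
  have "card ((\<lambda>c. (k, c) # replicate (i div k - 1) (k, False)) ` (UNIV :: bool set)) = 2"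
    by (subst card_image) (auto intro: injI)
  then show ?thesis using assms by (simp add: blocks_eq)
qed

text \<open>
  Overpartitions of \<open>n\<close> into parts from \<open>{1..N}\<close> in which the values in \<open>R\<close> are required and those
  in \<open>X\<close> are forbidden. With \<open>R = {1..<m}\<close> and \<open>X = {m}\<close> this says that the mex is \<open>m\<close>, and for general
  \<open>R\<close>, \<open>X\<close> one can still remove the largest part size.
\<close>
definition ovp_upto :: "nat set \<Rightarrow> nat set \<Rightarrow> nat \<Rightarrow> nat \<Rightarrow> (nat \<times> bool) list set" where
  "ovp_upto R X N n = {l \<in> overpartitions n. fst ` set l \<subseteq> {1..N} - X \<and> R \<inter> {1..N} \<subseteq> fst ` set l}"

definition ok_blocks :: "nat set \<Rightarrow> nat set \<Rightarrow> nat \<Rightarrow> nat \<Rightarrow> (nat \<times> bool) list set" where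
  "ok_blocks R X k i = {b \<in> blocks k i. (k \<in> R \<longrightarrow> b \<noteq> []) \<and> (k \<in> X \<longrightarrow> b = [])}"

text \<open>
  The copies of the largest admissible value \<open>Suc N\<close> form a prefix of the list, and this prefix
  and the rest can be chosen independently.
\<close>
lemma ovp_upto_Suc_bij:
  "bij_betw (\<lambda>(i, b, l). b @ l) (SIGMA i:{..n}. ok_blocks R X (Suc N) i \<times> ovp_upto R X N (n - i))
     (ovp_upto R X (Suc N) n)"
proof -
  let ?k = "Suc N"
  have app: "b @ l \<in> ovp_upto R X ?k n"
    if i: "i \<le> n" and b: "b \<in> ok_blocks R X ?k i" and l: "l \<in> ovp_upto R X N (n - i)" for i b l
  proof -
    have fb: "fst ` set b = {} \<or> fst ` set b = {?k}"
      using b subset_singletonD[of "fst ` set b" ?k] by (simp add: ok_blocks_def blocks_def)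
    have "wf_ovp (b @ l) \<longleftrightarrow> wf_ovp b \<and> wf_ovp l"
    proof (rule wf_ovp_append)
      fix p p' assume "p \<in> set b" "p' \<in> set l"
      moreover have "fst ` set l \<subseteq> {1..N}" using l by (auto simp: ovp_upto_def)
      ultimately have "fst p' \<in> {1..N}" "fst p = ?k" using fb by (meson image_subset_iff, metis empty_iff image_eqI singletonD)
      then show "fst p' < fst p" by simp
    qed
    moreover have "fst ` set (b @ l) \<subseteq> {1..?k} - X"
    proof -
      have "fst ` set l \<subseteq> {1..?k} - X" using l by (auto simp: ovp_upto_def)
      moreover have "fst ` set b \<subseteq> {1..?k} - X" 
      proof (cases "b = []")
        case False
        then have "?k \<notin> X" using b by (auto simp: ok_blocks_def)
        then have "{?k} \<subseteq> {1..?k} - X" by auto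
        then show ?thesis using fb by (metis empty_subsetI)
      qed simp
      ultimately show ?thesis by (simp add: image_Un)
    qed
    moreover have "R \<inter> {1..?k} \<subseteq> fst ` set (b @ l)"
    proof
      fix k assume k: "k \<in> R \<inter> {1..?k}"
      show "k \<in> fst ` set (b @ l)"
      proof (cases "k = ?k")
        case True
        then have "b \<noteq> []" using b k by (auto simp: ok_blocks_def)
        then show ?thesis using fb True by auto
      next
        case False
        then have "k \<in> R \<inter> {1..N}" using k by auto
        then have "k \<in> fst ` set l" using l unfolding ovp_upto_def by blast
        then show ?thesis by auto
      qed
    qed
    ultimately show ?thesis using i b l
      by (simp add: ok_blocks_def blocks_def ovp_upto_def overpartitions_eq)
  qed
  have inj: "inj_on (\<lambda>(i, b, l). b @ l) (SIGMA i:{..n}. ok_blocks R X ?k i \<times> ovp_upto R X N (n - i))"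
  proof -
    have tw: "takeWhile (\<lambda>p. fst p = ?k) (b @ l) = b \<and> dropWhile (\<lambda>p. fst p = ?k) (b @ l) = l \<and> i = sum_list (map fst b)"
      if "b \<in> ok_blocks R X ?k i" "l \<in> ovp_upto R X N (n - i)" for i b l
    proof -
      have "\<forall>p\<in>set b. fst p = ?k" using that(1) by (auto simp: ok_blocks_def blocks_def)
      moreover have "fst ` set l \<subseteq> {1..N}" using that(2) by (auto simp: ovp_upto_def)
      then have "\<forall>p\<in>set l. fst p \<noteq> ?k" by (metis Suc_n_not_le_n atLeastAtMost_iff image_subset_iff)
      then have "takeWhile (\<lambda>p. fst p = ?k) l = []" "dropWhile (\<lambda>p. fst p = ?k) l = l"
        by (cases l; simp)+
      ultimately show ?thesis using that(1)
        by (simp add: takeWhile_append2 dropWhile_append2 ok_blocks_def blocks_def)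
    qed
    show ?thesis by (rule inj_onI) (clarify, metis tw)
  qed
  \<comment> \<open>The prefix is found by \<open>takeWhile\<close>; sortedness keeps further copies of \<open>Suc N\<close> out of the rest.\<close>
  have surj: "\<exists>i\<le>n. \<exists>b\<in>ok_blocks R X ?k i. \<exists>m\<in>ovp_upto R X N (n - i). l = b @ m"
    if l: "l \<in> ovp_upto R X ?k n" for l
  proof -
    define b m where "b = takeWhile (\<lambda>p. fst p = ?k) l" and "m = dropWhile (\<lambda>p. fst p = ?k) l"
    have lb: "l = b @ m" by (simp add: b_def m_def)
    have fb: "\<forall>p\<in>set b. fst p = ?k" unfolding b_def by (auto dest: set_takeWhileD)
    have wl: "wf_ovp l" and le: "\<forall>p\<in>set l. fst p \<le> ?k \<and> fst p \<ge> 1"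
      using l by (auto simp: ovp_upto_def overpartitions_eq image_subset_iff)
    have fm: "\<forall>p\<in>set m. fst p < ?k"
    proof (cases m)
      case (Cons x xs)
      have "fst x \<noteq> ?k" using Cons by (simp add: m_def dropWhile_eq_Cons_conv)
      then have "fst x < ?k" using le Cons lb by fastforce
      moreover have "\<forall>p\<in>set xs. fst p \<le> fst x"
      proof -
        have "wf_ovp (b @ m) \<Longrightarrow> wf_ovp m" for b m by (induction b) auto
        then have "wf_ovp m" using wl lb by simp
        then show ?thesis using Cons by simp
      qed
      ultimately show ?thesis using Cons by (metis le_less_trans set_ConsD)
    qed simp
    have "wf_ovp b \<and> wf_ovp m"
      using wf_ovp_append[of b m] fb fm wl lb by auto
    moreover have "fst ` set m \<subseteq> {1..N} - X" 
    proof -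
      have "fst ` set m \<subseteq> {1..?k} - X" using l lb by (auto simp: ovp_upto_def)
      moreover have "?k \<notin> fst ` set m" using fm by auto
      moreover have "{1..N} - X = ({1..?k} - X) - {?k}" by auto
      ultimately show ?thesis by (simp only: subset_Diff_insert Diff_empty) simp
    qed
    moreover have "R \<inter> {1..N} \<subseteq> fst ` set m"
    proof
      fix k assume k: "k \<in> R \<inter> {1..N}"
      then have "k \<in> fst ` set l" using l by (auto simp: ovp_upto_def)
      moreover have "k \<notin> fst ` set b" using k fb by auto
      ultimately show "k \<in> fst ` set m" using lb by (auto simp: image_Un)
    qed
    moreover have "?k \<in> R \<longrightarrow> b \<noteq> []"
    proof
      assume "?k \<in> R"
      then have "?k \<in> fst ` set l" using l by (auto simp: ovp_upto_def)
      then show "b \<noteq> []" using fm lb by auto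
    qed
    moreover have "?k \<in> X \<longrightarrow> b = []"
      using l lb fb by (cases b) (auto simp: ovp_upto_def)
    moreover have "sum_list (map fst b) + sum_list (map fst m) = n"
      using l lb by (auto simp: ovp_upto_def overpartitions_eq)
    ultimately show ?thesis using lb fb
      by (intro exI[of _ "sum_list (map fst b)"] conjI bexI[of _ b] bexI[of _ m])
         (auto simp: ok_blocks_def blocks_def ovp_upto_def overpartitions_eq)
  qed
  show ?thesis
    unfolding bij_betw_def using inj app surj by (fastforce simp: image_iff)
qed

lemma card_ovp_upto_Suc:
  "card (ovp_upto R X (Suc N) n) = (\<Sum>i\<le>n. card (ok_blocks R X (Suc N) i) * card (ovp_upto R X N (n - i)))"
proof -
  have fin: "finite (ok_blocks R X (Suc N) i)" "finite (ovp_upto R X N j)" for i j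
    using finite_subset[OF _ finite_blocks[of "Suc N" i]] finite_subset[OF _ finite_overpartitions[of j]]
    by (auto simp: ok_blocks_def ovp_upto_def)
  show ?thesis
    using bij_betw_same_card[OF ovp_upto_Suc_bij, of n R X N] fin
    by (simp add: card_cartesian_product)
qed

lemma card_ovp_upto_0: "card (ovp_upto R X 0 n) = (if n = 0 then 1 else 0)"
proof -
  have "ovp_upto R X 0 n = (if n = 0 then {[]} else {})"
    by (auto simp: ovp_upto_def overpartitions_eq)
  then show ?thesis by simp
qed

lemma card_ok_blocks:
  assumes "k > 0"
  shows "card (ok_blocks R X k i) = (if i = 0 then if k \<in> R then 0 else 1 
     else if k dvd i \<and> k \<notin> X then 2 else 0)"
proof (cases "i = 0")
  case True
  then have "ok_blocks R X k i = (if k \<in> R then {} else {[]})"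
    using assms by (auto simp: ok_blocks_def blocks_eq)
  then show ?thesis using True by simp
next
  case False
  then have "ok_blocks R X k i = (if k \<in> X then {} else blocks k i)"
    using assms by (auto simp: ok_blocks_def blocks_def)
  then show ?thesis using False assms by (simp add: card_blocks)
qed

text \<open>
  The local factor of the part size \<open>k\<close>: \<open>1\<close> for the empty block and \<open>2 q\<^sup>k / (1 - q\<^sup>k)\<close> for the
  others.
\<close>
lemma ok_blocks_sums:
  fixes q :: "'a :: {real_normed_field, banach}"
  assumes "k > 0" "norm q < 1"
  shows "(\<lambda>i. of_nat (card (ok_blocks R X k i)) * q ^ i) sums
     ((if k \<in> R then 0 else 1) + (if k \<in> X then 0 else 2 * q ^ k / (1 - q ^ k)))"
    and "summable (\<lambda>i. norm (of_nat (card (ok_blocks R X k i)) * q ^ i))"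
proof -
  have sums: "(\<lambda>i. of_nat (card (ok_blocks R X k i)) * q ^ i) sums
     ((if k \<in> R then 0 else 1) + (if k \<in> X then 0 else 2 * q ^ k / (1 - q ^ k)))"
    if "norm q < 1" for q :: "'b :: {real_normed_field, banach}"
  proof -
    have qk: "norm (q ^ k) < 1" using that assms(1) by (simp add: norm_power power_less_one_iff)
    have "(\<lambda>j. 2 * q ^ k * (q ^ k) ^ j) sums (2 * q ^ k * (1 / (1 - q ^ k)))"
      by (intro sums_mult geometric_sums qk)
    also have "(\<lambda>j. 2 * q ^ k * (q ^ k) ^ j) = (\<lambda>j. (\<lambda>i. if i = 0 then 0 else if k dvd i then 2 * q ^ i else 0) (k * Suc j))"
      using assms(1) by (simp add: fun_eq_iff power_mult power_add)
    finally have "(\<lambda>i. if i = 0 then 0 else if k dvd i then 2 * q ^ i else 0) sums (2 * q ^ k / (1 - q ^ k))"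
    proof (subst (asm) sums_mono_reindex)
      show "strict_mono (\<lambda>j. k * Suc j)" using assms(1) by (simp add: strict_mono_def)
      fix i assume "i \<notin> range (\<lambda>j. k * Suc j)"
      moreover have "i \<in> range (\<lambda>j. k * Suc j)" if dvd: "k dvd i" "i \<noteq> 0"
      proof -
        obtain c where c: "i = k * c" using dvd(1) unfolding dvd_def by blast
        with dvd(2) obtain j where "c = Suc j" by (cases c) auto
        then show ?thesis using c by blast
      qed
      ultimately show "(if i = 0 then 0 else if k dvd i then 2 * q ^ i else 0) = 0" by auto
    qed simp
    then have "(\<lambda>i. (if k \<in> X then 0 else 1) * (if i = 0 then 0 else if k dvd i then 2 * q ^ i else 0)) sums
        ((if k \<in> X then 0 else 1) * (2 * q ^ k / (1 - q ^ k)))"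
      by (rule sums_mult)
    moreover have "(\<lambda>i. if i = 0 then (if k \<in> R then 0 else 1) else 0 :: 'b) sums (if k \<in> R then 0 else 1)"
      by (rule sums_single[of 0 "\<lambda>_. if k \<in> R then 0 else 1"])
    ultimately have "(\<lambda>i. (if i = 0 then (if k \<in> R then 0 else 1) else 0) +
        (if k \<in> X then 0 else 1) * (if i = 0 then 0 else if k dvd i then 2 * q ^ i else 0)) sums
        ((if k \<in> R then 0 else 1) + (if k \<in> X then 0 else 1) * (2 * q ^ k / (1 - q ^ k)))"
      by (intro sums_add)
    moreover have "(if i = 0 then (if k \<in> R then 0 else 1) else 0) +
        (if k \<in> X then 0 else 1) * (if i = 0 then 0 else if k dvd i then 2 * q ^ i else 0) =
        of_nat (card (ok_blocks R X k i)) * q ^ i" for i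
      using assms(1) by (auto simp: card_ok_blocks)
    moreover have "(if k \<in> X then 0 else 1 :: 'b) * (2 * q ^ k / (1 - q ^ k)) = (if k \<in> X then 0 else 2 * q ^ k / (1 - q ^ k))"
      by simp
    ultimately show ?thesis by (simp only:)
  qed
  show "(\<lambda>i. of_nat (card (ok_blocks R X k i)) * q ^ i) sums
     ((if k \<in> R then 0 else 1) + (if k \<in> X then 0 else 2 * q ^ k / (1 - q ^ k)))"
    by (rule sums) fact
  show "summable (\<lambda>i. norm (of_nat (card (ok_blocks R X k i)) * q ^ i))"
    using sums_summable[OF sums[of "norm q"]] assms(2) by (simp add: norm_mult norm_power)
qed

text \<open>
  The Euler product. By \<open>card_ovp_upto_Suc\<close> the counts for \<open>Suc N\<close> are a convolution, so each step
  of the induction is a Cauchy product with one local factor.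
\<close>
lemma ovp_upto_sums:
  fixes q :: "'a :: {real_normed_field, banach}"
  assumes "norm q < 1"
  shows "(\<lambda>n. of_nat (card (ovp_upto R X N n)) * q ^ n) sums
     (\<Prod>k=1..N. (if k \<in> R then 0 else 1) + (if k \<in> X then 0 else 2 * q ^ k / (1 - q ^ k)))"
    and "summable (\<lambda>n. norm (of_nat (card (ovp_upto R X N n)) * q ^ n))"
proof -
  have sums: "(\<lambda>n. of_nat (card (ovp_upto R X N n)) * q ^ n) sums
       (\<Prod>k=1..N. (if k \<in> R then 0 else 1) + (if k \<in> X then 0 else 2 * q ^ k / (1 - q ^ k))) \<and>
      summable (\<lambda>n. norm (of_nat (card (ovp_upto R X N n)) * q ^ n))"
    using assms
  proof (induction N)
    case 0
    have "(\<lambda>n. of_nat (card (ovp_upto R X 0 n)) * q ^ n) = (\<lambda>n. if n = 0 then 1 else 0)"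
      by (auto simp: card_ovp_upto_0)
    moreover have "(\<lambda>n. norm (of_nat (card (ovp_upto R X 0 n)) * q ^ n)) = (\<lambda>n. if n = 0 then 1 else 0)"
      by (auto simp: card_ovp_upto_0)
    moreover have "summable (\<lambda>n::nat. if n = 0 then 1 else 0 :: real)"
      by (rule sums_summable[OF sums_single])
    ultimately show ?case
      using sums_single[of 0 "\<lambda>_. 1::'a"] by (simp only:) simp
  next
    case (Suc N)
    let ?b = "\<lambda>i. of_nat (card (ok_blocks R X (Suc N) i)) * q ^ i"
    let ?c = "\<lambda>n. of_nat (card (ovp_upto R X N n)) * q ^ n"
    have coeff: "(\<Sum>i\<le>n. ?b i * ?c (n - i)) = of_nat (card (ovp_upto R X (Suc N) n)) * q ^ n" for n
    proof -
      have "(\<Sum>i\<le>n. ?b i * ?c (n - i)) =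
          (\<Sum>i\<le>n. of_nat (card (ok_blocks R X (Suc N) i)) * of_nat (card (ovp_upto R X N (n - i))) * (q ^ i * q ^ (n - i)))"
        by (simp add: algebra_simps)
      also have "\<dots> = (\<Sum>i\<le>n. of_nat (card (ok_blocks R X (Suc N) i)) * of_nat (card (ovp_upto R X N (n - i))) * q ^ n)"
        by (intro sum.cong) (auto simp flip: power_add)
      finally show ?thesis
        by (simp add: card_ovp_upto_Suc sum_distrib_right)
    qed
    have b: "summable (\<lambda>i. norm (?b i))" using ok_blocks_sums(2) Suc.prems by blast
    have c: "summable (\<lambda>i. norm (?c i))" using Suc by blast
    have "(\<lambda>n. \<Sum>i\<le>n. ?b i * ?c (n - i)) sums ((\<Sum>i. ?b i) * (\<Sum>i. ?c i))"
      by (rule Cauchy_product_sums[OF b c])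
    moreover have "(\<Sum>i. ?b i) = (if Suc N \<in> R then 0 else 1) + (if Suc N \<in> X then 0 else 2 * q ^ Suc N / (1 - q ^ Suc N))"
      using ok_blocks_sums(1)[of "Suc N" q R X] Suc.prems sums_unique by fastforce
    moreover have "(\<Sum>i. ?c i) = (\<Prod>k=1..N. (if k \<in> R then 0 else 1) + (if k \<in> X then 0 else 2 * q ^ k / (1 - q ^ k)))"
      using Suc sums_unique by fastforce
    moreover have "summable (\<lambda>n. norm (of_nat (card (ovp_upto R X (Suc N) n)) * q ^ n))"
    proof -
      have "summable (\<lambda>n. \<Sum>i\<le>n. norm (?b i) * norm (?c (n - i)))"
        using Cauchy_product_sums[of "\<lambda>i. norm (?b i)" "\<lambda>i. norm (?c i)"] b c by (auto simp: sums_iff)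
      then show ?thesis
        by (rule summable_comparison_test[rotated])
           (auto simp: coeff[symmetric] norm_mult[symmetric] intro!: norm_sum exI[of _ 0] simp del: norm_mult)
    qed
    moreover have "(\<Prod>k=1..Suc N. (if k \<in> R then 0 else 1) + (if k \<in> X then 0 else 2 * q ^ k / (1 - q ^ k))) =
        ((if Suc N \<in> R then 0 else 1) + (if Suc N \<in> X then 0 else 2 * q ^ Suc N / (1 - q ^ Suc N))) *
        (\<Prod>k=1..N. (if k \<in> R then 0 else 1) + (if k \<in> X then 0 else 2 * q ^ k / (1 - q ^ k)))"
      by (rule prod.nat_ivl_Suc') simp
    ultimately show ?case by (simp only: coeff)
  qed
  then show "(\<lambda>n. of_nat (card (ovp_upto R X N n)) * q ^ n) sums
     (\<Prod>k=1..N. (if k \<in> R then 0 else 1) + (if k \<in> X then 0 else 2 * q ^ k / (1 - q ^ k)))"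
    and "summable (\<lambda>n. norm (of_nat (card (ovp_upto R X N n)) * q ^ n))" by auto
qed

lemma mex_eq_iff:
  "mex l = m \<longleftrightarrow> m > 0 \<and> m \<notin> fst ` set l \<and> {1..<m} \<subseteq> fst ` set l"
proof -
  have ex: "\<exists>k>0. k \<notin> fst ` set l"
  proof -
    have "finite (insert 0 (fst ` set l))" by simp
    then obtain k where "k \<notin> insert 0 (fst ` set l)"
      using infinite_UNIV_nat ex_new_if_finite by blast
    then show ?thesis by auto
  qed
  show ?thesis
  proof
    assume m: "mex l = m"
    have "m > 0 \<and> m \<notin> fst ` set l"
      unfolding m[symmetric] mex_def set_map using ex by (rule LeastI_ex)
    moreover have "k \<in> fst ` set l" if "k \<in> {1..<m}" for k
      using not_less_Least[of k "\<lambda>m. m > 0 \<and> m \<notin> set (map fst l)"] that m by (auto simp: mex_def)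
    ultimately show "m > 0 \<and> m \<notin> fst ` set l \<and> {1..<m} \<subseteq> fst ` set l" by blast
  next
    assume m: "m > 0 \<and> m \<notin> fst ` set l \<and> {1..<m} \<subseteq> fst ` set l"
    show "mex l = m" unfolding mex_def
    proof (rule Least_equality)
      fix y assume "y > 0 \<and> y \<notin> set (map fst l)"
      then have "1 \<le> y" "y \<notin> fst ` set l" by auto
      then have "y \<notin> {1..<m}" using m by blast
      then show "m \<le> y" using \<open>1 \<le> y\<close> by simp
    qed (use m in auto)
  qed
qed

lemma part_le:
  assumes "l \<in> overpartitions n" "k \<in> fst ` set l"
  shows "1 \<le> k" "k \<le> n"
proof -
  show "1 \<le> k" using assms by (force simp: overpartitions_def)
  show "k \<le> n" using assms member_le_sum_list[of k "map fst l"] by (auto simp: overpartitions_def)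
qed

lemma mex_le: "l \<in> overpartitions n \<Longrightarrow> mex l \<le> Suc n"
proof (rule ccontr)
  assume l: "l \<in> overpartitions n" and "\<not> mex l \<le> Suc n"
  then have "Suc n \<in> {1..<mex l}" by auto
  then have "Suc n \<in> fst ` set l" using mex_eq_iff[of l "mex l"] by blast
  then show False using part_le[OF l] by fastforce
qed

definition mex_count :: "nat \<Rightarrow> nat \<Rightarrow> nat" where
  "mex_count m n = card {l \<in> overpartitions n. mex l = m}"

text \<open>
  Parts of an overpartition of \<open>n\<close> are at most \<open>n\<close>, so that the cutoff \<open>N\<close> excludes nothing.
\<close>
lemma mex_count_eq:
  assumes "m > 0" "N \<ge> n" "N \<ge> m"
  shows "mex_count m n = card (ovp_upto {1..<m} {m} N n)"
proof -
  have "l \<in> overpartitions n \<Longrightarrow> mex l = m \<longleftrightarrow>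
      fst ` set l \<subseteq> {1..N} - {m} \<and> {1..<m} \<inter> {1..N} \<subseteq> fst ` set l" for l
  proof -
    assume l: "l \<in> overpartitions n"
    have "fst ` set l \<subseteq> {1..N}" using part_le[OF l] assms by (meson atLeastAtMost_iff le_trans subsetI)
    moreover have "{1..<m} \<inter> {1..N} = {1..<m}" using assms by auto
    ultimately show ?thesis unfolding mex_eq_iff using assms by blast
  qed
  then have "{l \<in> overpartitions n. mex l = m} = ovp_upto {1..<m} {m} N n"
    unfolding ovp_upto_def by (intro Collect_cong) blast
  then show ?thesis by (simp add: mex_count_def)
qed

text \<open>
  All odd mex values \<open>2 i + 1\<close> that occur have \<open>i \<le> n\<close>, since the mex is at most \<open>Suc n\<close>. Keeping the
  sum finite lets it commute with the coefficient integrals.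
\<close>
lemma sigma_mex_odd_eq: "sigma_mex_odd n = (\<Sum>i\<le>n. (2 * i + 1) * mex_count (2 * i + 1) n)"
proof -
  have "mex_odd l = (\<Sum>i\<le>n. if mex l = 2 * i + 1 then 2 * i + 1 else 0)"
    if "l \<in> overpartitions n" for l
  proof (cases "odd (mex l)")
    case True
    then obtain j where j: "mex l = 2 * j + 1" by (elim oddE)
    have "(\<Sum>i\<le>n. if mex l = 2 * i + 1 then 2 * i + 1 else 0) = (\<Sum>i\<le>n. if i = j then 2 * j + 1 else 0)"
      by (intro sum.cong) (auto simp: j)
    also have "\<dots> = 2 * j + 1" using mex_le[OF that] j by simp
    finally show ?thesis using True j by (simp add: mex_odd_def)
  qed (auto simp: mex_odd_def intro!: sum.neutral[symmetric])
  then have "sigma_mex_odd n = (\<Sum>i\<le>n. \<Sum>l\<in>overpartitions n. if mex l = 2 * i + 1 then 2 * i + 1 else 0)"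
    unfolding sigma_mex_odd_def by (subst sum.swap) (auto intro!: sum.cong)
  also have "\<dots> = (\<Sum>i\<le>n. (2 * i + 1) * mex_count (2 * i + 1) n)"
    by (intro sum.cong refl)
       (simp add: sum.If_cases finite_overpartitions mex_count_def Int_def)
  finally show ?thesis .
qed

section \<open>The logarithm of the overpartition product\<close>

lemma log_ratio_sums:
  fixes w :: complex
  assumes "norm w < 1"
  shows "(\<lambda>j. 2 * w ^ (2 * j + 1) / of_nat (2 * j + 1)) sums (Ln (1 + w) - Ln (1 - w))"
proof -
  let ?f = "\<lambda>n. - ((- w) ^ n) / of_nat n - (- (w ^ n) / of_nat n)"
  have "(\<lambda>n. - ((- w) ^ n) / of_nat n) sums Ln (1 + w)" "(\<lambda>n. - (w ^ n) / of_nat n) sums Ln (1 - w)"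
    using Ln_series'[of w] Ln_series'[of "- w"] assms by auto
  then have "?f sums (Ln (1 + w) - Ln (1 - w))" by (rule sums_diff)
  moreover have "?f n = 0" if "n \<notin> range (\<lambda>j. 2 * j + 1)" for n
  proof -
    have "even n" using that by (metis oddE rangeI)
    then show ?thesis by simp
  qed
  ultimately have "(\<lambda>j. ?f (2 * j + 1)) sums (Ln (1 + w) - Ln (1 - w))"
    by (subst sums_mono_reindex) (auto simp: strict_mono_def)
  also have "(\<lambda>j. ?f (2 * j + 1)) = (\<lambda>j. 2 * w ^ (2 * j + 1) / of_nat (2 * j + 1))"
    by (auto simp: fun_eq_iff field_simps simp del: of_nat_Suc of_nat_add of_nat_mult)
  finally show ?thesis .
qed

definition ovp_prod :: "nat \<Rightarrow> 'a :: field \<Rightarrow> 'a" where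
  "ovp_prod N q = (\<Prod>k=1..N. (1 + q ^ k) / (1 - q ^ k))"

text \<open>
  The logarithm of \<open>P(exp (- z))\<close>. Expanding \<open>ln ((1 + q\<^sup>k) / (1 - q\<^sup>k))\<close> in odd powers and summing
  over \<open>k\<close> first gives this series, in which each term has a simple pole at \<open>z = 0\<close>.
\<close>
definition log_ovp :: "complex \<Rightarrow> complex" where
  "log_ovp z = (\<Sum>j. 2 / (of_nat (2 * j + 1) * (exp (of_nat (2 * j + 1) * z) - 1)))"

lemma norm_one_minus_ge: "1 - norm w \<le> norm (1 - w)" for w :: "'a :: real_normed_field"
  using norm_triangle_ineq2[of 1 w] by simp

lemma exp_minus_one_inverse:
  fixes z :: complex
  assumes "Re z > 0"
  shows "norm (1 / (exp z - 1)) \<le> exp (- Re z) / (1 - exp (- Re z))"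
    and "1 / (exp z - 1) = exp (- z) / (1 - exp (- z))"
proof -
  have n: "norm (exp (- z)) = exp (- Re z)" by simp
  have lt: "exp (- Re z) < 1" using assms by simp
  then have ne: "1 - exp (- z) \<noteq> 0" using n by (metis less_irrefl norm_one right_minus_eq)
  show eq: "1 / (exp z - 1) = exp (- z) / (1 - exp (- z))"
    using ne by (auto simp: exp_minus field_simps)
  have "1 - exp (- Re z) \<le> norm (1 - exp (- z))" using norm_one_minus_ge[of "exp (- z)"] n by simp
  then show "norm (1 / (exp z - 1)) \<le> exp (- Re z) / (1 - exp (- Re z))"
    unfolding eq norm_divide n using lt by (intro divide_left_mono mult_pos_pos) auto
qed

text \<open>
  For a finite product the sums over \<open>k\<close> and \<open>j\<close> can be exchanged freely; the passage to the limit
  under the sum over \<open>j\<close> is Tannery's theorem.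
\<close>
lemma ovp_prod_tendsto:
  assumes "Re z > 0"
  shows "(\<lambda>N. ovp_prod N (exp (- z))) \<longlonglongrightarrow> exp (log_ovp z)"
proof -
  define q where "q = exp (- z)"
  define r where "r = exp (- Re z)"
  have r: "norm q = r" "0 < r" "r < 1" using assms by (simp_all add: q_def r_def)
  define a where "a N j = (\<Sum>k=1..N. 2 * (q ^ k) ^ (2 * j + 1) / of_nat (2 * j + 1))" for N j
  have qk: "norm (q ^ k) < 1" if "k \<ge> 1" for k
    using r that by (simp add: norm_power power_less_one_iff)
  have ovp: "ovp_prod N q = exp (\<Sum>j. a N j)" for N
  proof -
    have "a N sums (\<Sum>k=1..N. Ln (1 + q ^ k) - Ln (1 - q ^ k))"
      unfolding a_def by (intro sums_sum log_ratio_sums qk) auto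
    then have "exp (\<Sum>j. a N j) = (\<Prod>k=1..N. exp (Ln (1 + q ^ k) - Ln (1 - q ^ k)))"
      by (simp add: sums_iff exp_sum)
    also have "\<dots> = ovp_prod N q"
      unfolding ovp_prod_def
    proof (intro prod.cong refl)
      fix k assume "k \<in> {1..N}"
      then have "norm (q ^ k) < 1" using qk by auto
      then have "1 + q ^ k \<noteq> 0" "1 - q ^ k \<noteq> 0"
        by (metis add_eq_0_iff less_irrefl norm_minus_cancel norm_one, metis less_irrefl norm_one right_minus_eq)
      then show "exp (Ln (1 + q ^ k) - Ln (1 - q ^ k)) = (1 + q ^ k) / (1 - q ^ k)"
        by (simp add: exp_diff)
    qed
    finally show ?thesis by simp
  qed
  have geo: "a N j = 2 / of_nat (2 * j + 1) * (\<Sum>k=1..N. (q ^ (2 * j + 1)) ^ k)" for N j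
  proof -
    have "(q ^ k) ^ (2 * j + 1) = (q ^ (2 * j + 1)) ^ k" for k by (metis mult.commute power_mult)
    then show ?thesis unfolding a_def sum_distrib_left by (intro sum.cong) simp_all
  qed
  have limit: "(\<lambda>N. a N j) \<longlonglongrightarrow> 2 / (of_nat (2 * j + 1) * (exp (of_nat (2 * j + 1) * z) - 1))" for j
  proof -
    let ?m = "2 * j + 1"
    have "norm (q ^ ?m) < 1" by (rule qk) simp
    then have "(\<lambda>k. q ^ ?m * (q ^ ?m) ^ k) sums (q ^ ?m * (1 / (1 - q ^ ?m)))"
      by (intro sums_mult geometric_sums)
    then have "(\<lambda>N. \<Sum>k<N. (q ^ ?m) ^ Suc k) \<longlonglongrightarrow> q ^ ?m / (1 - q ^ ?m)"
      by (simp only: sums_def power_Suc sum_distrib_left[symmetric] times_divide_eq_right mult_1_right)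
    also have "(\<lambda>N. \<Sum>k<N. (q ^ ?m) ^ Suc k) = (\<lambda>N. \<Sum>k=1..N. (q ^ ?m) ^ k)"
      by (simp only: sum.atLeast1_atMost_eq One_nat_def)
    also have "q ^ ?m / (1 - q ^ ?m) = 1 / (exp (of_nat ?m * z) - 1)"
    proof -
      have "Re (of_nat ?m * z) > 0" using assms by (simp del: of_nat_add of_nat_mult)
      moreover have "exp (- (of_nat ?m * z)) = q ^ ?m"
        using exp_of_nat_mult[of ?m "- z"] unfolding q_def by (simp only: mult_minus_right)
      ultimately show ?thesis using exp_minus_one_inverse(2)[of "of_nat ?m * z"] by (simp only:)
    qed
    finally have "(\<lambda>N. \<Sum>k=1..N. (q ^ ?m) ^ k) \<longlonglongrightarrow> 1 / (exp (of_nat ?m * z) - 1)" .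
    from tendsto_mult[OF tendsto_const[of "2 / of_nat ?m"] this] show ?thesis
      unfolding geo by (simp only: times_divide_times_eq mult_1_right)
  qed
  have bound: "norm (a N j) \<le> 2 / (1 - r) * r ^ j" for N j
  proof -
    let ?m = "2 * j + 1"
    have rm: "0 < r ^ ?m" "r ^ ?m < 1" using r by (auto simp: power_less_one_iff simp del: power_Suc)
    have "norm (a N j) \<le> 2 / real ?m * (\<Sum>k=1..N. (r ^ ?m) ^ k)"
      unfolding geo norm_mult norm_divide norm_of_nat norm_numeral
      by (intro mult_left_mono order.trans[OF norm_sum]) (auto simp: norm_power norm_mult r)
    also have "\<dots> \<le> 2 * (r ^ j / (1 - r))"
    proof (intro mult_mono)
      have "(\<Sum>k=1..N. (r ^ ?m) ^ k) = r ^ ?m * (\<Sum>k<N. (r ^ ?m) ^ k)"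
        unfolding sum_distrib_left by (simp add: sum.atLeast1_atMost_eq)
      also have "\<dots> \<le> r ^ j * (1 / (1 - r))"
      proof (rule mult_mono)
        have "(\<Sum>k<N. (r ^ ?m) ^ k) \<le> 1 / (1 - r ^ ?m)"
          using rm sum_le_suminf[of "\<lambda>k. (r ^ ?m) ^ k" "{..<N}"] suminf_geometric[of "r ^ ?m"]
            summable_geometric[of "r ^ ?m"] by simp
        also have "\<dots> \<le> 1 / (1 - r)"
          using r rm power_decreasing[of 1 ?m r] by (intro divide_left_mono) auto
        finally show "(\<Sum>k<N. (r ^ ?m) ^ k) \<le> 1 / (1 - r)" .
        show "r ^ ?m \<le> r ^ j" using r by (intro power_decreasing) auto
      qed (use r in \<open>auto intro!: sum_nonneg\<close>)
      finally show "(\<Sum>k=1..N. (r ^ ?m) ^ k) \<le> r ^ j / (1 - r)" by simp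
    qed (use rm r in \<open>auto intro!: sum_nonneg simp: field_simps\<close>)
    finally show ?thesis by simp
  qed
  have "(\<lambda>N. \<Sum>j. a N j) \<longlonglongrightarrow> log_ovp z"
    unfolding log_ovp_def
    using tannerys_theorem[where a = "\<lambda>j N. a N j" and F = sequentially and M = "\<lambda>j. 2 / (1 - r) * r ^ j", OF limit]
      bound r by (auto intro!: summable_mult summable_geometric always_eventually)
  then show ?thesis
    unfolding ovp[unfolded q_def] by (rule tendsto_exp)
qed

section \<open>Comparison with the real axis\<close>

text \<open>
  This is \<open>a\<^sup>2 \<le> 4 sinh\<^sup>2 (a / 2)\<close>.
\<close>
lemma exp_minus_one_square_ge:
  fixes a :: real
  assumes "a \<ge> 0"
  shows "a\<^sup>2 * exp a \<le> (exp a - 1)\<^sup>2"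
proof -
  let ?x = "a / 2"
  have "1 \<le> (1 + ?x + ?x\<^sup>2 / 2) * (1 - ?x + ?x\<^sup>2 / 2)"
    using assms by (simp add: algebra_simps power2_eq_square)
  also have "\<dots> \<le> exp ?x * (1 - ?x + ?x\<^sup>2 / 2)"
  proof (rule mult_right_mono)
    show "1 + ?x + ?x\<^sup>2 / 2 \<le> exp ?x" using exp_lower_Taylor_quadratic[of ?x] assms by simp
    have "0 \<le> (1 - ?x)\<^sup>2 + 1" by simp
    also have "\<dots> = 2 * (1 - ?x + ?x\<^sup>2 / 2)" by (simp add: power2_eq_square algebra_simps)
    finally show "0 \<le> 1 - ?x + ?x\<^sup>2 / 2" by simp
  qed
  finally have "exp (- ?x) \<le> 1 - ?x + ?x\<^sup>2 / 2"
    by (simp add: exp_minus field_simps)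
  moreover have "1 + ?x + ?x\<^sup>2 / 2 \<le> exp ?x" using exp_lower_Taylor_quadratic[of ?x] assms by simp
  ultimately have "a \<le> exp ?x - exp (- ?x)" by simp
  then have "a\<^sup>2 \<le> (exp ?x - exp (- ?x))\<^sup>2" using assms by (intro power_mono)
  then have "a\<^sup>2 * (exp ?x)\<^sup>2 \<le> (exp ?x - exp (- ?x))\<^sup>2 * (exp ?x)\<^sup>2" by (rule mult_right_mono) simp
  also have "\<dots> = ((exp ?x - exp (- ?x)) * exp ?x)\<^sup>2" by (simp add: power_mult_distrib)
  also have "(exp ?x - exp (- ?x)) * exp ?x = (exp ?x)\<^sup>2 - 1"
    by (simp add: left_diff_distrib power2_eq_square flip: exp_add)
  also have "(exp ?x)\<^sup>2 = exp a" by (simp add: power2_eq_square flip: exp_add)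
  finally show ?thesis .
qed

text \<open>
  The left-hand side is the derivative of \<open>1 / (exp s - 1) - 1 / s\<close>. Here \<open>exp s / (exp s - 1)\<^sup>2 = 1 / Q\<close>
  with \<open>Q = exp s + exp (- s) - 2\<close>. Away from \<open>0\<close> both fractions are at most \<open>1 / (Re s)\<^sup>2\<close>; near \<open>0\<close>
  the difference stays bounded because \<open>Q - s\<^sup>2 = O(s\<^sup>4)\<close>. The restriction to a sector makes \<open>\<bar>s\<bar>\<close>
  and \<open>Re s\<close> comparable.
\<close>
lemma deriv_polar_part_bound:
  fixes s :: complex
  assumes "Re s > 0" "\<bar>Im s\<bar> \<le> Re s"
  shows "norm (1 / s\<^sup>2 - exp s / (exp s - 1)\<^sup>2) \<le> 8 / (1 + Re s)\<^sup>2"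
proof -
  define a where "a = Re s"
  define Q where "Q = exp s + exp (- s) - 2"
  have a: "a > 0" using assms by (simp add: a_def)
  have Q: "(exp s - 1)\<^sup>2 = Q * exp s"
    by (simp add: Q_def power2_eq_square algebra_simps flip: exp_add)
  have ea: "exp a - 1 \<le> norm (exp s - 1)" "0 \<le> exp a - 1"
    using norm_triangle_ineq2[of "exp s" 1] a by (auto simp: a_def)
  have "a\<^sup>2 * exp a \<le> (exp a - 1)\<^sup>2" using a by (intro exp_minus_one_square_ge) simp
  also have "\<dots> \<le> (norm (exp s - 1))\<^sup>2" using ea by (intro power_mono)
  also have "\<dots> = norm Q * exp a" by (simp add: Q norm_mult a_def flip: norm_power)
  finally have Qa: "a\<^sup>2 \<le> norm Q" by simp
  have "0 < a\<^sup>2" using a by simp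
  then have Q0: "Q \<noteq> 0" using Qa by auto
  have s0: "s \<noteq> 0" using a by (auto simp: a_def)
  have as: "a \<le> norm s" using complex_Re_le_cmod[of s] by (simp add: a_def)
  have as2: "a\<^sup>2 \<le> (norm s)\<^sup>2" using as a by (intro power_mono) auto
  have sa: "(norm s)\<^sup>2 \<le> 2 * a\<^sup>2"
    using assms(2) power_mono[of "\<bar>Im s\<bar>" "Re s" 2] by (simp add: cmod_power2 a_def)
  have eq: "exp s / (exp s - 1)\<^sup>2 = 1 / Q" by (simp add: Q)
  show ?thesis unfolding eq a_def[symmetric]
  proof (cases "a \<le> 1")
    case False
    have "norm (1 / s\<^sup>2 - 1 / Q) \<le> 1 / (norm s)\<^sup>2 + 1 / norm Q"
      using norm_triangle_ineq4[of "1 / s\<^sup>2" "1 / Q"] by (simp add: norm_divide norm_power)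
    also have "\<dots> \<le> 1 / a\<^sup>2 + 1 / a\<^sup>2"
      using as2 Qa a s0 Q0 by (intro add_mono divide_left_mono mult_pos_pos) auto
    also have "\<dots> \<le> 8 / (1 + a)\<^sup>2"
    proof -
      have "(1 + a)\<^sup>2 \<le> (2 * a)\<^sup>2" using False by (intro power_mono) auto
      then show ?thesis using a by (simp add: field_simps power_mult_distrib)
    qed
    finally show "norm (1 / s\<^sup>2 - 1 / Q) \<le> 8 / (1 + a)\<^sup>2" .
  next
    case True
    let ?T = "\<lambda>s::complex. \<Sum>k\<le>3. s ^ k / fact k"
    have T: "?T s + ?T (- s) = 2 + s\<^sup>2"
      by (simp add: numeral_eq_Suc fact_numeral field_simps)
    have "norm (exp s - ?T s) \<le> exp \<bar>Re s\<bar> * norm s ^ Suc 3 / fact 3"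
      "norm (exp (- s) - ?T (- s)) \<le> exp \<bar>Re (- s)\<bar> * norm (- s) ^ Suc 3 / fact 3"
      by (rule Taylor_exp)+
    then have "norm ((exp s - ?T s) + (exp (- s) - ?T (- s))) \<le> 2 * (exp a * norm s ^ 4 / 6)"
      using norm_triangle_ineq[of "exp s - ?T s" "exp (- s) - ?T (- s)"] a
      by (simp add: a_def fact_numeral)
    also have "(exp s - ?T s) + (exp (- s) - ?T (- s)) = Q - s\<^sup>2"
      using T by (simp add: Q_def algebra_simps)
    also have "2 * (exp a * norm s ^ 4 / 6) \<le> 2 * (3 * norm s ^ 4 / 6)"
      using True exp_le order.trans[of "exp a" "exp 1" 3] by (intro mult_left_mono divide_right_mono mult_right_mono) auto
    finally have d: "norm (Q - s\<^sup>2) \<le> norm s ^ 4" by simp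
    have "norm (1 / s\<^sup>2 - 1 / Q) = norm (Q - s\<^sup>2) / ((norm s)\<^sup>2 * norm Q)"
      using s0 Q0 by (simp add: field_simps norm_divide norm_mult norm_power diff_divide_eq_iff
          flip: norm_mult norm_power norm_divide)
    also have "\<dots> \<le> norm s ^ 4 / ((norm s)\<^sup>2 * a\<^sup>2)"
      using d Qa a s0 Q0 by (intro frac_le mult_left_mono) auto
    also have "\<dots> = (norm s)\<^sup>2 / a\<^sup>2"
      using s0 by (simp add: power2_eq_square power4_eq_xxxx)
    also have "\<dots> \<le> 2" using sa a by (simp add: field_simps)
    also have "2 \<le> 8 / (1 + a)\<^sup>2"
    proof -
      have "(1 + a)\<^sup>2 \<le> 2\<^sup>2" using a True by (intro power_mono) auto
      then show ?thesis using a by (simp add: field_simps)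
    qed
    finally show "norm (1 / s\<^sup>2 - 1 / Q) \<le> 8 / (1 + a)\<^sup>2" .
  qed
qed

text \<open>
  Each term is at most the telescoping difference \<open>1 / (1 + j t) - 1 / (1 + (j + 1) t)\<close>. This makes
  the bound for the whole series independent of \<open>t\<close>.
\<close>
lemma odd_telescope_sum:
  fixes t :: real
  assumes "t > 0"
  shows "summable (\<lambda>j. t / (1 + real (2 * j + 1) * t)\<^sup>2)" "(\<Sum>j. t / (1 + real (2 * j + 1) * t)\<^sup>2) \<le> 1"
proof -
  have le: "t / (1 + real (2 * j + 1) * t)\<^sup>2 \<le> 1 / (1 + real j * t) - 1 / (1 + real (Suc j) * t)" for j
  proof -
    have p: "0 < 1 + real j * t" "0 < 1 + real (Suc j) * t" using assms by (auto intro: add_pos_nonneg)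
    have "t / (1 + real (2 * j + 1) * t)\<^sup>2 \<le> t / ((1 + real j * t) * (1 + real (Suc j) * t))"
      unfolding power2_eq_square using assms p
      by (intro divide_left_mono mult_mono add_left_mono mult_right_mono mult_pos_pos) (auto intro: add_pos_nonneg)
    also have "\<dots> = 1 / (1 + real j * t) - 1 / (1 + real (Suc j) * t)"
      using p by (simp add: diff_frac_eq) (simp add: algebra_simps)
    finally show ?thesis .
  qed
  have "(\<Sum>j<n. t / (1 + real (2 * j + 1) * t)\<^sup>2) \<le> 1" for n
  proof -
    have "(\<Sum>j<n. t / (1 + real (2 * j + 1) * t)\<^sup>2) \<le> (\<Sum>j<n. 1 / (1 + real j * t) - 1 / (1 + real (Suc j) * t))"
      by (intro sum_mono le)
    also have "\<dots> = 1 - 1 / (1 + real n * t)" by (subst sum_lessThan_telescope') simp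
    also have "\<dots> \<le> 1" using assms by simp
    finally show ?thesis .
  qed
  then show "summable (\<lambda>j. t / (1 + real (2 * j + 1) * t)\<^sup>2)" "(\<Sum>j. t / (1 + real (2 * j + 1) * t)\<^sup>2) \<le> 1"
    using assms by (auto intro!: summableI_nonneg_bounded suminf_le_const)
qed

lemma odd_inverse_squares_sums: "(\<lambda>j. 1 / real (2 * j + 1) ^ 2) sums (pi\<^sup>2 / 8)"
proof -
  have s: "(\<lambda>n. 1 / real (n + 1) ^ 2) sums (pi\<^sup>2 / 6)" using inverse_squares_sums by simp
  have "(\<lambda>n. \<Sum>i = n * 2..<n * 2 + 2. 1 / real (i + 1) ^ 2) sums (pi\<^sup>2 / 6)"
    by (rule sums_group[OF s]) simp
  moreover have "(\<Sum>i = n * 2..<n * 2 + 2. 1 / real (i + 1) ^ 2) = 1 / real (2 * n + 1) ^ 2 + 1 / 4 * (1 / real (n + 1) ^ 2)" for n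
  proof -
    have "{n * 2..<n * 2 + 2} = {2 * n, 2 * n + 1}" by auto
    moreover have "real (2 * n + 1 + 1) ^ 2 = 4 * real (n + 1) ^ 2" by (simp add: power2_eq_square algebra_simps)
    ultimately show ?thesis by simp
  qed
  ultimately have "(\<lambda>n. 1 / real (2 * n + 1) ^ 2 + 1 / 4 * (1 / real (n + 1) ^ 2)) sums (pi\<^sup>2 / 6)" by simp
  from sums_diff[OF this sums_mult[OF s, of "1 / 4"]] show ?thesis by simp
qed

lemma summable_log_ovp:
  assumes "Re z > 0"
  shows "summable (\<lambda>j. 2 / (of_nat (2 * j + 1) * (exp (of_nat (2 * j + 1) * z) - 1)))"
proof (rule summable_comparison_test')
  define r where "r = exp (- Re z)"
  have r: "0 < r" "r < 1" using assms by (auto simp: r_def)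
  show "summable (\<lambda>j. 2 / (1 - r) * r ^ j)" using r by (intro summable_mult summable_geometric) auto
  fix j :: nat
  let ?m = "2 * j + 1"
  have rm: "exp (- Re (of_nat ?m * z)) = r ^ ?m"
    using exp_of_nat_mult[of ?m "- Re z"] by (simp add: r_def)
  have "norm (1 / (exp (of_nat ?m * z) - 1)) \<le> r ^ ?m / (1 - r ^ ?m)"
    using exp_minus_one_inverse(1)[of "of_nat ?m * z"] assms unfolding rm by (simp del: of_nat_add of_nat_mult)
  also have "\<dots> \<le> r ^ j / (1 - r)"
    using r power_decreasing[of 1 ?m r] power_decreasing[of j ?m r] by (intro frac_le) auto
  finally have "norm (1 / (exp (of_nat ?m * z) - 1)) \<le> r ^ j / (1 - r)" .
  then have "2 / real ?m * norm (1 / (exp (of_nat ?m * z) - 1)) \<le> 2 * (r ^ j / (1 - r))"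
    using r by (intro mult_mono) (auto simp: field_simps)
  then show "norm (2 / (of_nat ?m * (exp (of_nat ?m * z) - 1))) \<le> 2 / (1 - r) * r ^ j"
    by (simp add: norm_divide norm_mult del: of_nat_add of_nat_mult of_nat_Suc)
qed

lemma log_ovp_polar_part:
  assumes "Re z > 0"
  shows "(\<lambda>j. 2 / of_nat (2 * j + 1) * (1 / (exp (of_nat (2 * j + 1) * z) - 1) - 1 / (of_nat (2 * j + 1) * z)))
     sums (log_ovp z - of_real (pi\<^sup>2) / (4 * z))"
proof -
  have z: "z \<noteq> 0" using assms by auto
  have "(\<lambda>j. 2 / z * of_real (1 / real (2 * j + 1) ^ 2)) sums (2 / z * of_real (pi\<^sup>2 / 8))"
    by (intro sums_mult sums_of_real odd_inverse_squares_sums)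
  from sums_diff[OF summable_sums[OF summable_log_ovp[OF assms], folded log_ovp_def] this]
  have "(\<lambda>j. 2 / (of_nat (2 * j + 1) * (exp (of_nat (2 * j + 1) * z) - 1)) - 2 / z * of_real (1 / real (2 * j + 1) ^ 2))
     sums (log_ovp z - 2 / z * of_real (pi\<^sup>2 / 8))" .
  moreover have "2 / z * of_real (pi\<^sup>2 / 8) = of_real (pi\<^sup>2) / (4 * z)" using z by simp
  moreover have "2 / (of_nat m * (w - 1)) - 2 / z * of_real (1 / real m ^ 2) =
      2 / of_nat m * (1 / (w - 1) - 1 / (of_nat m * z))" for m w
    by (simp add: right_diff_distrib power2_eq_square)
  ultimately show ?thesis by (simp only:)
qed

text \<open>
  The mean value theorem is applied to \<open>g s = 1 / (exp s - 1) - 1 / s\<close> on the vertical segments between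
  \<open>m z\<close> and \<open>m t\<close>; the factor \<open>m\<close> from their length cancels the \<open>1 / m\<close> of the series.
\<close>
lemma log_ovp_diff_bound:
  assumes "Re z = t" "t > 0" "\<bar>Im z\<bar> \<le> t"
  shows "norm ((log_ovp z - of_real (pi\<^sup>2) / (4 * z)) - (log_ovp (of_real t) - of_real (pi\<^sup>2) / (4 * of_real t)))
    \<le> 16 * \<bar>Im z\<bar> / t"
proof -
  define g where "g s = 1 / (exp s - 1) - 1 / s" for s :: complex
  let ?m = "\<lambda>j::nat. 2 * j + 1"
  let ?d = "\<lambda>j. 2 / of_nat (?m j) * (g (of_nat (?m j) * z) - g (of_nat (?m j) * of_real t))"
  have sums: "?d sums ((log_ovp z - of_real (pi\<^sup>2) / (4 * z)) - (log_ovp (of_real t) - of_real (pi\<^sup>2) / (4 * of_real t)))"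
    using sums_diff[OF log_ovp_polar_part[of z] log_ovp_polar_part[of "of_real t"]] assms
    by (simp add: g_def right_diff_distrib del: of_nat_add of_nat_mult of_nat_Suc)
  have bound: "norm (?d j) \<le> 16 * \<bar>Im z\<bar> / t * (t / (1 + real (?m j) * t)\<^sup>2)" for j
  proof -
    define m where "m = ?m j"
    define S where "S = {s. Re s = real m * t \<and> \<bar>Im s\<bar> \<le> real m * t}"
    have m: "m > 0" by (simp add: m_def)
    have mt: "real m * t > 0" using m assms by simp
    have "convex {s. Re s \<le> real m * t}" "convex {s. Re s \<ge> real m * t}" "convex {s. Im s \<le> real m * t}" "convex {s. Im s \<ge> - (real m * t)}"
      by (auto simp: convex_halfspace_Im_le convex_halfspace_Im_ge convex_halfspace_Re_le convex_halfspace_Re_ge)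
    then have "convex ({s. Re s \<le> real m * t} \<inter> {s. Re s \<ge> real m * t} \<inter> {s. Im s \<le> real m * t} \<inter> {s. Im s \<ge> - (real m * t)})"
      by (intro convex_Int)
    also have "\<dots> = S" by (auto simp: S_def)
    finally have cv: "convex S" .
    have "norm (g (of_nat m * z) - g (of_nat m * of_real t)) \<le>
       8 / (1 + real m * t)\<^sup>2 * norm (of_nat m * z - of_nat m * of_real t)"
    proof (rule field_differentiable_bound[OF cv])
      show "of_nat m * z \<in> S" "of_nat m * of_real t \<in> S"
        using assms m by (auto simp: S_def abs_mult)
      fix s assume s: "s \<in> S"
      then have Re: "Re s > 0" using mt by (simp add: S_def)
      then have "exp s \<noteq> 1" by (metis exp_le_one_iff linorder_not_le norm_exp_eq_Re norm_one order_refl)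
      moreover have "s \<noteq> 0" using Re by auto
      ultimately show "(g has_field_derivative (1 / s\<^sup>2 - exp s / (exp s - 1)\<^sup>2)) (at s within S)"
        unfolding g_def by (auto intro!: derivative_eq_intros simp: power2_eq_square)
      show "norm (1 / s\<^sup>2 - exp s / (exp s - 1)\<^sup>2) \<le> 8 / (1 + real m * t)\<^sup>2"
        using deriv_polar_part_bound[of s] Re s by (simp add: S_def)
    qed
    also have "norm (of_nat m * z - of_nat m * of_real t) = real m * \<bar>Im z\<bar>"
    proof -
      have "z - of_real t = \<i> * of_real (Im z)" using assms by (simp add: complex_eq_iff)
      then have "norm (z - of_real t) = \<bar>Im z\<bar>" by (simp add: norm_mult)
      then show ?thesis by (simp add: norm_mult flip: right_diff_distrib)
    qed
    finally have "2 / real m * norm (g (of_nat m * z) - g (of_nat m * of_real t)) \<le> 2 / real m * (8 / (1 + real m * t)\<^sup>2 * (real m * \<bar>Im z\<bar>))"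
      by (intro mult_left_mono) auto
    also have "\<dots> = 16 * \<bar>Im z\<bar> / t * (t / (1 + real m * t)\<^sup>2)"
      using m assms by simp
    finally show ?thesis unfolding m_def norm_mult norm_divide norm_of_nat norm_numeral .
  qed
  have "norm ((log_ovp z - of_real (pi\<^sup>2) / (4 * z)) - (log_ovp (of_real t) - of_real (pi\<^sup>2) / (4 * of_real t)))
      \<le> (\<Sum>j. 16 * \<bar>Im z\<bar> / t * (t / (1 + real (?m j) * t)\<^sup>2))"
    unfolding sums_unique[OF sums]
    by (rule norm_suminf_le[OF bound]) (rule summable_mult[OF odd_telescope_sum(1)[OF assms(2)]])
  also have "\<dots> = 16 * \<bar>Im z\<bar> / t * (\<Sum>j. t / (1 + real (?m j) * t)\<^sup>2)"
    using odd_telescope_sum(1)[OF assms(2)] by (rule suminf_mult)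
  also have "\<dots> \<le> 16 * \<bar>Im z\<bar> / t * 1"
    using odd_telescope_sum(2)[OF assms(2)] assms by (intro mult_left_mono) auto
  finally show ?thesis by simp
qed

section \<open>The product on the real axis\<close>

definition log_coth :: "real \<Rightarrow> real" where
  "log_coth x = ln ((1 + exp (- x)) / (1 - exp (- x)))"

lemma log_coth_nonneg: "x > 0 \<Longrightarrow> log_coth x \<ge> 0"
  by (simp add: log_coth_def field_simps)

text \<open>
  Put \<open>p = exp (- (x - d))\<close>, \<open>s = exp (- (x + d))\<close> and \<open>w = exp (- x)\<close>. Then \<open>p s = w\<^sup>2\<close>, so the product of the
  two cotangents only depends on \<open>p + s\<close>, and it grows with it, while \<open>p + s \<ge> 2 w\<close>.
\<close>
lemma log_coth_convex:
  assumes "0 < x - d" "d \<ge> 0"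
  shows "2 * log_coth x \<le> log_coth (x - d) + log_coth (x + d)"
proof -
  define p w s where "p = exp (- (x - d))" and "w = exp (- x)" and "s = exp (- (x + d))"
  have lt: "p < 1" "w < 1" "s < 1" "0 < p" "0 < w" "0 < s" using assms by (auto simp: p_def w_def s_def)
  have ps: "p * s = w\<^sup>2" by (simp add: p_def s_def w_def power2_eq_square flip: exp_add)
  have "p + s - 2 * w = w * (exp (d / 2) - exp (- d / 2))\<^sup>2"
    by (simp add: p_def s_def w_def power2_eq_square algebra_simps flip: exp_add)
  then have pw: "0 \<le> p + s - 2 * w" using lt by simp
  have "(1 + w)\<^sup>2 * ((1 - p) * (1 - s)) \<le> ((1 + p) * (1 + s)) * (1 - w)\<^sup>2"
  proof -
    have "((1 + p) * (1 + s)) * (1 - w)\<^sup>2 - (1 + w)\<^sup>2 * ((1 - p) * (1 - s)) =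
       (1 + p * s + (p + s)) * (1 - w)\<^sup>2 - (1 + w)\<^sup>2 * (1 + p * s - (p + s))"
      by (simp add: algebra_simps)
    also have "\<dots> = 2 * (1 + w\<^sup>2) * (p + s - 2 * w)"
      unfolding ps by (simp add: algebra_simps power2_eq_square)
    also have "\<dots> \<ge> 0" using pw by simp
    finally show ?thesis by simp
  qed
  then have "((1 + w) / (1 - w))\<^sup>2 \<le> (1 + p) / (1 - p) * ((1 + s) / (1 - s))"
    using lt by (simp add: power_divide divide_simps)
  then have "ln (((1 + w) / (1 - w))\<^sup>2) \<le> ln ((1 + p) / (1 - p) * ((1 + s) / (1 - s)))"
    using lt by (intro ln_mono) auto
  moreover have "ln ((1 + p) / (1 - p) * ((1 + s) / (1 - s))) = ln ((1 + p) / (1 - p)) + ln ((1 + s) / (1 - s))"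
    using lt by (subst ln_mult_pos) auto
  moreover have "ln (((1 + w) / (1 - w))\<^sup>2) = 2 * ln ((1 + w) / (1 - w))"
    using lt by (subst ln_realpow) auto
  ultimately show ?thesis by (simp only: p_def w_def s_def log_coth_def)
qed

definition log_ovp_real :: "real \<Rightarrow> real" where
  "log_ovp_real t = (\<Sum>j. 2 / (real (2 * j + 1) * (exp (real (2 * j + 1) * t) - 1)))"

lemma log_ovp_term_of_real:
  "2 / (of_nat m * (exp (of_nat m * of_real t) - 1)) = complex_of_real (2 / (real m * (exp (real m * t) - 1)))"
  by (simp flip: exp_of_real)

lemma summable_log_ovp_real:
  assumes "t > 0"
  shows "summable (\<lambda>j. 2 / (real (2 * j + 1) * (exp (real (2 * j + 1) * t) - 1)))"
  using summable_log_ovp[of "of_real t"] assms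
  unfolding log_ovp_term_of_real summable_complex_of_real by simp

lemma log_ovp_of_real: "t > 0 \<Longrightarrow> log_ovp (of_real t) = of_real (log_ovp_real t)"
  unfolding log_ovp_def log_ovp_real_def log_ovp_term_of_real
  by (rule suminf_of_real[symmetric, OF summable_log_ovp_real])

lemma ovp_prod_real_tendsto:
  assumes "t > 0"
  shows "(\<lambda>N. ovp_prod N (exp (- t))) \<longlonglongrightarrow> exp (log_ovp_real t)"
proof -
  have "complex_of_real (ovp_prod N (exp (- t))) = ovp_prod N (exp (- complex_of_real t))" for N
    by (simp add: ovp_prod_def flip: exp_of_real)
  then have "(\<lambda>N. complex_of_real (ovp_prod N (exp (- t)))) \<longlonglongrightarrow> of_real (exp (log_ovp_real t))"
    using ovp_prod_tendsto[of "of_real t"] assms by (simp only: log_ovp_of_real[OF assms] exp_of_real Re_complex_of_real)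
  then show ?thesis by (rule tendsto_of_real_iff[THEN iffD1])
qed

lemma sum_log_coth_tendsto:
  assumes "t > 0"
  shows "(\<lambda>N. \<Sum>k=1..N. log_coth (real k * t)) \<longlonglongrightarrow> log_ovp_real t"
proof -
  define h where "h k = (1 + exp (- t) ^ k) / (1 - exp (- t) ^ k)" for k
  have h_pos: "0 < h k" if "k \<ge> 1" for k
    unfolding h_def using assms that by (intro divide_pos_pos add_pos_pos) (auto simp: power_less_one_iff)
  have ln_h: "ln (h k) = log_coth (real k * t)" for k
    by (simp add: h_def log_coth_def exp_of_nat_mult[symmetric])
  have lim: "(\<lambda>N. ln (ovp_prod N (exp (- t)))) \<longlonglongrightarrow> ln (exp (log_ovp_real t))"
    by (intro tendsto_ln ovp_prod_real_tendsto assms) simp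
  have "ln (ovp_prod N (exp (- t))) = (\<Sum>k=1..N. log_coth (real k * t))" for N
  proof -
    have "h k \<noteq> 0" if "k \<in> {1..N}" for k using h_pos[of k] that by auto
    then have "ln (prod h {1..N}) = (\<Sum>k=1..N. ln (h k))" using h_pos by (intro ln_prod) auto
    moreover have "ovp_prod N (exp (- t)) = prod h {1..N}" by (simp add: ovp_prod_def h_def)
    ultimately show ?thesis by (simp only: ln_h)
  qed
  with lim show ?thesis by (simp only: ln_exp)
qed

definition coth_step :: "real \<Rightarrow> nat \<Rightarrow> real" where
  "coth_step t k = log_coth ((2 * real k - 1) * t) - log_coth (2 * real k * t)"

text \<open>
  In \<open>log P(q) - 2 log P(q\<^sup>2)\<close> an even index contributes once with weight \<open>1\<close> and once with weight
  \<open>- 2\<close>, which leaves an alternating sum.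
\<close>
lemma sum_coth_step:
  "(\<Sum>k=1..N. coth_step t k) = (\<Sum>k=1..2*N. log_coth (real k * t)) - 2 * (\<Sum>k=1..N. log_coth (real k * (2 * t)))"
proof (induction N)
  case (Suc N)
  have "2 * Suc N = Suc (Suc (2 * N))" by simp
  then show ?case using Suc 
    by (simp add: coth_step_def algebra_simps del: mult_Suc_right)
qed simp

lemma sum_coth_step_tendsto:
  assumes "t > 0"
  shows "(\<lambda>N. \<Sum>k=1..N. coth_step t k) \<longlonglongrightarrow> log_ovp_real t - 2 * log_ovp_real (2 * t)"
proof -
  have "filterlim (\<lambda>N. 2 * N) sequentially (sequentially :: nat filter)" by real_asymp
  note filterlim_compose[OF sum_log_coth_tendsto[OF assms] this]
  moreover have "(\<lambda>N. \<Sum>k=1..N. log_coth (real k * (2 * t))) \<longlonglongrightarrow> log_ovp_real (2 * t)"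
    using assms by (intro sum_log_coth_tendsto) simp
  ultimately show ?thesis
    unfolding sum_coth_step by (intro tendsto_diff tendsto_mult tendsto_const)
qed

text \<open>
  By convexity, a step of length \<open>t\<close> descends at least half as much as the two steps that begin
  with it and at most half as much as the two steps that end with it.
\<close>
lemma coth_step_bounds:
  assumes "t > 0" "k \<ge> 1"
  shows "log_coth ((2 * real k - 1) * t) - log_coth ((2 * real k + 1) * t) \<le> 2 * coth_step t k"
    and "k \<ge> 2 \<Longrightarrow> 2 * coth_step t k \<le> log_coth ((2 * real k - 2) * t) - log_coth (2 * real k * t)"
proof -
  have "0 < (2 * real k - 1) * t" using assms by (intro mult_pos_pos) auto
  then show "log_coth ((2 * real k - 1) * t) - log_coth ((2 * real k + 1) * t) \<le> 2 * coth_step t k"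
    using log_coth_convex[of "2 * real k * t" t] assms by (simp add: coth_step_def algebra_simps)
  assume "k \<ge> 2"
  then have "0 < (2 * real k - 2) * t" using assms by (intro mult_pos_pos) auto
  then show "2 * coth_step t k \<le> log_coth ((2 * real k - 2) * t) - log_coth (2 * real k * t)"
    using log_coth_convex[of "(2 * real k - 1) * t" t] assms by (simp add: coth_step_def algebra_simps)
qed

text \<open>
  The bounds of \<open>coth_step_bounds\<close> telescope over \<open>k > K\<close>. With \<open>K\<close> fixed, both sides have an
  explicit behaviour as \<open>t \<rightarrow> 0\<close>.
\<close>
lemma log_ovp_real_doubling_bounds:
  assumes t: "t > 0" and K: "K \<ge> 1"
  shows "(\<Sum>k=1..K. coth_step t k) + log_coth ((2 * real K + 1) * t) / 2 \<le> log_ovp_real t - 2 * log_ovp_real (2 * t)"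
    and "log_ovp_real t - 2 * log_ovp_real (2 * t) \<le> (\<Sum>k=1..K. coth_step t k) + log_coth (2 * real K * t) / 2"
proof -
  have up: "(\<Sum>k=1..N. coth_step t k) \<le> (\<Sum>k=1..K. coth_step t k) + (log_coth (2 * real K * t) - log_coth (2 * real N * t)) / 2"
    if "N \<ge> K" for N
    using that
  proof (induction N rule: dec_induct)
    case (step N)
    have "2 * coth_step t (Suc N) \<le> log_coth (2 * real N * t) - log_coth (2 * real (Suc N) * t)"
      using coth_step_bounds(2)[of t "Suc N"] t K step by (simp add: algebra_simps)
    moreover have "(\<Sum>k=1..Suc N. coth_step t k) = (\<Sum>k=1..N. coth_step t k) + coth_step t (Suc N)" by simp
    ultimately show ?case using step.IH by argo
  qed simp
  have lo: "(\<Sum>k=1..K. coth_step t k) + (log_coth ((2 * real K + 1) * t) - log_coth ((2 * real N + 1) * t)) / 2 \<le> (\<Sum>k=1..N. coth_step t k)"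
    if "N \<ge> K" for N
    using that
  proof (induction N rule: dec_induct)
    case (step N)
    have "log_coth ((2 * real N + 1) * t) - log_coth ((2 * real (Suc N) + 1) * t) \<le> 2 * coth_step t (Suc N)"
      using coth_step_bounds(1)[of t "Suc N"] t by (simp add: algebra_simps)
    moreover have "(\<Sum>k=1..Suc N. coth_step t k) = (\<Sum>k=1..N. coth_step t k) + coth_step t (Suc N)" by simp
    ultimately show ?case using step.IH by argo
  qed simp
  show "log_ovp_real t - 2 * log_ovp_real (2 * t) \<le> (\<Sum>k=1..K. coth_step t k) + log_coth (2 * real K * t) / 2"
  proof (rule tendsto_upperbound[OF sum_coth_step_tendsto[OF t]])
    show "\<forall>\<^sub>F N in sequentially. (\<Sum>k=1..N. coth_step t k) \<le> (\<Sum>k=1..K. coth_step t k) + log_coth (2 * real K * t) / 2"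
      using eventually_ge_at_top[of K]
    proof eventually_elim
      case (elim N)
      have "log_coth (2 * real N * t) \<ge> 0" using elim K t by (intro log_coth_nonneg) auto
      then show ?case using up[OF elim] by argo
    qed
  qed simp
  have "(\<lambda>N. log_coth ((2 * real N + 1) * t)) \<longlonglongrightarrow> 0"
    unfolding log_coth_def using t by real_asymp
  then have "(\<lambda>N. (\<Sum>k=1..K. coth_step t k) + (log_coth ((2 * real K + 1) * t) - log_coth ((2 * real N + 1) * t)) / 2)
     \<longlonglongrightarrow> (\<Sum>k=1..K. coth_step t k) + (log_coth ((2 * real K + 1) * t) - 0) / 2"
    by (intro tendsto_intros) auto
  then show "(\<Sum>k=1..K. coth_step t k) + log_coth ((2 * real K + 1) * t) / 2 \<le> log_ovp_real t - 2 * log_ovp_real (2 * t)"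
    using tendsto_le[OF _ sum_coth_step_tendsto[OF t]] eventually_mono[OF eventually_ge_at_top[of K] lo] by fastforce
qed

lemma log_coth_at_0:
  assumes "c > 0"
  shows "((\<lambda>t. log_coth (c * t) + ln t) \<longlongrightarrow> ln (2 / c)) (at_right 0)"
  unfolding log_coth_def using assms by real_asymp (simp add: field_simps)

lemma wallis_log:
  "(\<lambda>K. 2 * (\<Sum>k=1..K. ln (2 * real k / (2 * real k - 1))) - ln (2 * real K + 1)) \<longlonglongrightarrow> ln (pi / 2)"
proof -
  have "(\<Prod>k=1..K. (4 * real k ^ 2) / (4 * real k ^ 2 - 1)) = exp (2 * (\<Sum>k=1..K. ln (2 * real k / (2 * real k - 1))) - ln (2 * real K + 1))" for K
  proof (induction K)
    case (Suc K)
    let ?x = "2 * real (Suc K)"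
    have "exp (2 * ln (?x / (?x - 1)) - ln (?x + 1) + ln (?x - 1)) = (4 * real (Suc K) ^ 2) / (4 * real (Suc K) ^ 2 - 1)"
    proof -
      have x: "?x - 1 > 0" "?x + 1 > 0" "?x > 0" by auto
      have "exp (2 * ln (?x / (?x - 1)) - ln (?x + 1) + ln (?x - 1)) = (?x / (?x - 1))\<^sup>2 / (?x + 1) * (?x - 1)"
      proof -
        have "exp (ln (?x / (?x - 1))) = ?x / (?x - 1)" using x by (intro exp_ln divide_pos_pos)
        moreover have "exp (ln (?x + 1)) = ?x + 1" "exp (ln (?x - 1)) = ?x - 1" using x by (intro exp_ln; simp)+
        ultimately show ?thesis by (simp only: exp_add exp_diff exp_double)
      qed
      also have "\<dots> = ?x\<^sup>2 / (?x\<^sup>2 - 1)"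
      proof -
        have "?x\<^sup>2 - 1 = (?x - 1) * (?x + 1)" by (simp add: power2_eq_square algebra_simps)
        then show ?thesis using x by (simp add: power2_eq_square del: of_nat_Suc)
      qed
      finally show ?thesis by (simp add: power_mult_distrib del: of_nat_Suc)
    qed
    moreover have "2 * (\<Sum>k=1..Suc K. ln (2 * real k / (2 * real k - 1))) - ln (2 * real (Suc K) + 1) =
        (2 * (\<Sum>k=1..K. ln (2 * real k / (2 * real k - 1))) - ln (2 * real K + 1)) +
        (2 * ln (?x / (?x - 1)) - ln (?x + 1) + ln (?x - 1))"
    proof -
      have "ln (?x - 1) = ln (2 * real K + 1)" by simp
      then show ?thesis by (simp del: of_nat_Suc)
    qed
    moreover have "(\<Prod>k=1..Suc K. (4 * real k ^ 2) / (4 * real k ^ 2 - 1)) =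
        (\<Prod>k=1..K. (4 * real k ^ 2) / (4 * real k ^ 2 - 1)) * ((4 * real (Suc K) ^ 2) / (4 * real (Suc K) ^ 2 - 1))"
      by (simp del: of_nat_Suc)
    ultimately show ?case using Suc.IH by (simp only: exp_add)
  qed simp
  then have "(\<lambda>K. exp (2 * (\<Sum>k=1..K. ln (2 * real k / (2 * real k - 1))) - ln (2 * real K + 1))) \<longlonglongrightarrow> pi / 2"
    using wallis by simp
  from tendsto_ln[OF this] show ?thesis by simp
qed

text \<open>
  For fixed \<open>K\<close> the two bounds tend to partial Wallis products as \<open>t \<rightarrow> 0\<close>; then \<open>K \<rightarrow> \<infinity>\<close> closes the
  gap.
\<close>
lemma log_ovp_real_doubling:
  "((\<lambda>t. log_ovp_real t - 2 * log_ovp_real (2 * t) + ln t / 2) \<longlongrightarrow> ln pi / 2) (at_right 0)"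
proof -
  define W where "W K = (\<Sum>k=1..K. ln (2 * real k / (2 * real k - 1)))" for K :: nat
  have step: "((\<lambda>t. coth_step t k) \<longlongrightarrow> ln (2 * real k / (2 * real k - 1))) (at_right 0)" if "k \<ge> 1" for k
  proof -
    have "((\<lambda>t. (log_coth ((2 * real k - 1) * t) + ln t) - (log_coth (2 * real k * t) + ln t)) \<longlongrightarrow>
        ln (2 / (2 * real k - 1)) - ln (2 / (2 * real k))) (at_right 0)"
      using that by (intro tendsto_diff log_coth_at_0) auto
    moreover have "ln (2 / (2 * real k - 1)) - ln (2 / (2 * real k)) = ln (2 * real k / (2 * real k - 1))"
      using that by (simp add: ln_div ln_mult)
    ultimately show ?thesis by (simp add: coth_step_def)
  qed
  have sum: "((\<lambda>t. \<Sum>k=1..K. coth_step t k) \<longlongrightarrow> W K) (at_right 0)" for K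
    unfolding W_def by (intro tendsto_sum step) auto
  have lower: "\<forall>\<^sub>F t in at_right 0. a < log_ovp_real t - 2 * log_ovp_real (2 * t) + ln t / 2"
    if "a < W K + ln (2 / (2 * real K + 1)) / 2" "K \<ge> 1" for K a
  proof -
    have "((\<lambda>t. (\<Sum>k=1..K. coth_step t k) + (log_coth ((2 * real K + 1) * t) + ln t) / 2) \<longlongrightarrow> W K + ln (2 / (2 * real K + 1)) / 2) (at_right 0)"
      by (intro tendsto_intros sum log_coth_at_0) auto
    from order_tendstoD(1)[OF this that(1)] eventually_at_right_less[of 0]
    show ?thesis
      by eventually_elim (use log_ovp_real_doubling_bounds(1)[OF _ that(2)] in \<open>force simp: add_divide_distrib\<close>)
  qed
  have upper: "\<forall>\<^sub>F t in at_right 0. log_ovp_real t - 2 * log_ovp_real (2 * t) + ln t / 2 < a"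
    if "W K + ln (2 / (2 * real K)) / 2 < a" "K \<ge> 1" for K a
  proof -
    have "((\<lambda>t. (\<Sum>k=1..K. coth_step t k) + (log_coth (2 * real K * t) + ln t) / 2) \<longlongrightarrow> W K + ln (2 / (2 * real K)) / 2) (at_right 0)"
      using that(2) by (intro tendsto_intros sum log_coth_at_0) auto
    from order_tendstoD(2)[OF this that(1)] eventually_at_right_less[of 0]
    show ?thesis
      by eventually_elim (use log_ovp_real_doubling_bounds(2)[OF _ that(2)] in \<open>force simp: add_divide_distrib\<close>)
  qed
  have lim_lo: "(\<lambda>K. W K + ln (2 / (2 * real K + 1)) / 2) \<longlonglongrightarrow> ln pi / 2"
  proof -
    have "(\<lambda>K. (2 * W K - ln (2 * real K + 1) + ln 2) / 2) \<longlonglongrightarrow> (ln (pi / 2) + ln 2) / 2"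
      unfolding W_def by (intro tendsto_intros wallis_log) auto
    also have "ln (pi / 2) + ln 2 = ln pi" by (simp add: ln_div)
    also have "(\<lambda>K. (2 * W K - ln (2 * real K + 1) + ln 2) / 2) = (\<lambda>K. W K + ln (2 / (2 * real K + 1)) / 2)"
      by (simp add: fun_eq_iff ln_div field_simps)
    finally show ?thesis .
  qed
  have lim_hi: "(\<lambda>K. W K + ln (2 / (2 * real K)) / 2) \<longlonglongrightarrow> ln pi / 2"
  proof -
    have "(\<lambda>K. (ln (2 / (2 * real K)) - ln (2 / (2 * real K + 1))) / 2) \<longlonglongrightarrow> 0" by real_asymp
    from tendsto_add[OF lim_lo this] show ?thesis by (simp add: field_simps)
  qed
  show ?thesis
  proof (rule order_tendstoI)
    fix a assume "a < ln pi / 2"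
    from eventually_happens[OF eventually_conj[OF order_tendstoD(1)[OF lim_lo this] eventually_ge_at_top[of 1]]]
    show "\<forall>\<^sub>F t in at_right 0. a < log_ovp_real t - 2 * log_ovp_real (2 * t) + ln t / 2"
      using lower by auto
  next
    fix a assume "ln pi / 2 < a"
    from eventually_happens[OF eventually_conj[OF order_tendstoD(2)[OF lim_hi this] eventually_ge_at_top[of 1]]]
    show "\<forall>\<^sub>F t in at_right 0. log_ovp_real t - 2 * log_ovp_real (2 * t) + ln t / 2 < a"
      using upper by auto
  qed
qed

text \<open>
  Solving the relation for \<open>E t\<close> gives \<open>E t = E (t / 2) / 2 + o(1)\<close>. Iteration expresses \<open>E t\<close> by
  \<open>E (t / 2\<^sup>m) / 2\<^sup>m\<close>, which vanishes as \<open>m \<rightarrow> \<infinity>\<close> for fixed \<open>t\<close> if \<open>E\<close> is \<open>o(1 / t)\<close>, and by a geometric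
  sum of small errors.
\<close>
lemma tendsto_0_of_doubling:
  fixes E :: "real \<Rightarrow> real"
  assumes "((\<lambda>t. 2 * E (2 * t) - E t) \<longlongrightarrow> 0) (at_right 0)"
    and "((\<lambda>t. t * E t) \<longlongrightarrow> 0) (at_right 0)"
  shows "(E \<longlongrightarrow> 0) (at_right 0)"
proof (rule tendstoI)
  fix \<epsilon> :: real assume "\<epsilon> > 0"
  then have "\<forall>\<^sub>F t in at_right 0. dist (2 * E (2 * t) - E t) 0 < \<epsilon> / 2"
    using tendstoD[OF assms(1), of "\<epsilon> / 2"] by simp
  then obtain \<delta> where \<delta>: "\<delta> > 0" "\<And>t. 0 < t \<Longrightarrow> t < \<delta> \<Longrightarrow> \<bar>2 * E (2 * t) - E t\<bar> < \<epsilon> / 2"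
    by (auto simp: eventually_at_right_field)
  have iter: "\<bar>E t\<bar> \<le> \<bar>E (t / 2 ^ m)\<bar> / 2 ^ m + \<epsilon> / 2 * (1 - 1 / 2 ^ m)" if "0 < t" "t < \<delta>" for t m
  proof (induction m)
    case (Suc m)
    have "t / 2 ^ Suc m \<le> t" using that divide_left_mono[of 1 "2 ^ Suc m" t] one_le_power[of "2::real" "Suc m"] by simp
    then have "\<bar>2 * E (2 * (t / 2 ^ Suc m)) - E (t / 2 ^ Suc m)\<bar> < \<epsilon> / 2"
      using that by (intro \<delta>) auto
    moreover have "2 * (t / 2 ^ Suc m) = t / 2 ^ m" by simp
    ultimately have "\<bar>E (t / 2 ^ m)\<bar> \<le> \<bar>E (t / 2 ^ Suc m)\<bar> / 2 + \<epsilon> / 4" by (simp only:)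
    then have "\<bar>E (t / 2 ^ m)\<bar> / 2 ^ m \<le> (\<bar>E (t / 2 ^ Suc m)\<bar> / 2 + \<epsilon> / 4) / 2 ^ m"
      by (intro divide_right_mono) auto
    then show ?case using Suc by (simp add: field_simps)
  qed simp
  have "\<bar>E t\<bar> \<le> \<epsilon> / 2" if t: "0 < t" "t < \<delta>" for t
  proof -
    have "filterlim (\<lambda>m::nat. t / 2 ^ m) (at_right 0) sequentially" using t by real_asymp
    from filterlim_compose[OF assms(2) this]
    have "(\<lambda>m. 1 / t * \<bar>t / 2 ^ m * E (t / 2 ^ m)\<bar> + \<epsilon> / 2) \<longlonglongrightarrow> 1 / t * \<bar>0\<bar> + \<epsilon> / 2"
      by (intro tendsto_intros)
    moreover have "\<bar>E t\<bar> \<le> 1 / t * \<bar>t / 2 ^ m * E (t / 2 ^ m)\<bar> + \<epsilon> / 2" for m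
    proof -
      define c where "c = \<epsilon> / 2 * (1 - 1 / 2 ^ m)"
      have "c \<le> \<epsilon> / 2 * 1" unfolding c_def using \<open>\<epsilon> > 0\<close> by (intro mult_left_mono) auto
      moreover have "1 / t * \<bar>t / 2 ^ m * E (t / 2 ^ m)\<bar> = \<bar>E (t / 2 ^ m)\<bar> / 2 ^ m"
        using t by (simp add: abs_mult)
      ultimately show ?thesis using iter[OF t, of m, folded c_def] by linarith
    qed
    ultimately show ?thesis by (intro tendsto_lowerbound[of _ _ sequentially]) auto
  qed
  then show "\<forall>\<^sub>F t in at_right 0. dist (E t) 0 < \<epsilon>"
    using \<delta>(1) \<open>\<epsilon> > 0\<close> unfolding eventually_at_right_field by (intro exI[of _ \<delta>]) force
qed

text \<open>
  Termwise \<open>t / (exp (j t) - 1) \<rightarrow> 1 / j\<close>, and \<open>1 / j\<close> is also an upper bound. This provides the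
  \<open>o(1 / t)\<close> that \<open>tendsto_0_of_doubling\<close> starts from.
\<close>
lemma log_ovp_real_leading: "((\<lambda>t. t * log_ovp_real t) \<longlongrightarrow> pi\<^sup>2 / 4) (at_right 0)"
proof -
  let ?a = "\<lambda>j t. t * (2 / (real (2 * j + 1) * (exp (real (2 * j + 1) * t) - 1)))"
  have lim: "(?a j \<longlongrightarrow> 2 * (1 / real (2 * j + 1) ^ 2)) (at_right 0)" for j
    by real_asymp (simp add: field_simps power2_eq_square)
  have "norm (?a j t) \<le> 2 * (1 / real (2 * j + 1) ^ 2)" if "t > 0" for j t
  proof -
    have "real (2 * j + 1) * t \<le> exp (real (2 * j + 1) * t) - 1"
      using exp_ge_add_one_self[of "real (2 * j + 1) * t"] by (simp only: le_diff_eq add.commute)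
    moreover have p: "real (2 * j + 1) * t > 0" using that by (intro mult_pos_pos) auto
    ultimately have "?a j t \<le> t * (2 / (real (2 * j + 1) * (real (2 * j + 1) * t)))"
      using that by (intro mult_left_mono divide_left_mono mult_pos_pos) auto
    also have "\<dots> = 2 * (1 / real (2 * j + 1) ^ 2)" using that by (simp add: power2_eq_square)
    finally show ?thesis using that p by simp
  qed
  then have "\<forall>\<^sub>F (j, t) in at_top \<times>\<^sub>F at_right 0. norm (?a j t) \<le> 2 * (1 / real (2 * j + 1) ^ 2)"
    using eventually_prod1[of "at_right (0::real)" "\<lambda>_. True" at_top] eventually_at_right_less[of "0::real"]
    by (auto simp: eventually_prod_filter case_prod_beta intro!: exI[of _ "\<lambda>_. True"] exI[of _ "\<lambda>t. t > 0"])
  moreover have "summable (\<lambda>j. 2 * (1 / real (2 * j + 1) ^ 2))"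
    using odd_inverse_squares_sums by (intro summable_mult) (simp only: sums_iff)
  ultimately have "((\<lambda>t. \<Sum>j. ?a j t) \<longlongrightarrow> (\<Sum>j. 2 * (1 / real (2 * j + 1) ^ 2))) (at_right 0)"
    using tannerys_theorem[OF lim, of "\<lambda>j. j" "\<lambda>j. 2 * (1 / real (2 * j + 1) ^ 2)"] trivial_limit_at_right_real[of 0]
    by blast
  also have "(\<Sum>j. 2 * (1 / real (2 * j + 1) ^ 2)) = pi\<^sup>2 / 4"
    using odd_inverse_squares_sums by (subst suminf_mult) (auto simp: sums_iff)
  finally show ?thesis
  proof (rule Lim_transform_eventually)
    show "\<forall>\<^sub>F t in at_right 0. (\<Sum>j. ?a j t) = t * log_ovp_real t"
      unfolding log_ovp_real_def using eventually_at_right_less[of "0::real"]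
    proof eventually_elim
      case (elim t)
      show ?case by (rule suminf_mult[OF summable_log_ovp_real[OF elim]])
    qed
  qed
qed

lemma log_ovp_real_asymp:
  "((\<lambda>t. log_ovp_real t - (pi\<^sup>2 / (4 * t) + ln t / 2 - ln (4 * pi) / 2)) \<longlongrightarrow> 0) (at_right 0)"
proof (rule tendsto_0_of_doubling)
  let ?E = "\<lambda>t. log_ovp_real t - (pi\<^sup>2 / (4 * t) + ln t / 2 - ln (4 * pi) / 2)"
  have "((\<lambda>t. ln pi / 2 - (log_ovp_real t - 2 * log_ovp_real (2 * t) + ln t / 2)) \<longlongrightarrow> ln pi / 2 - ln pi / 2) (at_right 0)"
    by (intro tendsto_intros log_ovp_real_doubling)
  then have "((\<lambda>t. ln pi / 2 - (log_ovp_real t - 2 * log_ovp_real (2 * t) + ln t / 2)) \<longlongrightarrow> 0) (at_right 0)" by simp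
  moreover have "\<forall>\<^sub>F t in at_right 0. ln pi / 2 - (log_ovp_real t - 2 * log_ovp_real (2 * t) + ln t / 2) = 2 * ?E (2 * t) - ?E t"
    using eventually_at_right_less[of "0::real"]
  proof eventually_elim
    case (elim t)
    have "ln (4 * pi) = 2 * ln 2 + ln pi" using ln_realpow[of 2 2] by (simp add: ln_mult)
    then show ?case using elim by (simp add: ln_mult field_simps)
  qed
  ultimately show "((\<lambda>t. 2 * ?E (2 * t) - ?E t) \<longlongrightarrow> 0) (at_right 0)"
    by (rule Lim_transform_eventually)
  have "((\<lambda>t. t * (ln t / 2 - ln (4 * pi) / 2)) \<longlongrightarrow> 0) (at_right 0)" by real_asymp
  then have "((\<lambda>t. t * log_ovp_real t - pi\<^sup>2 / 4 - t * (ln t / 2 - ln (4 * pi) / 2)) \<longlongrightarrow> pi\<^sup>2 / 4 - pi\<^sup>2 / 4 - 0) (at_right 0)"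
    by (intro tendsto_intros log_ovp_real_leading)
  then have "((\<lambda>t. t * log_ovp_real t - pi\<^sup>2 / 4 - t * (ln t / 2 - ln (4 * pi) / 2)) \<longlongrightarrow> 0) (at_right 0)" by simp
  moreover have "\<forall>\<^sub>F t in at_right 0. t * log_ovp_real t - pi\<^sup>2 / 4 - t * (ln t / 2 - ln (4 * pi) / 2) = t * ?E t"
    using eventually_at_right_less[of "0::real"] by eventually_elim (simp add: field_simps)
  ultimately show "((\<lambda>t. t * ?E t) \<longlongrightarrow> 0) (at_right 0)" by (rule Lim_transform_eventually)
qed

section \<open>The mean of the odd mex\<close>

text \<open>
  The generating function of the overpartitions with mex \<open>m\<close>, divided by that of all overpartitions.
\<close>
definition mex_weight :: "nat \<Rightarrow> 'a :: field \<Rightarrow> 'a" where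
  "mex_weight m q = (\<Prod>k=1..<m. 2 * q ^ k / (1 + q ^ k)) * ((1 - q ^ m) / (1 + q ^ m))"

lemma one_minus_cos_le: "1 - cos x \<le> x\<^sup>2 / 2" for x :: real
proof -
  have "\<bar>sin (x / 2)\<bar>\<^sup>2 \<le> \<bar>x / 2\<bar>\<^sup>2" by (intro power_mono abs_sin_x_le_abs_x) auto
  then show ?thesis using cos_double_sin[of "x / 2"] by (simp add: power_divide)
qed

lemma polar_sum_of_squares: "(1 + e * cos x)\<^sup>2 + (e * sin x)\<^sup>2 = 1 + 2 * e * cos x + e\<^sup>2" for e x :: real
proof -
  have "(1 + e * c)\<^sup>2 + (e * s)\<^sup>2 = 1 + 2 * e * c + e\<^sup>2 * (s\<^sup>2 + c\<^sup>2)" for s c :: real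
    by (simp add: power2_eq_square algebra_simps)
  then show ?thesis by simp
qed

lemma norm_one_plus_exp_sq: "(norm (1 + exp w))\<^sup>2 = 1 + 2 * exp (Re w) * cos (Im w) + exp (Re w) ^ 2"
  using polar_sum_of_squares[of "exp (Re w)" "Im w"] by (simp add: cmod_power2 Re_exp Im_exp)

text \<open>
  Since \<open>exp a + exp (- a) \<ge> 2 + a\<^sup>2\<close> and \<open>2 cos b \<ge> 2 - b\<^sup>2\<close>, an imaginary part \<open>b\<close> with \<open>\<bar>b\<bar> \<le> a\<close> costs no
  more than what the real part gains.
\<close>
lemma norm_one_plus_exp_ge:
  assumes "Re w \<ge> 0" "\<bar>Im w\<bar> \<le> Re w"
  shows "2 * exp (Re w / 2) \<le> norm (1 + exp w)"
proof -
  define a where "a = Re w"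
  have "(Im w)\<^sup>2 \<le> a\<^sup>2" using assms power_mono[of "\<bar>Im w\<bar>" a 2] by (simp add: a_def)
  then have "1 - a\<^sup>2 / 2 \<le> cos (Im w)" using one_minus_cos_le[of "Im w"] by simp
  then have "2 * exp a * (1 - a\<^sup>2 / 2) \<le> 2 * exp a * cos (Im w)" by (intro mult_left_mono) auto
  moreover have "a\<^sup>2 * exp a \<le> (exp a - 1)\<^sup>2" using assms by (intro exp_minus_one_square_ge) (simp add: a_def)
  ultimately have "4 * exp a \<le> 1 + 2 * exp a * cos (Im w) + exp a ^ 2"
    by (simp add: power2_eq_square algebra_simps)
  also have "\<dots> = (norm (1 + exp w))\<^sup>2" by (simp add: norm_one_plus_exp_sq a_def)
  also have "4 * exp a = (2 * exp (a / 2))\<^sup>2" by (simp add: power_mult_distrib flip: exp_double)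
  finally show ?thesis unfolding a_def by (rule power2_le_imp_le) simp
qed

lemma norm_one_minus_exp_le:
  assumes "Re w \<ge> 0"
  shows "norm (1 - exp (- w)) \<le> norm w"
proof -
  define a where "a = Re w"
  have "(norm (1 - exp (- w)))\<^sup>2 = (1 - exp (- a) * cos (Im w))\<^sup>2 + (exp (- a) * sin (Im w))\<^sup>2"
    by (simp add: cmod_power2 Re_exp Im_exp a_def)
  also have "\<dots> = 1 - 2 * exp (- a) * cos (Im w) + exp (- a) ^ 2"
    using polar_sum_of_squares[of "- exp (- a)" "Im w"] by simp
  also have "\<dots> = (1 - exp (- a))\<^sup>2 + 2 * exp (- a) * (1 - cos (Im w))"
    by (simp add: power2_eq_square algebra_simps)
  also have "\<dots> \<le> a\<^sup>2 + 2 * 1 * ((Im w)\<^sup>2 / 2)"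
    using exp_ge_add_one_self[of "- a"] assms one_minus_cos_le[of "Im w"]
    by (intro add_mono power_mono mult_mono) (auto simp: a_def)
  also have "\<dots> = (norm w)\<^sup>2" by (simp add: cmod_power2 a_def)
  finally show ?thesis by (rule power2_le_imp_le) simp
qed

lemma mex_weight_exp:
  "mex_weight m (exp (- z)) = (\<Prod>k=1..<m. 2 / (1 + exp (of_nat k * z))) * ((1 - exp (- (of_nat m * z))) / (1 + exp (- (of_nat m * z))))"
  for z :: complex
proof -
  have pow: "exp (- z) ^ k = exp (- (of_nat k * z))" for k
    using exp_of_nat_mult[of k "- z"] by simp
  have "2 * exp (- w) / (1 + exp (- w)) = 2 / (1 + exp w)" for w :: complex
  proof -
    have "exp w * (1 + exp (- w)) = 1 + exp w" by (simp add: algebra_simps flip: exp_add)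
    then have "2 / (1 + exp w) = (exp w * (2 * exp (- w))) / (exp w * (1 + exp (- w)))"
      by (simp flip: exp_add)
    then show ?thesis by simp
  qed
  then show ?thesis unfolding mex_weight_def pow by simp
qed

text \<open>
  Each of the factors \<open>2 / (1 + exp (k z))\<close> is at most \<open>exp (- k t / 2)\<close>, which already is Gaussian
  decay in \<open>m\<close>; the numerator \<open>1 - exp (- m z)\<close> contributes \<open>m t\<close>.
\<close>
lemma mex_weight_bound:
  assumes "Re z = t" "t > 0" "\<bar>Im z\<bar> \<le> t" "m \<ge> 1"
  shows "norm (mex_weight m (exp (- z))) \<le> real m * t * exp (- t * real m * (real m - 3) / 4)"
proof -
  have w: "Re (of_nat k * z) \<ge> 0" "\<bar>Im (of_nat k * z)\<bar> \<le> Re (of_nat k * z)" for k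
    using assms by (auto simp: abs_mult mult_left_mono)
  have fac: "norm (2 / (1 + exp (of_nat k * z))) \<le> exp (- (t / 2)) ^ k" for k
  proof -
    have "norm (2 / (1 + exp (of_nat k * z))) \<le> 2 / (2 * exp (Re (of_nat k * z) / 2))"
    proof -
      have "0 < 2 * exp (Re (of_nat k * z) / 2)" by simp
      from less_le_trans[OF this norm_one_plus_exp_ge[OF w]] this show ?thesis
        unfolding norm_divide norm_numeral using norm_one_plus_exp_ge[OF w]
        by (intro divide_left_mono mult_pos_pos) simp_all
    qed
    also have "\<dots> = exp (- (t / 2)) ^ k"
      using assms exp_of_nat_mult[of k "- (t / 2)"] by (simp add: exp_minus field_simps)
    finally show ?thesis .
  qed
  have "norm (\<Prod>k=1..<m. 2 / (1 + exp (of_nat k * z))) \<le> (\<Prod>k=1..<m. exp (- (t / 2)) ^ k)"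
    unfolding prod_norm[symmetric] by (intro prod_mono) (auto intro: fac)
  also have "\<dots> = exp (\<Sum>k=1..<m. - (t / 2) * real k)"
    by (simp add: exp_sum mult.commute flip: exp_of_nat_mult)
  also have "(\<Sum>k=1..<m. - (t / 2) * real k) = - t * real m * (real m - 1) / 4"
  proof -
    have "(\<Sum>k=1..<m. real k) = real m * (real m - 1) / 2"
      using assms(4) by (induction m rule: dec_induct) (auto simp: field_simps)
    moreover have "(\<Sum>k=1..<m. - (t / 2) * real k) = - (t / 2) * (\<Sum>k=1..<m. real k)"
      by (rule sum_distrib_left[symmetric])
    ultimately show ?thesis by simp
  qed
  finally have P: "norm (\<Prod>k=1..<m. 2 / (1 + exp (of_nat k * z))) \<le> exp (- t * real m * (real m - 1) / 4)" .
  have num: "norm (1 - exp (- (of_nat m * z))) \<le> 2 * (real m * t)"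
  proof -
    have "norm (1 - exp (- (of_nat m * z))) \<le> norm (of_nat m * z)" by (intro norm_one_minus_exp_le w)
    also have "\<dots> = real m * norm z" by (simp add: norm_mult)
    also have "norm z \<le> 2 * t" using cmod_le[of z] assms by simp
    finally show ?thesis by (simp add: mult_left_mono mult.left_commute)
  qed
  have den: "2 * exp (- (real m * t / 2)) \<le> norm (1 + exp (- (of_nat m * z)))"
  proof -
    have "1 + exp (- (of_nat m * z)) = exp (- (of_nat m * z)) * (1 + exp (of_nat m * z))"
      by (simp add: distrib_left flip: exp_add)
    then have "norm (1 + exp (- (of_nat m * z))) = exp (- (real m * t)) * norm (1 + exp (of_nat m * z))"
      using assms by (simp add: norm_mult)
    also have "\<dots> \<ge> exp (- (real m * t)) * (2 * exp (real m * t / 2))"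
      using norm_one_plus_exp_ge[OF w[of m]] assms by (intro mult_left_mono) auto
    also have "exp (- (real m * t)) * (2 * exp (real m * t / 2)) = 2 * exp (- (real m * t / 2))"
      by (simp flip: exp_add)
    finally show ?thesis .
  qed
  have "norm (mex_weight m (exp (- z))) \<le> exp (- t * real m * (real m - 1) / 4) * (2 * (real m * t) / (2 * exp (- (real m * t / 2))))"
    unfolding mex_weight_exp norm_mult norm_divide
    using P num den assms by (intro mult_mono frac_le) auto
  also have "\<dots> = real m * t * (exp (- t * real m * (real m - 1) / 4) * exp (real m * t / 2))"
    by (simp add: exp_minus field_simps)
  also have "exp (- t * real m * (real m - 1) / 4) * exp (real m * t / 2) = exp (- t * real m * (real m - 3) / 4)"
  proof -
    have "- t * real m * (real m - 1) / 4 + real m * t / 2 = - t * real m * (real m - 3) / 4"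
      by (simp add: field_simps)
    then show ?thesis by (simp only: exp_add[symmetric])
  qed
  finally show ?thesis .
qed

lemma norm_cosh_minus_one_le: "norm (cosh v - 1) \<le> exp (norm v) * (norm v)\<^sup>2" for v :: complex
proof -
  have b: "norm (exp v - (1 + v)) \<le> exp (norm v) * (norm v)\<^sup>2" for v :: complex
  proof -
    have "norm (exp v - (1 + v)) \<le> exp \<bar>Re v\<bar> * (norm v)\<^sup>2"
      using Taylor_exp[of v 1] by (simp add: power2_eq_square)
    also have "\<dots> \<le> exp (norm v) * (norm v)\<^sup>2"
      using abs_Re_le_cmod[of v] by (intro mult_right_mono) auto
    finally show ?thesis .
  qed
  have "cosh v - 1 = ((exp v - (1 + v)) + (exp (- v) - (1 + - v))) / 2"
    by (simp add: cosh_def scaleR_conv_of_real field_simps)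
  also have "norm \<dots> \<le> (exp (norm v) * (norm v)\<^sup>2 + exp (norm v) * (norm v)\<^sup>2) / 2"
    unfolding norm_divide using b[of v] b[of "- v"]
    by (intro divide_mono order.trans[OF norm_triangle_ineq] add_mono) auto
  finally show ?thesis by simp
qed

lemma prod_cosh_near_one:
  "norm ((\<Prod>k=1..<m. cosh (of_nat k * v)) - 1) \<le> exp (exp (real m * norm v) * (real m ^ 3 * (norm v)\<^sup>2)) - 1"
  for v :: complex
proof -
  have "norm ((\<Prod>k=1..<m. 1 + (cosh (of_nat k * v) - 1)) - 1) \<le> (\<Prod>k=1..<m. 1 + norm (cosh (of_nat k * v) - 1)) - 1"
    by (rule norm_prod_minus1_le_prod_minus1)
  also have "\<dots> \<le> exp (\<Sum>k=1..<m. norm (cosh (of_nat k * v) - 1)) - 1"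
    by (intro diff_right_mono prod_le_exp_sum) auto
  also have "(\<Sum>k=1..<m. norm (cosh (of_nat k * v) - 1)) \<le> (\<Sum>k=1..<m. exp (real m * norm v) * (real m * norm v)\<^sup>2)"
  proof (rule sum_mono)
    fix k assume "k \<in> {1..<m}"
    then have "norm (of_nat k * v) \<le> real m * norm v" by (simp add: norm_mult mult_right_mono)
    then show "norm (cosh (of_nat k * v) - 1) \<le> exp (real m * norm v) * (real m * norm v)\<^sup>2"
      by (intro order.trans[OF norm_cosh_minus_one_le] mult_mono power_mono) auto
  qed
  also have "\<dots> \<le> real m * (exp (real m * norm v) * (real m * norm v)\<^sup>2)"
    by (simp add: mult_right_mono)
  also have "\<dots> = exp (real m * norm v) * (real m ^ 3 * (norm v)\<^sup>2)"
    by (simp add: power_mult_distrib power2_eq_square power3_eq_cube)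
  finally show ?thesis by simp
qed

text \<open>
  Separates the exponential main term from a product of values of \<open>cosh\<close> near \<open>0\<close>, which by
  \<open>prod_cosh_near_one\<close> is negligible when \<open>m\<^sup>3 \<bar>z\<bar>\<^sup>2\<close> is small.
\<close>
lemma prod_two_over_one_plus_exp:
  "(\<Prod>k=1..<m. 2 / (1 + exp (of_nat k * z))) =
     exp (- (z * of_nat m * (of_nat m - 1) / 4)) / (\<Prod>k=1..<m. cosh (of_nat k * (z / 2)))" for z :: complex
proof (cases "m = 0")
  case False
  have fac: "2 / (1 + exp w) = exp (- (w / 2)) / cosh (w / 2)" for w :: complex
  proof -
    have "1 + exp w = exp (w / 2) * (2 * cosh (w / 2))"
      by (simp add: cosh_def scaleR_conv_of_real algebra_simps flip: exp_add)
    then show ?thesis by (simp add: exp_minus divide_simps)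
  qed
  have "(\<Prod>k=1..<m. exp (- (of_nat k * z / 2))) = exp (- (z * of_nat m * (of_nat m - 1) / 4))"
  proof -
    have "m \<ge> 1" using False by simp
    then have "(\<Sum>k=1..<m. of_nat k) = (of_nat m * (of_nat m - 1) / 2 :: complex)"
      by (induction m rule: dec_induct) (auto simp: field_simps)
    moreover have "(\<Sum>k=1..<m. - (of_nat k * z / 2)) = - (z / 2) * (\<Sum>k=1..<m. of_nat k)"
      unfolding sum_distrib_left by (intro sum.cong) auto
    ultimately have "(\<Sum>k=1..<m. - (of_nat k * z / 2)) = - (z * of_nat m * (of_nat m - 1) / 4)"
      by (simp only:) (simp add: field_simps)
    then show ?thesis by (simp only: exp_sum[symmetric] finite_atLeastLessThan)
  qed
  then show ?thesis unfolding fac prod_dividef by simp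
qed simp

text \<open>
  The limit of the term for \<open>m \<approx> 2 x / \<surd>t\<close>: the exponential in \<open>prod_two_over_one_plus_exp\<close> tends to
  \<open>exp (- x\<^sup>2)\<close>, and \<open>m (1 - exp (- m z)) / (1 + exp (- m z)) \<approx> m\<^sup>2 z / 2\<close> to \<open>2 x\<^sup>2\<close>.
\<close>
lemma mex_weight_limit:
  fixes z :: "nat \<Rightarrow> complex" and t :: "nat \<Rightarrow> real" and m :: "nat \<Rightarrow> nat"
  assumes t: "\<And>n. t n > 0" "t \<longlonglongrightarrow> 0"
    and z: "\<And>n. z n \<noteq> 0" "(\<lambda>n. z n / of_real (t n)) \<longlonglongrightarrow> 1"
    and m: "\<And>n. m n \<ge> 1" "(\<lambda>n. real (m n) * sqrt (t n)) \<longlonglongrightarrow> 2 * x"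
  shows "(\<lambda>n. of_nat (m n) * mex_weight (m n) (exp (- z n))) \<longlonglongrightarrow> of_real (2 * x\<^sup>2 * exp (- x\<^sup>2))"
proof -
  define y where "y n = real (m n) * sqrt (t n)" for n
  define \<rho> where "\<rho> n = z n / of_real (t n)" for n
  define \<delta> where "\<delta> n = sqrt (t n)" for n
  have y: "y \<longlonglongrightarrow> 2 * x" unfolding y_def by (rule m)
  have \<rho>: "\<rho> \<longlonglongrightarrow> 1" unfolding \<rho>_def by (rule z)
  have \<delta>: "\<delta> \<longlonglongrightarrow> 0" unfolding \<delta>_def using tendsto_real_sqrt[OF t(2)] by simp
  have \<delta>p: "\<delta> n > 0" for n using t by (simp add: \<delta>_def)
  have t2: "t n = \<delta> n * \<delta> n" for n using t(1)[of n] by (simp add: \<delta>_def)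
  have zt: "z n = \<rho> n * of_real (\<delta> n) * of_real (\<delta> n)" for n
  proof -
    have "z n = \<rho> n * of_real (t n)" using t(1)[of n] by (simp add: \<rho>_def)
    then show ?thesis by (simp add: t2)
  qed
  have my: "of_nat (m n) * complex_of_real (\<delta> n) = of_real (y n)" for n
    by (simp add: y_def \<delta>_def)
  define w where "w n = of_nat (m n) * z n" for n
  have w_eq: "w n = of_real (y n) * \<rho> n * of_real (\<delta> n)" for n
    unfolding w_def zt my[symmetric] by simp
  have w0: "w \<longlonglongrightarrow> 0"
    unfolding w_eq using tendsto_mult[OF tendsto_mult[OF tendsto_of_real[OF y] \<rho>] tendsto_of_real[OF \<delta>]] by simp
  have wnz: "w n \<noteq> 0" for n using z(1)[of n] m(1)[of n] by (simp add: w_def)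
  have "filterlim (\<lambda>n. - w n) (at 0) sequentially"
    using tendsto_minus[OF w0] wnz by (auto simp: filterlim_at)
  from filterlim_compose[OF lim_exp_minus_1 this]
  have phi: "(\<lambda>n. (exp (- w n) - 1) / - w n) \<longlonglongrightarrow> 1" .
  have "(\<lambda>n. (of_real (y n) * of_real (y n) * \<rho> n) * ((exp (- w n) - 1) / - w n) / (1 + exp (- w n)))
     \<longlonglongrightarrow> (of_real (2 * x) * of_real (2 * x) * 1) * 1 / (1 + exp (- 0))"
    by (intro tendsto_intros tendsto_of_real y \<rho> phi w0) auto
  also have "(\<lambda>n. (of_real (y n) * of_real (y n) * \<rho> n) * ((exp (- w n) - 1) / - w n) / (1 + exp (- w n))) =
      (\<lambda>n. of_nat (m n) * ((1 - exp (- w n)) / (1 + exp (- w n))))"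
  proof
    fix n
    have A: "of_real (y n) * of_real (y n) * \<rho> n = of_nat (m n) * w n"
      unfolding my[symmetric] w_def zt by simp
    have B: "w n * ((exp (- w n) - 1) / - w n) = 1 - exp (- w n)" using wnz[of n] by simp
    show "(of_real (y n) * of_real (y n) * \<rho> n) * ((exp (- w n) - 1) / - w n) / (1 + exp (- w n)) =
      of_nat (m n) * ((1 - exp (- w n)) / (1 + exp (- w n)))"
      unfolding A unfolding mult.assoc unfolding B by (rule times_divide_eq_right[symmetric])
  qed
  finally have lim1: "(\<lambda>n. of_nat (m n) * ((1 - exp (- w n)) / (1 + exp (- w n)))) \<longlonglongrightarrow> of_real (2 * x\<^sup>2)"
    by (simp add: power2_eq_square)
  have "(\<lambda>n. exp (- (\<rho> n * of_real (y n) * (of_real (y n) - of_real (\<delta> n)) / 4))) \<longlonglongrightarrow>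
      exp (- (1 * of_real (2 * x) * (of_real (2 * x) - of_real 0) / 4))"
    by (intro tendsto_intros tendsto_of_real y \<rho> \<delta>) auto
  also have "- (1 * complex_of_real (2 * x) * (of_real (2 * x) - of_real 0) / 4) = of_real (- x\<^sup>2)"
    by (simp add: power2_eq_square)
  also have "(\<lambda>n. exp (- (\<rho> n * of_real (y n) * (of_real (y n) - of_real (\<delta> n)) / 4))) =
     (\<lambda>n. exp (- (z n * of_nat (m n) * (of_nat (m n) - 1) / 4)))"
    unfolding my[symmetric] zt by (simp add: algebra_simps)
  finally have lim2: "(\<lambda>n. exp (- (z n * of_nat (m n) * (of_nat (m n) - 1) / 4))) \<longlonglongrightarrow> of_real (exp (- x\<^sup>2))"
    by (simp only: exp_of_real)
  have lim3: "(\<lambda>n. \<Prod>k=1..<m n. cosh (of_nat k * (z n / 2))) \<longlonglongrightarrow> 1"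
  proof (rule LIM_zero_cancel, rule Lim_null_comparison)
    let ?B = "\<lambda>n. exp (exp (y n * (norm (\<rho> n) / 2) * \<delta> n) * (y n ^ 3 * (norm (\<rho> n) / 2)\<^sup>2 * \<delta> n)) - 1"
    have nz: "norm (z n / 2) = norm (\<rho> n) / 2 * \<delta> n * \<delta> n" for n
      using \<delta>p[of n] by (simp add: zt norm_mult norm_divide)
    have ym: "y n = real (m n) * \<delta> n" for n by (simp add: y_def \<delta>_def)
    have eqs: "real (m n) * norm (z n / 2) = y n * (norm (\<rho> n) / 2) * \<delta> n"
      "real (m n) ^ 3 * (norm (z n / 2))\<^sup>2 = y n ^ 3 * (norm (\<rho> n) / 2)\<^sup>2 * \<delta> n" for n
      unfolding nz ym by (simp_all add: power2_eq_square power3_eq_cube)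
    show "\<forall>\<^sub>F n in sequentially. norm ((\<Prod>k=1..<m n. cosh (of_nat k * (z n / 2))) - 1) \<le> ?B n"
      using prod_cosh_near_one[where m = "m n" and v = "z n / 2" for n] unfolding eqs by (intro always_eventually allI)
    have "?B \<longlonglongrightarrow> exp (exp (2 * x * (norm (1::complex) / 2) * 0) * ((2 * x) ^ 3 * (norm (1::complex) / 2)\<^sup>2 * 0)) - 1"
      by (intro tendsto_intros y \<rho> \<delta>) auto
    then show "?B \<longlonglongrightarrow> 0" by simp
  qed
  have lim: "(\<lambda>n. exp (- (z n * of_nat (m n) * (of_nat (m n) - 1) / 4)) / (\<Prod>k=1..<m n. cosh (of_nat k * (z n / 2)))
      * (of_nat (m n) * ((1 - exp (- w n)) / (1 + exp (- w n))))) \<longlonglongrightarrow> of_real (exp (- x\<^sup>2)) / 1 * of_real (2 * x\<^sup>2)"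
    by (intro tendsto_mult tendsto_divide lim1 lim2 lim3) auto
  have eq: "of_nat (m n) * mex_weight (m n) (exp (- z n)) =
      exp (- (z n * of_nat (m n) * (of_nat (m n) - 1) / 4)) / (\<Prod>k=1..<m n. cosh (of_nat k * (z n / 2)))
      * (of_nat (m n) * ((1 - exp (- w n)) / (1 + exp (- w n))))" for n
    unfolding mex_weight_exp prod_two_over_one_plus_exp w_def by (rule mult.left_commute)
  have val: "of_real (exp (- x\<^sup>2)) / 1 * complex_of_real (2 * x\<^sup>2) = of_real (2 * x\<^sup>2 * exp (- x\<^sup>2))" by simp
  show ?thesis using lim unfolding eq val .
qed

text \<open>
  Turns a sum whose range and mesh vary into an integral over a fixed domain, so that dominated
  convergence applies.
\<close>
lemma step_function:
  fixes h :: "nat \<Rightarrow> complex"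
  assumes "\<delta> > 0"
  shows "(\<integral>x. (\<Sum>i\<le>n. indicator {real i * \<delta>..<real (Suc i) * \<delta>} x *\<^sub>R h i) \<partial>lborel) = of_real \<delta> * (\<Sum>i\<le>n. h i)"
    and "(\<Sum>i\<le>n. indicator {real i * \<delta>..<real (Suc i) * \<delta>} x *\<^sub>R h i) =
      (if 0 \<le> x \<and> nat \<lfloor>x / \<delta>\<rfloor> \<le> n then h (nat \<lfloor>x / \<delta>\<rfloor>) else 0)"
proof -
  have le: "real i * \<delta> \<le> real (Suc i) * \<delta>" for i using assms by (simp add: mult_right_mono)
  have "(\<integral>x. indicator {real i * \<delta>..<real (Suc i) * \<delta>} x *\<^sub>R h i \<partial>lborel) = of_real \<delta> * h i" for i
    using le[of i] by (simp add: scaleR_conv_of_real algebra_simps)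
  moreover have "integrable lborel (\<lambda>x. indicator {real i * \<delta>..<real (Suc i) * \<delta>} x *\<^sub>R h i)" for i
    using le[of i] by (intro integrable_scaleR_left impI) auto
  ultimately show "(\<integral>x. (\<Sum>i\<le>n. indicator {real i * \<delta>..<real (Suc i) * \<delta>} x *\<^sub>R h i) \<partial>lborel) = of_real \<delta> * (\<Sum>i\<le>n. h i)"
    by (subst Bochner_Integration.integral_sum) (simp_all only: sum_distrib_left)
  have mem: "x \<in> {real i * \<delta>..<real (Suc i) * \<delta>} \<longleftrightarrow> 0 \<le> x \<and> i = nat \<lfloor>x / \<delta>\<rfloor>" for i
  proof -
    have "x \<in> {real i * \<delta>..<real (Suc i) * \<delta>} \<longleftrightarrow> real i \<le> x / \<delta> \<and> x / \<delta> < real i + 1"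
      using assms by (auto simp: field_simps)
    also have "\<dots> \<longleftrightarrow> \<lfloor>x / \<delta>\<rfloor> = int i" by (simp add: floor_eq_iff)
    also have "\<dots> \<longleftrightarrow> 0 \<le> x \<and> i = nat \<lfloor>x / \<delta>\<rfloor>"
    proof -
      have "0 \<le> \<lfloor>x / \<delta>\<rfloor> \<longleftrightarrow> 0 \<le> x" using assms by (simp add: zero_le_divide_iff)
      moreover have "\<lfloor>x / \<delta>\<rfloor> = int i \<longleftrightarrow> 0 \<le> \<lfloor>x / \<delta>\<rfloor> \<and> i = nat \<lfloor>x / \<delta>\<rfloor>" by linarith
      ultimately show ?thesis by (simp only:)
    qed
    finally show ?thesis .
  qed
  show "(\<Sum>i\<le>n. indicator {real i * \<delta>..<real (Suc i) * \<delta>} x *\<^sub>R h i) =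
      (if 0 \<le> x \<and> nat \<lfloor>x / \<delta>\<rfloor> \<le> n then h (nat \<lfloor>x / \<delta>\<rfloor>) else 0)"
  proof -
    have "(\<Sum>i\<le>n. indicator {real i * \<delta>..<real (Suc i) * \<delta>} x *\<^sub>R h i) =
        (\<Sum>i\<le>n. if i = nat \<lfloor>x / \<delta>\<rfloor> then if 0 \<le> x then h (nat \<lfloor>x / \<delta>\<rfloor>) else 0 else 0)"
      by (intro sum.cong refl) (simp only: indicator_def mem, auto)
    then show ?thesis by simp
  qed
qed

text \<open>
  With mesh \<open>\<surd>t\<close> the sum is the integral of a step function that converges pointwise to
  \<open>2 x\<^sup>2 exp (- x\<^sup>2)\<close>; the integral of the limit is a Gaussian moment. The range \<open>N\<close> of the sum only has
  to cover every bounded set of \<open>x\<close> eventually.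
\<close>
lemma mex_weight_sum_limit:
  fixes z :: "nat \<Rightarrow> complex" and t :: "nat \<Rightarrow> real"
  assumes t: "\<And>n. 0 < t n" "\<And>n. t n \<le> 1" "t \<longlonglongrightarrow> 0"
    and z: "\<And>n. Re (z n) = t n" "\<And>n. \<bar>Im (z n)\<bar> \<le> t n" "(\<lambda>n. z n / of_real (t n)) \<longlonglongrightarrow> 1"
    and N: "filterlim (\<lambda>n. real (N n) * sqrt (t n)) at_top sequentially"
  shows "(\<lambda>n. of_real (sqrt (t n)) * (\<Sum>i\<le>N n. of_nat (2 * i + 1) * mex_weight (2 * i + 1) (exp (- z n)))) \<longlonglongrightarrow> of_real (sqrt pi / 2)"
proof -
  define \<delta> where "\<delta> n = sqrt (t n)" for n
  have \<delta>: "\<delta> n > 0" "\<delta> n \<le> 1" "\<delta> n * \<delta> n = t n" for n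
    using t(1,2)[of n] by (auto simp: \<delta>_def)
  have \<delta>0: "\<delta> \<longlonglongrightarrow> 0" unfolding \<delta>_def using tendsto_real_sqrt[OF t(3)] by simp
  define h where "h n i = of_nat (2 * i + 1) * mex_weight (2 * i + 1) (exp (- z n))" for n i
  define s where "s n x = (\<Sum>i\<le>N n. indicator {real i * \<delta> n..<real (Suc i) * \<delta> n} x *\<^sub>R h n i)" for n x
  define f where "f x = complex_of_real (indicator {0..} x * (2 * x\<^sup>2 * exp (- x\<^sup>2)))" for x :: real
  define B where "B x = indicator {0<..} x *\<^sub>R (exp 26 * exp (- (x * 3)))" for x :: real
  have s_eq: "s n x = (if 0 \<le> x \<and> nat \<lfloor>x / \<delta> n\<rfloor> \<le> N n then h n (nat \<lfloor>x / \<delta> n\<rfloor>) else 0)" for n x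
    unfolding s_def by (rule step_function(2)[OF \<delta>(1)])
  have i_bounds: "real (nat \<lfloor>x / \<delta> n\<rfloor>) * \<delta> n \<le> x" "x \<le> (real (nat \<lfloor>x / \<delta> n\<rfloor>) + 1) * \<delta> n" if "x \<ge> 0" for n x
  proof -
    have "x / \<delta> n \<ge> 0" using that \<delta>(1)[of n] by simp
    then have "real (nat \<lfloor>x / \<delta> n\<rfloor>) \<le> x / \<delta> n" "x / \<delta> n \<le> real (nat \<lfloor>x / \<delta> n\<rfloor>) + 1" by linarith+
    then show "real (nat \<lfloor>x / \<delta> n\<rfloor>) * \<delta> n \<le> x" "x \<le> (real (nat \<lfloor>x / \<delta> n\<rfloor>) + 1) * \<delta> n"
      using \<delta>(1)[of n] by (auto simp: field_simps)
  qed
  have lim: "(\<lambda>n. \<integral>x. s n x \<partial>lborel) \<longlonglongrightarrow> (\<integral>x. f x \<partial>lborel)"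
  proof (rule integral_dominated_convergence[where w = B])
    show "f \<in> borel_measurable lborel" unfolding f_def by measurable
    show "s n \<in> borel_measurable lborel" for n unfolding s_def by measurable
    have "integrable lborel (\<lambda>x. exp 26 * (indicator {0<..} x *\<^sub>R exp (- (x * 3)) :: real))"
      using integrable_I0i_exp_mscale[of 3] unfolding set_integrable_def by (intro integrable_mult_right) simp
    then show "integrable lborel B" unfolding B_def by (simp add: mult.left_commute)
    show "AE x in lborel. (\<lambda>n. s n x) \<longlonglongrightarrow> f x"
    proof (rule AE_I2)
      fix x :: real
      show "(\<lambda>n. s n x) \<longlonglongrightarrow> f x"
      proof (cases "x \<ge> 0")
        case True
        let ?i = "\<lambda>n. nat \<lfloor>x / \<delta> n\<rfloor>"
        have i: "(\<lambda>n. real (?i n) * \<delta> n) \<longlonglongrightarrow> x"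
        proof (rule tendsto_sandwich)
          show "(\<lambda>n. x - \<delta> n) \<longlonglongrightarrow> x" using tendsto_diff[OF tendsto_const \<delta>0] by simp
          show "\<forall>\<^sub>F n in sequentially. x - \<delta> n \<le> real (?i n) * \<delta> n"
            using i_bounds(2)[OF True] by (intro always_eventually allI) (simp add: algebra_simps)
          show "\<forall>\<^sub>F n in sequentially. real (?i n) * \<delta> n \<le> x" using i_bounds(1)[OF True] by simp
        qed auto
        have "(\<lambda>n. h n (?i n)) \<longlonglongrightarrow> of_real (2 * x\<^sup>2 * exp (- x\<^sup>2))"
          unfolding h_def
        proof (rule mex_weight_limit[where t = t])
          have "(\<lambda>n. 2 * (real (?i n) * \<delta> n) + \<delta> n) \<longlonglongrightarrow> 2 * x + 0"
            by (intro tendsto_intros i \<delta>0)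
          then show "(\<lambda>n. real (2 * ?i n + 1) * sqrt (t n)) \<longlonglongrightarrow> 2 * x"
            by (simp add: \<delta>_def algebra_simps)
          show "z n \<noteq> 0" for n using z(1)[of n] t(1)[of n] by auto
        qed (use t z in auto)
        moreover have "\<forall>\<^sub>F n in sequentially. h n (?i n) = s n x"
        proof -
          have "\<forall>\<^sub>F n in sequentially. x \<le> real (N n) * sqrt (t n)"
            using N by (simp add: filterlim_at_top)
          then show ?thesis
          proof eventually_elim
            case (elim n)
            have "real (?i n) * \<delta> n \<le> real (N n) * \<delta> n" using i_bounds(1)[OF True, of n] elim by (simp add: \<delta>_def)
            then have "?i n \<le> N n" using \<delta>(1)[of n] by simp
            then show ?case using True by (simp add: s_eq)
          qed
        qed
        ultimately show ?thesis using True by (auto simp: f_def intro: Lim_transform_eventually)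
      qed (simp add: s_eq f_def)
    qed
    show "AE x in lborel. norm (s n x) \<le> B x" for n
      using AE_lborel_singleton[of "0::real"]
    proof eventually_elim
      case (elim x)
      show "norm (s n x) \<le> B x"
      proof (cases "x \<ge> 0")
        case True
        define i where "i = nat \<lfloor>x / \<delta> n\<rfloor>"
        define v where "v = real i * \<delta> n"
        have v: "0 \<le> v" "v \<le> x" "x \<le> v + 1"
          using i_bounds[OF True, of n] \<delta>[of n] by (auto simp: v_def i_def algebra_simps)
        have vt: "real i * t n = v * \<delta> n" "real i * real i * t n = v * v" using \<delta>(3)[of n] by (auto simp: v_def)
        have "norm (h n i) \<le> real (2 * i + 1) * (real (2 * i + 1) * t n * exp (- t n * real (2 * i + 1) * (real (2 * i + 1) - 3) / 4))"
          unfolding h_def norm_mult norm_of_nat using t z by (intro mult_left_mono mex_weight_bound) auto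
        also have "\<dots> = (2 * v + \<delta> n)\<^sup>2 * exp (- v\<^sup>2 + v * \<delta> n / 2 + t n / 2)"
        proof -
          have "real (2 * i + 1) * (real (2 * i + 1) * t n) = (2 * v + \<delta> n)\<^sup>2"
            unfolding v_def \<delta>(3)[symmetric] by (simp add: power2_eq_square algebra_simps)
          moreover have "- t n * real (2 * i + 1) * (real (2 * i + 1) - 3) / 4 = - v\<^sup>2 + v * \<delta> n / 2 + t n / 2"
            unfolding v_def \<delta>(3)[symmetric] by (simp add: power2_eq_square field_simps)
          ultimately show ?thesis by (simp only: mult.assoc[symmetric])
        qed
        also have "\<dots> \<le> (exp (2 * x))\<^sup>2 * exp (26 - 7 * x)"
        proof (rule mult_mono)
          have "2 * v + \<delta> n \<le> 1 + 2 * x" using v \<delta>[of n] by simp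
          also have "\<dots> \<le> exp (2 * x)" by (rule exp_ge_add_one_self)
          finally show "(2 * v + \<delta> n)\<^sup>2 \<le> (exp (2 * x))\<^sup>2" using v \<delta>(1)[of n] by (intro power_mono) auto
          \<comment> \<open>A tangent of \<open>v\<^sup>2\<close>, steep enough to absorb the polynomial factor as well.\<close>
          have "0 \<le> (v - 4)\<^sup>2" by simp
          then have "8 * v - 16 \<le> v\<^sup>2" by (simp add: power2_eq_square algebra_simps)
          moreover have "v * \<delta> n \<le> v * 1" using v \<delta>(2)[of n] by (intro mult_left_mono) auto
          ultimately have "- v\<^sup>2 + v * \<delta> n / 2 + t n / 2 \<le> 26 - 7 * x" using v t(2)[of n] by linarith
          then show "exp (- v\<^sup>2 + v * \<delta> n / 2 + t n / 2) \<le> exp (26 - 7 * x)" by simp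
        qed auto
        also have "\<dots> = B x" using True elim by (simp add: B_def flip: exp_add exp_double)
        finally show ?thesis using True by (simp add: s_eq i_def B_def)
      qed (simp add: s_eq B_def)
    qed
  qed
  have int_s: "(\<integral>x. s n x \<partial>lborel) = of_real (sqrt (t n)) * (\<Sum>i\<le>N n. h n i)" for n
    unfolding s_def \<delta>_def[symmetric] by (rule step_function(1)[OF \<delta>(1)])
  have int_f: "(\<integral>x. f x \<partial>lborel) = of_real (sqrt pi / 2)"
  proof -
    have "has_bochner_integral lborel (\<lambda>x::real. 2 * (indicator {0..} x *\<^sub>R (exp (-x\<^sup>2)*x^(2 * 1)))) (2 * ((sqrt pi / 2) * (fact (2 * 1) / (2 ^ (2 * 1) * fact 1))))"
      by (intro has_bochner_integral_mult_right gaussian_moment_even_pos)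
    then have "(\<integral>x. indicator {0..} x * (2 * x\<^sup>2 * exp (- x\<^sup>2)) \<partial>lborel) = sqrt pi / 2"
      by (simp add: has_bochner_integral_iff mult_ac fact_numeral)
    then show ?thesis unfolding f_def integral_complex_of_real by (rule arg_cong)
  qed
  show ?thesis using lim unfolding int_s int_f h_def .
qed

section \<open>Coefficient extraction and the decay along the circle\<close>

lemma integral_cis_int:
  fixes j :: int
  shows "(\<integral>\<theta>. indicator {-pi..pi} \<theta> *\<^sub>R cis (real_of_int j * \<theta>) \<partial>lborel) = (if j = 0 then of_real (2 * pi) else 0)"
proof (cases "j = 0")
  case True
  have "(\<integral>\<theta>. indicator {-pi..pi} \<theta> *\<^sub>R (1::complex) \<partial>lborel) = of_real (2 * pi)"
    by (simp add: scaleR_conv_of_real)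
  then show ?thesis using True by (simp add: cis_zero)
next
  case False
  let ?F = "\<lambda>\<theta>. cis (real_of_int j * \<theta>) / (\<i> * of_int j)"
  have "(\<integral>\<theta>. indicator {-pi..pi} \<theta> *\<^sub>R cis (real_of_int j * \<theta>) \<partial>lborel) = ?F pi - ?F (- pi)"
  proof (rule integral_FTC_atLeastAtMost)
    show "(?F has_vector_derivative cis (real_of_int j * \<theta>)) (at \<theta> within {-pi..pi})" for \<theta>
    proof -
      have "((\<lambda>w. exp (\<i> * of_int j * w) / (\<i> * of_int j)) has_field_derivative exp (\<i> * of_int j * of_real \<theta>)) (at (of_real \<theta>))"
        using False by (auto intro!: derivative_eq_intros)
      from has_vector_derivative_real_field[OF this] show ?thesis
        by (simp add: cis_conv_exp mult.assoc)
    qed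
    show "continuous_on {-pi..pi} (\<lambda>\<theta>. cis (real_of_int j * \<theta>))"
      by (intro continuous_intros)
  qed simp
  also have "cis (real_of_int j * pi) = cis (real_of_int j * - pi)"
    using sin_npi_int[of j] by (simp add: complex_eq_iff mult.commute)
  then have "?F pi - ?F (- pi) = 0" by simp
  finally show ?thesis using False by simp
qed

text \<open>
  Integration term by term; only the term with exponent \<open>k\<close> survives.
\<close>
lemma coefficient_integral:
  fixes a :: "nat \<Rightarrow> real"
  assumes r: "r > 0" and nonneg: "\<And>n. a n \<ge> 0" and sm: "summable (\<lambda>n. a n * r ^ n)"
  shows "(\<integral>\<theta>. indicator {-pi..pi} \<theta> *\<^sub>R ((\<Sum>n. of_real (a n) * (of_real r * cis \<theta>) ^ n) * cis (- (real k * \<theta>))) \<partial>lborel)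
    = of_real (2 * pi * (a k * r ^ k))"
proof -
  let ?f = "\<lambda>n \<theta>. indicator {-pi..pi} \<theta> *\<^sub>R (of_real (a n * r ^ n) * cis (real_of_int (int n - int k) * \<theta>))"
  have int_f: "integrable lborel (?f n)" for n
    by (rule borel_integrable_compact[of "{-pi..pi}", simplified]) (intro continuous_intros)
  have norm_f: "norm (?f n \<theta>) = indicator {-pi..pi} \<theta> * (a n * r ^ n)" for n \<theta>
    using nonneg[of n] r by (simp add: norm_mult norm_power indicator_def abs_mult)
  have term_eq: "of_real (a n) * (of_real r * cis \<theta>) ^ n * cis (- (real k * \<theta>)) = of_real (a n * r ^ n) * cis (real_of_int (int n - int k) * \<theta>)" for n \<theta>
  proof -
    have "cis \<theta> ^ n * cis (- (real k * \<theta>)) = cis (real_of_int (int n - int k) * \<theta>)"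
      by (simp add: Complex.DeMoivre cis_mult left_diff_distrib)
    then show ?thesis by (simp add: power_mult_distrib mult.assoc)
  qed
  have sums_int: "(\<lambda>n. \<integral>\<theta>. ?f n \<theta> \<partial>lborel) sums (\<integral>\<theta>. (\<Sum>n. ?f n \<theta>) \<partial>lborel)"
  proof (rule sums_integral)
    show "AE \<theta> in lborel. summable (\<lambda>n. norm (?f n \<theta>))"
      unfolding norm_f using sm by (intro AE_I2 summable_mult)
    have "(\<integral>\<theta>. norm (?f n \<theta>) \<partial>lborel) = 2 * pi * (a n * r ^ n)" for n
      unfolding norm_f by simp
    then show "summable (\<lambda>n. \<integral>\<theta>. norm (?f n \<theta>) \<partial>lborel)"
      using sm by (simp only: summable_mult)
  qed (rule int_f)
  have int_eq: "(\<integral>\<theta>. ?f n \<theta> \<partial>lborel) = (if n = k then of_real (2 * pi * (a k * r ^ k)) else 0)" for n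
  proof -
    have "(\<integral>\<theta>. ?f n \<theta> \<partial>lborel) = of_real (a n * r ^ n) * (\<integral>\<theta>. indicator {-pi..pi} \<theta> *\<^sub>R cis (real_of_int (int n - int k) * \<theta>) \<partial>lborel)"
      by (subst integral_mult_right_zero[symmetric]) (simp only: mult_scaleR_right)
    then show ?thesis unfolding integral_cis_int by simp
  qed
  have int_sum: "(\<integral>\<theta>. (\<Sum>n. ?f n \<theta>) \<partial>lborel) = of_real (2 * pi * (a k * r ^ k))"
    by (rule sums_unique2[OF sums_int[unfolded int_eq] sums_single])
  have "(\<Sum>n. ?f n \<theta>) = indicator {-pi..pi} \<theta> *\<^sub>R ((\<Sum>n. of_real (a n) * (of_real r * cis \<theta>) ^ n) * cis (- (real k * \<theta>)))" for \<theta>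
  proof -
    have "norm (of_real (a n) * (of_real r * cis \<theta>) ^ n) = a n * r ^ n" for n
      using r nonneg[of n] by (simp add: norm_mult norm_power)
    then have "summable (\<lambda>n. of_real (a n) * (of_real r * cis \<theta>) ^ n)"
      using sm summable_norm_cancel[of "\<lambda>n. of_real (a n) * (of_real r * cis \<theta>) ^ n"] by (simp only:)
    note sum1 = this
    show ?thesis
      unfolding term_eq[symmetric] suminf_scaleR_right[OF summable_mult2[OF sum1], symmetric] suminf_mult2[OF sum1] ..
  qed
  then show ?thesis using int_sum by (simp only:)
qed

text \<open>
  The local factor of the part size \<open>k\<close> in the generating function of the overpartitions with mex
  \<open>m\<close>.
\<close>
definition mex_factor :: "nat \<Rightarrow> nat \<Rightarrow> 'a :: field \<Rightarrow> 'a" where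
  "mex_factor m k q = (if k < m then 2 * q ^ k / (1 - q ^ k) else if k = m then 1 else (1 + q ^ k) / (1 - q ^ k))"

lemma one_pm_power_nonzero:
  fixes q :: "'a :: real_normed_field"
  assumes "norm q < 1" "k \<ge> 1"
  shows "1 - q ^ k \<noteq> 0" "1 + q ^ k \<noteq> 0"
proof -
  have "norm (q ^ k) < 1" using assms by (simp add: norm_power power_less_one_iff)
  then show "1 - q ^ k \<noteq> 0" "1 + q ^ k \<noteq> 0"
    by (metis less_irrefl norm_one right_minus_eq, metis add_eq_0_iff less_irrefl norm_minus_cancel norm_one)
qed

lemma prod_mex_factor:
  fixes q :: "'a :: real_normed_field"
  assumes "norm q < 1" "1 \<le> m" "m \<le> N"
  shows "(\<Prod>k=1..N. mex_factor m k q) = ovp_prod N q * mex_weight m q"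
proof -
  let ?g = "\<lambda>k. if k < m then 2 * q ^ k / (1 + q ^ k) else if k = m then (1 - q ^ k) / (1 + q ^ k) else 1"
  have "mex_factor m k q = (1 + q ^ k) / (1 - q ^ k) * ?g k" if "k \<in> {1..N}" for k
  proof -
    have "1 - q ^ k \<noteq> 0" "1 + q ^ k \<noteq> 0" using one_pm_power_nonzero[OF assms(1), of k] that by auto
    then show ?thesis by (cases "k = m") (simp_all add: mex_factor_def)
  qed
  then have "(\<Prod>k=1..N. mex_factor m k q) = (\<Prod>k=1..N. (1 + q ^ k) / (1 - q ^ k) * ?g k)" by (intro prod.cong refl)
  also have "\<dots> = ovp_prod N q * (\<Prod>k=1..N. ?g k)" by (simp only: prod.distrib ovp_prod_def)
  also have "(\<Prod>k=1..N. ?g k) = (\<Prod>k=1..m. ?g k)"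
    using assms by (intro prod.mono_neutral_right) auto
  also have "\<dots> = (\<Prod>k=1..<m. ?g k) * ?g m"
    using assms by (simp add: prod.last_plus mult.commute)
  also have "(\<Prod>k=1..<m. ?g k) = (\<Prod>k=1..<m. 2 * q ^ k / (1 + q ^ k))" by (intro prod.cong) auto
  finally show ?thesis by (simp add: mex_weight_def)
qed

lemma ovp_upto_mex_sums:
  fixes q :: "'a :: {real_normed_field, banach}"
  assumes "norm q < 1" "1 \<le> m" "m \<le> N"
  shows "(\<lambda>n. of_nat (card (ovp_upto {1..<m} {m} N n)) * q ^ n) sums (ovp_prod N q * mex_weight m q)"
proof -
  have "(\<Prod>k=1..N. (if k \<in> {1..<m} then 0 else 1) + (if k \<in> {m} then 0 else 2 * q ^ k / (1 - q ^ k))) = (\<Prod>k=1..N. mex_factor m k q)"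
    using one_pm_power_nonzero[OF assms(1)] assms
    by (intro prod.cong refl) (auto simp: mex_factor_def field_simps)
  then show ?thesis using ovp_upto_sums(1)[of q "{1..<m}" "{m}" N] assms
    by (simp only: prod_mex_factor)
qed

text \<open>
  Both possible numerators, \<open>2 q\<^sup>k\<close> and \<open>1 + q\<^sup>k\<close>, are largest in absolute value at \<open>q = r\<close>, so
  only the denominators matter for \<open>k \<noteq> m\<close>. For \<open>k = m\<close> there is no denominator, which is why \<open>m\<close> is
  removed from \<open>K\<close>.
\<close>
lemma norm_mex_product_le:
  fixes q :: complex
  assumes q: "norm q = r" "r < 1" and m: "1 \<le> m" "m \<le> N" and K: "K \<subseteq> {1..N} - {m}"
  shows "norm (ovp_prod N q * mex_weight m q) \<le> ovp_prod N r * mex_weight m r * (\<Prod>k\<in>K. (1 - r ^ k) / norm (1 - q ^ k))"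
proof -
  have r: "0 \<le> r" using q by auto
  have fac: "norm (mex_factor m k q) \<le> mex_factor m k r * (if k \<in> K then (1 - r ^ k) / norm (1 - q ^ k) else 1)"
    if k: "k \<in> {1..N}" for k
  proof -
    have rk: "norm (q ^ k) = r ^ k" "0 \<le> r ^ k" "r ^ k < 1"
      using q r k by (auto simp: norm_power power_less_one_iff)
    have d: "1 - r ^ k \<le> norm (1 - q ^ k)" using norm_one_minus_ge[of "q ^ k"] rk by simp
    have n: "norm (1 + q ^ k) \<le> 1 + r ^ k" using norm_triangle_ineq[of 1 "q ^ k"] rk by simp
    show ?thesis
    proof (cases "k = m")
      case True
      then show ?thesis using K by (auto simp: mex_factor_def)
    next
      case False
      define c where "c = (if k < m then 2 * r ^ k else 1 + r ^ k)"
      have c: "c \<ge> 0" using rk by (simp add: c_def)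
      have "norm (mex_factor m k q) \<le> c / norm (1 - q ^ k)"
        using False n rk by (auto simp: mex_factor_def c_def norm_divide norm_mult intro: divide_right_mono)
      moreover have "mex_factor m k r = c / (1 - r ^ k)" using False by (simp add: mex_factor_def c_def)
      moreover have "c / norm (1 - q ^ k) \<le> c / (1 - r ^ k)"
        using d c rk by (intro divide_left_mono mult_pos_pos) auto
      ultimately show ?thesis using rk d by auto
    qed
  qed
  have "norm (ovp_prod N q * mex_weight m q) = (\<Prod>k=1..N. norm (mex_factor m k q))"
    using prod_mex_factor[of q m N] q m by (simp add: prod_norm)
  also have "\<dots> \<le> (\<Prod>k=1..N. mex_factor m k r * (if k \<in> K then (1 - r ^ k) / norm (1 - q ^ k) else 1))"
    by (intro prod_mono conjI fac) auto
  also have "\<dots> = (\<Prod>k=1..N. mex_factor m k r) * (\<Prod>k=1..N. if k \<in> K then (1 - r ^ k) / norm (1 - q ^ k) else 1)"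
    by (rule prod.distrib)
  also have "(\<Prod>k=1..N. if k \<in> K then (1 - r ^ k) / norm (1 - q ^ k) else 1) = (\<Prod>k\<in>K. (1 - r ^ k) / norm (1 - q ^ k))"
    using K by (intro prod.mono_neutral_cong_right) auto
  also have "(\<Prod>k=1..N. mex_factor m k r) = ovp_prod N r * mex_weight m r"
    using prod_mex_factor[of r m N] r q m by simp
  finally show ?thesis .
qed

lemma norm_one_minus_polar_sq:
  "(norm (1 - (of_real r * cis \<theta>) ^ k))\<^sup>2 = (1 - r ^ k)\<^sup>2 + 2 * r ^ k * (1 - cos (real k * \<theta>))"
proof -
  have eq: "(of_real r * cis \<theta>) ^ k = of_real (r ^ k) * cis (real k * \<theta>)"
    by (simp add: power_mult_distrib Complex.DeMoivre)
  have "(norm (1 - (of_real r * cis \<theta>) ^ k))\<^sup>2 = (1 - r ^ k * cos (real k * \<theta>))\<^sup>2 + (r ^ k * sin (real k * \<theta>))\<^sup>2"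
    unfolding eq cmod_power2 by simp
  also have "\<dots> = 1 - 2 * r ^ k * cos (real k * \<theta>) + (r ^ k)\<^sup>2"
    using polar_sum_of_squares[of "- (r ^ k)" "real k * \<theta>"] by simp
  also have "\<dots> = (1 - r ^ k)\<^sup>2 + 2 * r ^ k * (1 - cos (real k * \<theta>))"
    by (simp add: power2_eq_square algebra_simps)
  finally show ?thesis .
qed

lemma one_over_le_exp:
  fixes y Y :: real
  assumes "0 \<le> y" "y \<le> Y"
  shows "1 / (1 + y) \<le> exp (- (y / (1 + Y)))"
proof -
  have "1 / (1 + y) = 1 + - (y / (1 + y))" using assms by (simp add: field_simps)
  also have "\<dots> \<le> exp (- (y / (1 + y)))" by (rule exp_ge_add_one_self)
  also have "\<dots> \<le> exp (- (y / (1 + Y)))" using assms by (simp add: frac_le)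
  finally show ?thesis .
qed

lemma exp_minus_le_inverse:
  fixes x :: real
  assumes "0 \<le> x"
  shows "exp (- x) \<le> 1 / (1 + x)"
proof -
  have "1 / exp x \<le> 1 / (1 + x)"
    using assms exp_ge_add_one_self[of x] by (intro divide_left_mono mult_pos_pos) auto
  then show ?thesis by (simp add: exp_minus inverse_eq_divide)
qed

text \<open>
  The square of the factor is \<open>1 / (1 + 2 s c / (1 - s)\<^sup>2)\<close> with \<open>s = exp (- k t)\<close> and
  \<open>c = 1 - cos (k \<theta>)\<close>. For \<open>k t \<le> 1\<close> one has \<open>s \<ge> 1 / 3\<close> and \<open>1 - s \<le> k t\<close>. The parameter \<open>Y\<close> allows one to
  replace \<open>1 / (1 + y)\<close> by an exponential, so that factors can be multiplied.
\<close>
lemma damping_factor_le: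
  assumes t: "t > 0" and k: "k \<ge> 1" "real k * t \<le> 1"
    and y: "0 \<le> y" "y \<le> Y" "y \<le> 2 / 3 * (1 - cos (real k * \<theta>)) / (real k * t)\<^sup>2"
  shows "((1 - exp (- t) ^ k) / norm (1 - (of_real (exp (- t)) * cis \<theta>) ^ k))\<^sup>2 \<le> exp (- (y / (1 + Y)))"
proof -
  define s where "s = exp (- t) ^ k"
  have s_eq: "s = exp (- (real k * t))" using exp_of_nat_mult[of k "- t"] by (simp add: s_def)
  have kt: "0 < real k * t" using t k by simp
  have s: "0 < s" "s < 1" unfolding s_eq using kt by auto
  have s3: "1 / 3 \<le> s"
  proof -
    have "exp (real k * t) \<le> exp 1" using k by simp
    also have "\<dots> \<le> 3" by (rule exp_le)
    finally have "exp (real k * t) \<le> 3" .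
    then show ?thesis unfolding s_eq exp_minus by (simp add: field_simps)
  qed
  have s1: "1 - s \<le> real k * t" using exp_ge_add_one_self[of "- (real k * t)"] by (simp add: s_eq)
  define c where "c = 1 - cos (real k * \<theta>)"
  have c: "c \<ge> 0" by (simp add: c_def)
  have "y * (1 - s)\<^sup>2 \<le> y * (real k * t)\<^sup>2" using s s1 y by (intro mult_left_mono power_mono) auto
  also have "\<dots> \<le> 2 / 3 * c" using y(3) kt k t unfolding c_def by (subst (asm) pos_le_divide_eq) auto
  also have "\<dots> \<le> 2 * s * c" using s3 c mult_right_mono[of "2 / 3" "2 * s" c] by simp
  finally have ys: "y * (1 - s)\<^sup>2 \<le> 2 * s * c" .
  have "((1 - s) / norm (1 - (of_real (exp (- t)) * cis \<theta>) ^ k))\<^sup>2 = (1 - s)\<^sup>2 / ((1 - s)\<^sup>2 + 2 * s * c)"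
    unfolding power_divide norm_one_minus_polar_sq s_def c_def by simp
  also have "\<dots> \<le> (1 - s)\<^sup>2 / ((1 - s)\<^sup>2 + y * (1 - s)\<^sup>2)"
    using s ys y c by (intro divide_left_mono mult_pos_pos add_left_mono add_pos_nonneg) (auto intro: add_pos_nonneg)
  also have "\<dots> = 1 / (1 + y)"
  proof -
    have "(1 - s)\<^sup>2 + y * (1 - s)\<^sup>2 = (1 - s)\<^sup>2 * (1 + y)" by (simp add: algebra_simps)
    then show ?thesis using s by simp
  qed
  also have "\<dots> \<le> exp (- (y / (1 + Y)))" using y by (intro one_over_le_exp) auto
  finally show ?thesis by (simp add: s_def)
qed

text \<open>
  The chord of a concave function lies below its graph.
\<close>
lemma jordan_sin_ge:
  fixes x :: real
  assumes "0 \<le> x" "x \<le> pi / 2"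
  shows "2 * x / pi \<le> sin x"
proof -
  have "concave_on {0..pi} sin"
    unfolding concave_on_def
  proof (rule f''_ge0_imp_convex[where f' = "\<lambda>x. - cos x" and f'' = "\<lambda>x. sin x"])
    show "0 \<le> sin x" if "x \<in> {0..pi}" for x using that by (intro sin_ge_zero) auto
  qed (auto intro!: derivative_eq_intros)
  from concave_onD[OF this, of "2 * x / pi" 0 "pi / 2"] show ?thesis
    using assms by (simp add: field_simps)
qed

lemma one_minus_cos_ge:
  fixes x :: real
  assumes "\<bar>x\<bar> \<le> pi"
  shows "2 * x\<^sup>2 / pi\<^sup>2 \<le> 1 - cos x"
proof -
  have "\<bar>x\<bar> / pi \<le> sin (\<bar>x\<bar> / 2)" using jordan_sin_ge[of "\<bar>x\<bar> / 2"] assms by simp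
  then have "(\<bar>x\<bar> / pi)\<^sup>2 \<le> (sin (\<bar>x\<bar> / 2))\<^sup>2" by (intro power_mono) auto
  moreover have "cos \<bar>x\<bar> = 1 - 2 * (sin (\<bar>x\<bar> / 2))\<^sup>2" using cos_double_sin[of "\<bar>x\<bar> / 2"] by simp
  ultimately show ?thesis by (simp add: power_divide)
qed

text \<open>
  The Dirichlet kernel.
\<close>
lemma sum_cos_le:
  fixes \<theta> :: real
  assumes "0 < \<bar>\<theta>\<bar>" "\<bar>\<theta>\<bar> \<le> pi"
  shows "(\<Sum>k=1..N. cos (real k * \<theta>)) \<le> pi / (2 * \<bar>\<theta>\<bar>)"
proof -
  define h where "h = sin (\<bar>\<theta>\<bar> / 2)"
  have h: "\<bar>\<theta>\<bar> / pi \<le> h" using jordan_sin_ge[of "\<bar>\<theta>\<bar> / 2"] assms by (simp add: h_def)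
  then have h0: "0 < h" using assms by (smt (verit) divide_pos_pos pi_gt_zero)
  have "2 * h * (\<Sum>k=1..N. cos (real k * \<bar>\<theta>\<bar>)) = sin ((real N + 1 / 2) * \<bar>\<theta>\<bar>) - h"
  proof (induction N)
    case (Suc N)
    have "2 * h * cos (real (Suc N) * \<bar>\<theta>\<bar>) = sin ((real (Suc N) + 1 / 2) * \<bar>\<theta>\<bar>) - sin ((real N + 1 / 2) * \<bar>\<theta>\<bar>)"
    proof -
      have "(real (Suc N) + 1 / 2) * \<bar>\<theta>\<bar> = real (Suc N) * \<bar>\<theta>\<bar> + \<bar>\<theta>\<bar> / 2"
        "(real N + 1 / 2) * \<bar>\<theta>\<bar> = real (Suc N) * \<bar>\<theta>\<bar> - \<bar>\<theta>\<bar> / 2" by (simp_all add: field_simps)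
      then show ?thesis unfolding h_def by (simp only: sin_add sin_diff) (simp add: algebra_simps)
    qed
    then show ?case using Suc by (simp add: distrib_left)
  qed (simp add: h_def)
  also have "\<dots> \<le> 1" using h0 sin_le_one[of "(real N + 1 / 2) * \<bar>\<theta>\<bar>"] by linarith
  finally have "(\<Sum>k=1..N. cos (real k * \<bar>\<theta>\<bar>)) \<le> 1 / (2 * h)" using h0 by (simp add: field_simps)
  also have "\<dots> \<le> 1 / (2 * (\<bar>\<theta>\<bar> / pi))" using h h0 assms by (intro divide_left_mono mult_pos_pos) auto
  also have "\<dots> = pi / (2 * \<bar>\<theta>\<bar>)" by simp
  also have "(\<Sum>k=1..N. cos (real k * \<bar>\<theta>\<bar>)) = (\<Sum>k=1..N. cos (real k * \<theta>))"
    by (intro sum.cong refl) (auto simp: abs_if)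
  finally show ?thesis .
qed

text \<open>
  The gain over the trivial bound at angle \<open>\<theta>\<close> from the part sizes in \<open>K\<close>.
\<close>
definition damping :: "nat set \<Rightarrow> real \<Rightarrow> real \<Rightarrow> real" where
  "damping K t \<theta> = (\<Prod>k\<in>K. (1 - exp (- t) ^ k) / norm (1 - (of_real (exp (- t)) * cis \<theta>) ^ k))"

text \<open>
  For \<open>k \<le> 1 / (2 t)\<close> the angle \<open>k \<theta>\<close> stays in \<open>{-pi..pi}\<close>, where \<open>1 - cos\<close> is at least quadratic, and
  every factor gains the same amount, of order \<open>\<theta>\<^sup>2 / t\<^sup>2\<close>. There are about \<open>1 / (2 t)\<close> factors, which
  gives a Gaussian in \<open>\<theta> / t\<^sup>3\<^sup>/\<^sup>2\<close>.
\<close>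
lemma damping_small_angle:
  assumes t: "0 < t" "t \<le> 1 / 8" and \<theta>: "\<bar>\<theta>\<bar> \<le> 2 * pi * t"
  shows "damping ({1..nat \<lfloor>1 / (2 * t)\<rfloor>} - {m}) t \<theta> \<le> 38 * pi\<^sup>2 / (1 + \<theta>\<^sup>2 / t ^ 3)"
proof -
  define N where "N = nat \<lfloor>1 / (2 * t)\<rfloor>"
  define K where "K = {1..N} - {m}"
  define Y where "Y = 4 / (3 * pi\<^sup>2) * (\<theta>\<^sup>2 / t\<^sup>2)"
  have N: "real N \<le> 1 / (2 * t)" "1 / (2 * t) - 1 \<le> real N" using t by (auto simp: N_def)
  have "\<theta>\<^sup>2 \<le> (2 * pi * t)\<^sup>2" using \<theta> power_mono[of "\<bar>\<theta>\<bar>" "2 * pi * t" 2] by simp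
  then have "\<theta>\<^sup>2 / t\<^sup>2 \<le> 4 * pi\<^sup>2" using t by (simp add: power_mult_distrib field_simps)
  then have "Y \<le> 4 / (3 * pi\<^sup>2) * (4 * pi\<^sup>2)" unfolding Y_def by (intro mult_left_mono) auto
  then have Y: "0 \<le> Y" "Y \<le> 16 / 3" by (auto simp: Y_def)
  have "(damping K t \<theta>)\<^sup>2 = (\<Prod>k\<in>K. ((1 - exp (- t) ^ k) / norm (1 - (of_real (exp (- t)) * cis \<theta>) ^ k))\<^sup>2)"
    by (simp add: damping_def prod_power_distrib)
  also have "\<dots> \<le> (\<Prod>k\<in>K. exp (- (Y / (1 + 16 / 3))))"
  proof (intro prod_mono conjI damping_factor_le)
    fix k assume "k \<in> K"
    then have k: "k \<ge> 1" "real k \<le> real N" by (auto simp: K_def)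
    have kt: "real k * t \<le> 1 / 2"
    proof -
      have "real k \<le> 1 / (2 * t)" using k N by linarith
      then show ?thesis using t by (simp add: field_simps)
    qed
    then show "real k * t \<le> 1" by simp
    have "\<bar>real k * \<theta>\<bar> \<le> real k * (2 * pi * t)" unfolding abs_mult using \<theta> by (simp add: mult_left_mono)
    also have "\<dots> \<le> pi" using mult_right_mono[OF kt, of "2 * pi"] by (simp add: mult_ac)
    finally have "2 * (real k * \<theta>)\<^sup>2 / pi\<^sup>2 \<le> 1 - cos (real k * \<theta>)" by (rule one_minus_cos_ge)
    then have "2 / 3 * (2 * (real k * \<theta>)\<^sup>2 / pi\<^sup>2) / (real k * t)\<^sup>2 \<le> 2 / 3 * (1 - cos (real k * \<theta>)) / (real k * t)\<^sup>2"
      by (intro divide_right_mono mult_left_mono) auto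
    also have "2 / 3 * (2 * (real k * \<theta>)\<^sup>2 / pi\<^sup>2) / (real k * t)\<^sup>2 = Y"
      using k t by (simp add: Y_def power_mult_distrib field_simps)
    finally show "Y \<le> 2 / 3 * (1 - cos (real k * \<theta>)) / (real k * t)\<^sup>2" .
    show "1 \<le> k" by (rule k)
  qed (use t Y in auto)
  also have "\<dots> = exp (- (Y / (1 + 16 / 3))) ^ card K" by simp
  also have "\<dots> = exp (real (card K) * - (Y / (1 + 16 / 3)))" by (rule exp_of_nat_mult[symmetric])
  also have "\<dots> \<le> exp (- (\<theta>\<^sup>2 / t ^ 3 / (19 * pi\<^sup>2)))"
  proof -
    \<comment> \<open>One unit is lost to the rounding of \<open>1 / (2 t)\<close> and one to the removal of \<open>m\<close>.\<close>
    have "1 / (4 * t) \<le> 1 / (2 * t) - 2" using t by (simp add: field_simps)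
    also have "\<dots> \<le> real (card K)"
    proof -
      have "card {1..N} \<le> card K + 1" unfolding K_def by (metis One_nat_def card_Diff1_le card_Diff_singleton_if diff_le_self le_diff_conv order_refl)
      then show ?thesis using N by simp
    qed
    finally have "1 / (4 * t) * (Y / (1 + 16 / 3)) \<le> real (card K) * (Y / (1 + 16 / 3))"
      using Y by (intro mult_right_mono) auto
    also have "1 / (4 * t) * (Y / (1 + 16 / 3)) = \<theta>\<^sup>2 / t ^ 3 / (19 * pi\<^sup>2)"
      using t by (simp add: Y_def power2_eq_square power3_eq_cube field_simps)
    finally show ?thesis by simp
  qed
  also have "\<dots> = (exp (- (\<theta>\<^sup>2 / t ^ 3 / (38 * pi\<^sup>2))))\<^sup>2" by (simp flip: exp_double)
  finally have "damping K t \<theta> \<le> exp (- (\<theta>\<^sup>2 / t ^ 3 / (38 * pi\<^sup>2)))" by (rule power2_le_imp_le) simp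
  also have "\<dots> \<le> 1 / (1 + \<theta>\<^sup>2 / t ^ 3 / (38 * pi\<^sup>2))"
    by (rule exp_minus_le_inverse) (use t in simp)
  also have "\<dots> = 38 * pi\<^sup>2 / (38 * pi\<^sup>2 + \<theta>\<^sup>2 / t ^ 3)"
  proof -
    have "38 * pi\<^sup>2 * (1 + \<theta>\<^sup>2 / t ^ 3 / (38 * pi\<^sup>2)) = 38 * pi\<^sup>2 + \<theta>\<^sup>2 / t ^ 3" by (simp add: distrib_left)
    then show ?thesis by (metis mult_divide_mult_cancel_left mult.right_neutral mult_eq_0_iff pi_neq_zero power_not_zero zero_neq_numeral)
  qed
  also have "\<dots> \<le> 38 * pi\<^sup>2 / (1 + \<theta>\<^sup>2 / t ^ 3)"
  proof -
    have "1\<^sup>2 \<le> pi\<^sup>2" using pi_gt3 by (intro power_mono) auto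
    then show ?thesis using t by (intro divide_left_mono mult_pos_pos add_right_mono add_pos_nonneg) auto
  qed
  finally show ?thesis by (simp add: K_def N_def)
qed

text \<open>
  By \<open>sum_cos_le\<close> the angles \<open>k \<theta>\<close> with \<open>k \<le> 1 / t\<close> are away from multiples of \<open>2 \<pi>\<close> on average. This
  gives a bound of the form \<open>exp (- c / t)\<close>, which is smaller than any power of \<open>t\<close>.
\<close>
lemma damping_large_angle:
  assumes t: "0 < t" "t \<le> 1 / 8" and \<theta>: "2 * pi * t \<le> \<bar>\<theta>\<bar>" "\<bar>\<theta>\<bar> \<le> pi"
  shows "damping ({1..nat \<lfloor>1 / t\<rfloor>} - {m}) t \<theta> \<le> 56 ^ 3 * (1 + pi\<^sup>2) / (1 + \<theta>\<^sup>2 / t ^ 3)"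
proof -
  define N where "N = nat \<lfloor>1 / t\<rfloor>"
  define K where "K = {1..N} - {m}"
  define c where "c k = 1 - cos (real k * \<theta>)" for k
  have c: "0 \<le> c k" "c k \<le> 2" for k using cos_ge_minus_one[of "real k * \<theta>"] by (auto simp: c_def simp del: cos_ge_minus_one)
  have N: "real N \<le> 1 / t" "1 / t - 1 \<le> real N" using t by (auto simp: N_def)
  have \<theta>0: "0 < \<bar>\<theta>\<bar>" using \<theta> t by (smt (verit) mult_pos_pos pi_gt_zero)
  have "(damping K t \<theta>)\<^sup>2 = (\<Prod>k\<in>K. ((1 - exp (- t) ^ k) / norm (1 - (of_real (exp (- t)) * cis \<theta>) ^ k))\<^sup>2)"
    by (simp add: damping_def prod_power_distrib)
  also have "\<dots> \<le> (\<Prod>k\<in>K. exp (- ((2 / 3 * c k) / (1 + 4 / 3))))"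
  proof (intro prod_mono conjI damping_factor_le)
    fix k assume "k \<in> K"
    then have k: "k \<ge> 1" "real k \<le> real N" by (auto simp: K_def)
    have "real k \<le> 1 / t" using k N by linarith
    then show kt: "real k * t \<le> 1" using t by (simp add: field_simps)
    show "1 \<le> k" by (rule k)
    show "2 / 3 * c k \<le> 2 / 3 * (1 - cos (real k * \<theta>)) / (real k * t)\<^sup>2"
    proof -
      have "(real k * t)\<^sup>2 \<le> 1" using kt t by (simp add: power_le_one)
      moreover have "0 < (real k * t)\<^sup>2" using k t by simp
      ultimately have "2 / 3 * c k / 1 \<le> 2 / 3 * c k / (real k * t)\<^sup>2" using c[of k] by (intro divide_left_mono) auto
      then show ?thesis by (simp add: c_def)
    qed
  qed (use t c in auto)
  also have "\<dots> = exp (- (2 / 7) * (\<Sum>k\<in>K. c k))"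
    unfolding K_def by (simp add: exp_sum[symmetric] sum_distrib_left sum_negf)
  also have "\<dots> \<le> exp (- (2 / 7) * (3 / (8 * t)))"
  proof -
    have "(\<Sum>k=1..N. c k) = real N - (\<Sum>k=1..N. cos (real k * \<theta>))" by (simp add: c_def sum_subtractf)
    moreover have "(\<Sum>k=1..N. cos (real k * \<theta>)) \<le> 1 / (4 * t)"
    proof -
      have "(\<Sum>k=1..N. cos (real k * \<theta>)) \<le> pi / (2 * \<bar>\<theta>\<bar>)" using \<theta> \<theta>0 by (intro sum_cos_le)
      also have "\<dots> \<le> pi / (2 * (2 * pi * t))" using \<theta> \<theta>0 t by (intro divide_left_mono mult_pos_pos mult_left_mono) auto
      finally show ?thesis by simp
    qed
    moreover have "(\<Sum>k=1..N. c k) \<le> (\<Sum>k\<in>K. c k) + 2"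
    proof -
      have "(\<Sum>k=1..N. c k) \<le> (\<Sum>k\<in>insert m K. c k)"
        using c by (intro sum_mono2) (auto simp: K_def)
      also have "\<dots> = c m + (\<Sum>k\<in>K. c k)" by (rule sum.insert) (auto simp: K_def)
      finally show ?thesis using c(2)[of m] by simp
    qed
    \<comment> \<open>The losses are the rounding of \<open>1 / t\<close>, the sum of cosines, and at most \<open>2\<close> for the removal of \<open>m\<close>.\<close>
    moreover have "3 / (8 * t) \<le> 1 / t - 1 - 1 / (4 * t) - 2" using t by (simp add: field_simps)
    ultimately have "3 / (8 * t) \<le> (\<Sum>k\<in>K. c k)" using N by linarith
    then show ?thesis by simp
  qed
  also have "\<dots> = (exp (- (3 / (56 * t))))\<^sup>2" by (simp flip: exp_double)
  finally have "damping K t \<theta> \<le> exp (- (3 / (56 * t)))" by (rule power2_le_imp_le) simp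
  also have "\<dots> = 1 / exp (1 / (56 * t)) ^ 3" by (simp add: exp_minus inverse_eq_divide flip: exp_of_nat_mult)
  also have "\<dots> \<le> 1 / (1 / (56 * t)) ^ 3"
  proof -
    have "1 / (56 * t) \<le> exp (1 / (56 * t))" using exp_ge_add_one_self[of "1 / (56 * t)"] by linarith
    then show ?thesis using t by (intro divide_left_mono power_mono mult_pos_pos) auto
  qed
  also have "\<dots> = 56 ^ 3 * t ^ 3" using t by (simp add: power_divide power_mult_distrib)
  also have "\<dots> \<le> 56 ^ 3 * (1 + pi\<^sup>2) / (1 + \<theta>\<^sup>2 / t ^ 3)"
  proof -
    have "t ^ 3 * (1 + \<theta>\<^sup>2 / t ^ 3) = t ^ 3 + \<theta>\<^sup>2" using t by (simp add: distrib_left)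
    also have "\<dots> \<le> 1 + pi\<^sup>2" using t \<theta> power_mono[of "\<bar>\<theta>\<bar>" pi 2] by (intro add_mono power_le_one) auto
    finally have "t ^ 3 \<le> (1 + pi\<^sup>2) / (1 + \<theta>\<^sup>2 / t ^ 3)" using t by (simp add: pos_le_divide_eq add_pos_nonneg)
    then have "56 ^ 3 * t ^ 3 \<le> 56 ^ 3 * ((1 + pi\<^sup>2) / (1 + \<theta>\<^sup>2 / t ^ 3))" by (rule mult_left_mono) simp
    then show ?thesis by (simp only: times_divide_eq_right)
  qed
  finally show ?thesis by (simp add: K_def N_def)
qed

text \<open>
  The scale \<open>t\<^sup>3\<^sup>/\<^sup>2\<close> of the angle is that of the saddle point, and the bound is integrable in the
  rescaled angle. The set \<open>K\<close> depends on \<open>m\<close>, but the bound does not.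
\<close>
lemma damping_bound:
  "\<exists>C>0. \<forall>t \<theta> m. 0 < t \<longrightarrow> t \<le> 1 / 8 \<longrightarrow> \<bar>\<theta>\<bar> \<le> pi \<longrightarrow>
     (\<exists>K. finite K \<and> K \<subseteq> {1..} - {m} \<and> damping K t \<theta> \<le> C / (1 + \<theta>\<^sup>2 / t ^ 3))"
proof (intro exI[of _ "56 ^ 3 * (1 + pi\<^sup>2)"] conjI allI impI)
  show "0 < 56 ^ 3 * (1 + pi\<^sup>2)" by (simp add: add_pos_nonneg)
  fix t \<theta> :: real and m :: nat
  assume t: "0 < t" "t \<le> 1 / 8" and \<theta>: "\<bar>\<theta>\<bar> \<le> pi"
  show "\<exists>K. finite K \<and> K \<subseteq> {1..} - {m} \<and> damping K t \<theta> \<le> 56 ^ 3 * (1 + pi\<^sup>2) / (1 + \<theta>\<^sup>2 / t ^ 3)"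
  proof (cases "\<bar>\<theta>\<bar> \<le> 2 * pi * t")
    case True
    have "38 * pi\<^sup>2 \<le> 56 ^ 3 * (1 + pi\<^sup>2)" by (simp add: distrib_left)
    moreover have "0 \<le> 1 + \<theta>\<^sup>2 / t ^ 3" using t by simp
    ultimately have "38 * pi\<^sup>2 / (1 + \<theta>\<^sup>2 / t ^ 3) \<le> 56 ^ 3 * (1 + pi\<^sup>2) / (1 + \<theta>\<^sup>2 / t ^ 3)"
      by (rule divide_right_mono)
    from order.trans[OF damping_small_angle[OF t True] this]
    have bound: "damping ({1..nat \<lfloor>1 / (2 * t)\<rfloor>} - {m}) t \<theta> \<le> 56 ^ 3 * (1 + pi\<^sup>2) / (1 + \<theta>\<^sup>2 / t ^ 3)" .
    have sub: "{1..nat \<lfloor>1 / (2 * t)\<rfloor>} - {m} \<subseteq> {1..} - {m}" by auto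
    show ?thesis by (rule exI, rule conjI[OF _ conjI[OF sub bound]]) simp
  next
    case False
    then have "2 * pi * t \<le> \<bar>\<theta>\<bar>" by simp
    from damping_large_angle[OF t this \<theta>]
    have bound: "damping ({1..nat \<lfloor>1 / t\<rfloor>} - {m}) t \<theta> \<le> 56 ^ 3 * (1 + pi\<^sup>2) / (1 + \<theta>\<^sup>2 / t ^ 3)" .
    have sub: "{1..nat \<lfloor>1 / t\<rfloor>} - {m} \<subseteq> {1..} - {m}" by auto
    show ?thesis by (rule exI, rule conjI[OF _ conjI[OF sub bound]]) simp
  qed
qed

lemma ovp_prod_real_bounds:
  assumes "t > 0"
  shows "0 \<le> ovp_prod N (exp (- t))" "ovp_prod N (exp (- t)) \<le> exp (log_ovp_real t)"
proof -
  define r where "r = exp (- t)"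
  have r: "0 < r" "r < 1" using assms by (auto simp: r_def)
  have fac: "1 \<le> (1 + r ^ k) / (1 - r ^ k)" if "k \<ge> 1" for k
  proof -
    have "r ^ k < 1" "0 < r ^ k" using r that by (auto simp: power_less_one_iff)
    then show ?thesis by simp
  qed
  have nonneg: "0 \<le> ovp_prod N r" for N
    unfolding ovp_prod_def using fac by (intro prod_nonneg) (force intro: order.trans[OF zero_le_one])
  have "incseq (\<lambda>N. ovp_prod N r)"
  proof (rule incseq_SucI)
    fix N
    have "ovp_prod (Suc N) r = ovp_prod N r * ((1 + r ^ Suc N) / (1 - r ^ Suc N))" by (simp add: ovp_prod_def)
    then show "ovp_prod N r \<le> ovp_prod (Suc N) r" using mult_left_mono[OF fac[of "Suc N"] nonneg[of N]] by simp
  qed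
  from incseq_le[OF this ovp_prod_real_tendsto[OF assms, folded r_def]] nonneg
  show "0 \<le> ovp_prod N (exp (- t))" "ovp_prod N (exp (- t)) \<le> exp (log_ovp_real t)" by (auto simp: r_def)
qed

lemma mex_weight_pos:
  fixes r :: real
  assumes "0 < r" "r < 1" "m \<ge> 1"
  shows "0 < mex_weight m r"
  unfolding mex_weight_def using assms
  by (intro mult_pos_pos prod_pos divide_pos_pos add_pos_pos ballI) (auto simp: power_less_one_iff)

lemma exp_minus_Complex: "exp (- Complex t (- \<theta>)) = of_real (exp (- t)) * cis \<theta>"
  by (simp add: exp_eq_polar)

lemma norm_mex_product_limit_le:
  assumes t: "t > 0" and m: "m \<ge> 1" and K: "finite K" "K \<subseteq> {1..} - {m}"
  shows "norm (exp (log_ovp (Complex t (- \<theta>))) * mex_weight m (exp (- Complex t (- \<theta>))))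
    \<le> exp (log_ovp_real t) * mex_weight m (exp (- t)) * damping K t \<theta>"
proof (rule LIMSEQ_le)
  let ?q = "exp (- Complex t (- \<theta>))"
  show "(\<lambda>N. norm (ovp_prod N ?q * mex_weight m ?q)) \<longlonglongrightarrow> norm (exp (log_ovp (Complex t (- \<theta>))) * mex_weight m ?q)"
    using t by (intro tendsto_intros ovp_prod_tendsto) simp
  show "(\<lambda>N. ovp_prod N (exp (- t)) * mex_weight m (exp (- t)) * damping K t \<theta>) \<longlonglongrightarrow>
    exp (log_ovp_real t) * mex_weight m (exp (- t)) * damping K t \<theta>"
    by (intro tendsto_intros ovp_prod_real_tendsto t)
  obtain M where M: "K \<subseteq> {..M}" using K(1) by (metis finite_nat_iff_bounded_le)
  show "\<exists>N. \<forall>n\<ge>N. norm (ovp_prod n ?q * mex_weight m ?q) \<le> ovp_prod n (exp (- t)) * mex_weight m (exp (- t)) * damping K t \<theta>"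
  proof (intro exI[of _ "max m M"] allI impI)
    fix n assume n: "max m M \<le> n"
    have sub: "K \<subseteq> {1..n} - {m}" using K(2) M n by fastforce
    have "norm ?q = exp (- t)" "exp (- t) < 1" using t by auto
    from norm_mex_product_le[OF this m _ sub] n
    show "norm (ovp_prod n ?q * mex_weight m ?q) \<le> ovp_prod n (exp (- t)) * mex_weight m (exp (- t)) * damping K t \<theta>"
      unfolding damping_def exp_minus_Complex by simp
  qed
qed

text \<open>
  Cauchy's formula for the truncated product holds for every large cutoff \<open>N\<close> with the same value of
  the integral, so one may let \<open>N\<close> tend to infinity under the integral.
\<close>
lemma mex_count_integral:
  fixes t :: real and m n :: nat
  assumes t: "t > 0" and m: "m \<ge> 1"
  defines "f \<equiv> \<lambda>\<theta>. indicator {-pi..pi} \<theta> *\<^sub>R (exp (log_ovp (Complex t (- \<theta>))) * mex_weight m (exp (- Complex t (- \<theta>))) * cis (- (real n * \<theta>)))"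
  shows "(\<integral>\<theta>. f \<theta> \<partial>lborel) = of_real (2 * pi * (real (mex_count m n) * exp (- t) ^ n))"
    and "integrable lborel f"
proof -
  define q where "q \<theta> = of_real (exp (- t)) * cis \<theta>" for \<theta>
  define s where "s N \<theta> = indicator {-pi..pi} \<theta> *\<^sub>R (ovp_prod (N + max m n) (q \<theta>) * mex_weight m (q \<theta>) * cis (- (real n * \<theta>)))" for N \<theta>
  define B where "B = exp (log_ovp_real t) * mex_weight m (exp (- t))"
  have r: "0 < exp (- t)" "exp (- t) < 1" using t by auto
  have nq: "norm (q \<theta>) = exp (- t)" for \<theta> by (simp add: q_def norm_mult)
  have cis_meas [measurable]: "(\<lambda>\<theta>. cis (c * \<theta>)) \<in> borel_measurable lborel" for c
    by (simp, intro borel_measurable_continuous_onI continuous_intros)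
  have q_meas [measurable]: "q \<in> borel_measurable lborel"
    unfolding q_def using cis_meas[of 1] by simp
  have s_meas: "s N \<in> borel_measurable lborel" for N
    unfolding s_def ovp_prod_def mex_weight_def using cis_meas[of "- real n"] by simp
  have lim: "(\<lambda>N. s N \<theta>) \<longlonglongrightarrow> f \<theta>" for \<theta>
  proof -
    have "(\<lambda>N. ovp_prod (N + max m n) (exp (- Complex t (- \<theta>)))) \<longlonglongrightarrow> exp (log_ovp (Complex t (- \<theta>)))"
      using t by (intro LIMSEQ_ignore_initial_segment ovp_prod_tendsto) simp
    then show ?thesis
      unfolding s_def f_def q_def exp_minus_Complex[symmetric] by (intro tendsto_intros)
  qed
  have f_meas: "f \<in> borel_measurable lborel" by (rule borel_measurable_LIMSEQ_metric[OF s_meas lim])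
  have bound: "norm (s N \<theta>) \<le> indicator {-pi..pi} \<theta> *\<^sub>R B" for N \<theta>
  proof -
    have "norm (ovp_prod (N + max m n) (q \<theta>) * mex_weight m (q \<theta>)) \<le> ovp_prod (N + max m n) (exp (- t)) * mex_weight m (exp (- t))"
      using norm_mex_product_le[OF nq r(2) m, of "N + max m n" "{}" \<theta>] by simp
    also have "\<dots> \<le> B" unfolding B_def
      using ovp_prod_real_bounds[OF t] mex_weight_pos[OF r m] by (intro mult_right_mono) auto
    finally show ?thesis unfolding s_def by (simp add: norm_mult indicator_def)
  qed
  have int_B: "integrable lborel (\<lambda>\<theta>. indicator {-pi..pi} \<theta> *\<^sub>R B)"
    by (intro integrable_scaleR_left impI) simp
  have AE_lim: "AE \<theta> in lborel. (\<lambda>N. s N \<theta>) \<longlonglongrightarrow> f \<theta>" by (rule AE_I2) (rule lim)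
  have AE_bound: "AE \<theta> in lborel. norm (s N \<theta>) \<le> indicator {-pi..pi} \<theta> *\<^sub>R B" for N by (rule AE_I2) (rule bound)
  show "integrable lborel f"
    by (rule integrable_dominated_convergence[OF f_meas s_meas int_B AE_lim AE_bound])
  have "(\<lambda>N. \<integral>\<theta>. s N \<theta> \<partial>lborel) \<longlonglongrightarrow> (\<integral>\<theta>. f \<theta> \<partial>lborel)"
    by (rule integral_dominated_convergence[OF f_meas s_meas int_B AE_lim AE_bound])
  moreover have "(\<integral>\<theta>. s N \<theta> \<partial>lborel) = of_real (2 * pi * (real (mex_count m n) * exp (- t) ^ n))" for N
  proof -
    let ?M = "N + max m n"
    let ?a = "\<lambda>j. real (card (ovp_upto {1..<m} {m} ?M j))"
    have "(\<Sum>j. of_real (?a j) * (of_real (exp (- t)) * cis \<theta>) ^ j) = ovp_prod ?M (q \<theta>) * mex_weight m (q \<theta>)" for \<theta>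
      using ovp_upto_mex_sums[of "q \<theta>" m ?M] nq r m by (simp add: sums_iff q_def)
    then have "(\<integral>\<theta>. s N \<theta> \<partial>lborel) = (\<integral>\<theta>. indicator {-pi..pi} \<theta> *\<^sub>R ((\<Sum>j. of_real (?a j) * (of_real (exp (- t)) * cis \<theta>) ^ j) * cis (- (real n * \<theta>))) \<partial>lborel)"
      unfolding s_def by (simp only:)
    also have "\<dots> = of_real (2 * pi * (?a n * exp (- t) ^ n))"
      using r m ovp_upto_mex_sums[of "exp (- t)" m ?M] by (intro coefficient_integral) (auto simp: sums_iff)
    also have "card (ovp_upto {1..<m} {m} ?M n) = mex_count m n"
      using m by (intro mex_count_eq[symmetric]) auto
    finally show ?thesis .
  qed
  ultimately show "(\<integral>\<theta>. f \<theta> \<partial>lborel) = of_real (2 * pi * (real (mex_count m n) * exp (- t) ^ n))"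
    by (simp only: LIMSEQ_const_iff)
qed

text \<open>
  Up to the truncation, the expected value of the odd mex in the distribution with weights \<open>q\<close> to the
  size.
\<close>
definition mex_mean :: "nat \<Rightarrow> 'a :: field \<Rightarrow> 'a" where
  "mex_mean n q = (\<Sum>i\<le>n. of_nat (2 * i + 1) * mex_weight (2 * i + 1) q)"

lemma mex_mean_of_real: "mex_mean n (exp (- complex_of_real t)) = of_real (mex_mean n (exp (- t)))"
proof -
  have "mex_weight m (complex_of_real r) = of_real (mex_weight m r)" for m r
    by (simp add: mex_weight_def)
  moreover have "exp (- complex_of_real t) = of_real (exp (- t))" by (simp flip: exp_of_real)
  ultimately show ?thesis unfolding mex_mean_def by simp
qed

lemma mex_mean_pos: "0 < r \<Longrightarrow> r < 1 \<Longrightarrow> 0 < mex_mean n (r :: real)"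
  unfolding mex_mean_def by (intro sum_pos mult_pos_pos mex_weight_pos) auto

definition sigma_integrand :: "nat \<Rightarrow> real \<Rightarrow> real \<Rightarrow> complex" where
  "sigma_integrand n t \<theta> = indicator {-pi..pi} \<theta> *\<^sub>R
     (exp (log_ovp (Complex t (- \<theta>))) * mex_mean n (exp (- Complex t (- \<theta>))) * cis (- (real n * \<theta>)))"

lemma sigma_integral:
  assumes t: "t > 0"
  shows "(\<integral>\<theta>. sigma_integrand n t \<theta> \<partial>lborel) = of_real (2 * pi * (real (sigma_mex_odd n) * exp (- t) ^ n))"
    and "sigma_integrand n t \<in> borel_measurable lborel"
proof -
  let ?f = "\<lambda>m \<theta>. indicator {-pi..pi} \<theta> *\<^sub>R (exp (log_ovp (Complex t (- \<theta>))) * mex_weight m (exp (- Complex t (- \<theta>))) * cis (- (real n * \<theta>)))"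
  have eq: "sigma_integrand n t = (\<lambda>\<theta>. \<Sum>i\<le>n. of_nat (2 * i + 1) * ?f (2 * i + 1) \<theta>)"
    unfolding sigma_integrand_def mex_mean_def
    by (intro ext) (simp add: sum_distrib_left sum_distrib_right scaleR_sum_right mult_ac del: of_nat_Suc of_nat_add)
  have f: "(\<integral>\<theta>. ?f (2 * i + 1) \<theta> \<partial>lborel) = of_real (2 * pi * (real (mex_count (2 * i + 1) n) * exp (- t) ^ n))"
    "integrable lborel (?f (2 * i + 1))" for i
    by (rule mex_count_integral[OF t], simp)+
  show "sigma_integrand n t \<in> borel_measurable lborel"
    unfolding eq using borel_measurable_integrable[OF f(2)] by (intro borel_measurable_sum borel_measurable_times) auto
  have "(\<integral>\<theta>. sigma_integrand n t \<theta> \<partial>lborel) = (\<Sum>i\<le>n. of_nat (2 * i + 1) * of_real (2 * pi * (real (mex_count (2 * i + 1) n) * exp (- t) ^ n)))"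
    unfolding eq f(1)[symmetric] using f(2)
    by (subst Bochner_Integration.integral_sum) (simp_all only: integrable_mult_right integral_mult_right_zero)
  also have "\<dots> = of_real (2 * pi * (real (sigma_mex_odd n) * exp (- t) ^ n))"
  proof -
    have "(\<Sum>i\<le>n. real (2 * i + 1) * (2 * pi * (real (mex_count (2 * i + 1) n) * exp (- t) ^ n))) =
        2 * pi * (real (sigma_mex_odd n) * exp (- t) ^ n)"
      unfolding sigma_mex_odd_eq of_nat_sum of_nat_mult sum_distrib_left sum_distrib_right
      by (intro sum.cong refl) (simp only: mult_ac)
    moreover have "of_nat j * complex_of_real x = of_real (real j * x)" for j x by simp
    ultimately show ?thesis by (simp only: of_real_sum[symmetric])
  qed
  finally show "(\<integral>\<theta>. sigma_integrand n t \<theta> \<partial>lborel) = of_real (2 * pi * (real (sigma_mex_odd n) * exp (- t) ^ n))" .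
qed

text \<open>
  As \<open>mex_weight\<close> is positive on the real axis, bounds for the individual \<open>m\<close> relative to the value at
  \<open>\<theta> = 0\<close> add up to the same bound for the sum.
\<close>
lemma sigma_integrand_bound:
  "\<exists>C>0. \<forall>n t \<theta>. 0 < t \<longrightarrow> t \<le> 1 / 8 \<longrightarrow>
     norm (sigma_integrand n t \<theta>) \<le> exp (log_ovp_real t) * mex_mean n (exp (- t)) * (C / (1 + \<theta>\<^sup>2 / t ^ 3))"
proof -
  obtain C where C: "C > 0" "\<And>t \<theta> m. 0 < t \<Longrightarrow> t \<le> 1 / 8 \<Longrightarrow> \<bar>\<theta>\<bar> \<le> pi \<Longrightarrow>
     \<exists>K. finite K \<and> K \<subseteq> {1..} - {m} \<and> damping K t \<theta> \<le> C / (1 + \<theta>\<^sup>2 / t ^ 3)"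
    using damping_bound by blast
  have "norm (sigma_integrand n t \<theta>) \<le> exp (log_ovp_real t) * mex_mean n (exp (- t)) * (C / (1 + \<theta>\<^sup>2 / t ^ 3))"
    if t: "0 < t" "t \<le> 1 / 8" for n t \<theta>
  proof (cases "\<bar>\<theta>\<bar> \<le> pi")
    case True
    let ?z = "Complex t (- \<theta>)"
    define D where "D = C / (1 + \<theta>\<^sup>2 / t ^ 3)"
    have r: "0 < exp (- t)" "exp (- t) < 1" using t by auto
    have each: "norm (exp (log_ovp ?z) * mex_weight m (exp (- ?z))) \<le> exp (log_ovp_real t) * mex_weight m (exp (- t)) * D"
      if m: "m \<ge> 1" for m
    proof -
      obtain K where K: "finite K" "K \<subseteq> {1..} - {m}" "damping K t \<theta> \<le> D"
        using C(2)[OF t True] unfolding D_def by blast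
      have "norm (exp (log_ovp ?z) * mex_weight m (exp (- ?z))) \<le> exp (log_ovp_real t) * mex_weight m (exp (- t)) * damping K t \<theta>"
        by (rule norm_mex_product_limit_le[OF t(1) m K(1,2)])
      also have "\<dots> \<le> exp (log_ovp_real t) * mex_weight m (exp (- t)) * D"
        using K(3) mex_weight_pos[OF r m] by (intro mult_left_mono) auto
      finally show ?thesis .
    qed
    have "norm (sigma_integrand n t \<theta>) = norm (exp (log_ovp ?z) * mex_mean n (exp (- ?z)))"
      using True by (simp add: sigma_integrand_def norm_mult abs_le_iff)
    also have "exp (log_ovp ?z) * mex_mean n (exp (- ?z)) =
        (\<Sum>i\<le>n. of_nat (2 * i + 1) * (exp (log_ovp ?z) * mex_weight (2 * i + 1) (exp (- ?z))))"
      unfolding mex_mean_def sum_distrib_left by (intro sum.cong refl mult.left_commute)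
    also have "norm \<dots> \<le> (\<Sum>i\<le>n. real (2 * i + 1) * (exp (log_ovp_real t) * mex_weight (2 * i + 1) (exp (- t)) * D))"
    proof (intro order.trans[OF norm_sum] sum_mono)
      fix i
      show "norm (of_nat (2 * i + 1) * (exp (log_ovp ?z) * mex_weight (2 * i + 1) (exp (- ?z)))) \<le>
        real (2 * i + 1) * (exp (log_ovp_real t) * mex_weight (2 * i + 1) (exp (- t)) * D)"
        unfolding norm_mult[of "of_nat (2 * i + 1)"] norm_of_nat by (intro mult_left_mono each) auto
    qed
    also have "\<dots> = exp (log_ovp_real t) * mex_mean n (exp (- t)) * D"
      unfolding mex_mean_def sum_distrib_left sum_distrib_right by (intro sum.cong refl) (simp only: mult_ac)
    finally show ?thesis by (simp only: D_def)
  next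
    case False
    then have "sigma_integrand n t \<theta> = 0" by (auto simp: sigma_integrand_def indicator_def)
    moreover have "0 < mex_mean n (exp (- t))" using t by (intro mex_mean_pos) auto
    ultimately show ?thesis using t C(1) by (simp add: add_nonneg_nonneg)
  qed
  with C(1) show ?thesis by blast
qed

section \<open>The saddle point\<close>

lemma gaussian_integral:
  "has_bochner_integral lborel (\<lambda>u::real. exp (- (pi\<^sup>2 / 4) * u\<^sup>2)) (2 / sqrt pi)"
proof -
  let ?\<sigma> = "sqrt 2 / pi"
  have density: "normal_density 0 ?\<sigma> u = sqrt pi / 2 * exp (- (pi\<^sup>2 / 4) * u\<^sup>2)" for u
  proof -
    have s2: "?\<sigma>\<^sup>2 = 2 / pi\<^sup>2" by (simp add: power_divide)
    have "2 * pi * ?\<sigma>\<^sup>2 = 4 / pi" unfolding s2 by (simp add: power2_eq_square)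
    then have "1 / sqrt (2 * pi * ?\<sigma>\<^sup>2) = sqrt pi / 2" by (simp add: real_sqrt_divide)
    moreover have "- (u - 0)\<^sup>2 / (2 * ?\<sigma>\<^sup>2) = - (pi\<^sup>2 / 4) * u\<^sup>2" unfolding s2 by simp
    ultimately show ?thesis unfolding normal_density_def by (simp only:)
  qed
  have "has_bochner_integral lborel (normal_density 0 ?\<sigma>) 1"
    unfolding has_bochner_integral_iff
    using integrable_normal_density[of ?\<sigma> 0] integral_normal_density[of ?\<sigma> 0] by simp
  then have "has_bochner_integral lborel (\<lambda>u. 2 / sqrt pi * normal_density 0 ?\<sigma> u) (2 / sqrt pi * 1)"
    by (intro has_bochner_integral_mult_right)
  then show ?thesis unfolding density by simp
qed

text \<open>
  The choice of \<open>t\<close> makes the linear terms in \<open>u\<close> cancel.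
\<close>
lemma saddle_exponent:
  fixes t u :: real and \<nu> :: nat
  assumes t: "t > 0" and \<nu>: "real \<nu> = pi\<^sup>2 / (4 * t\<^sup>2)"
  defines "z \<equiv> Complex t (- (t * sqrt t * u))"
  shows "of_real (pi\<^sup>2) / (4 * z) - of_real (pi\<^sup>2) / (4 * of_real t) - \<i> * of_real (real \<nu> * (t * sqrt t * u))
     = - of_real (pi\<^sup>2 / 4 * u\<^sup>2) * (of_real t / z)"
proof -
  define c where "c = t * sqrt t * u"
  have c2: "c\<^sup>2 = t ^ 3 * u\<^sup>2" using t by (simp add: c_def power_mult_distrib power2_eq_square power3_eq_cube)
  define T where "T = complex_of_real t"
  define w where "w = \<i> * complex_of_real c"
  have T: "T \<noteq> 0" using t by (simp add: T_def)
  have z: "z = T - w" by (simp add: z_def c_def T_def w_def complex_eq_iff)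
  have z0: "z \<noteq> 0" using t by (auto simp: z_def complex_eq_iff)
  have w2: "w\<^sup>2 = - (T ^ 3 * of_real (u\<^sup>2))"
    by (simp add: w_def power_mult_distrib T_def flip: of_real_power of_real_mult) (simp add: c2)
  have \<nu>': "\<i> * of_real (real \<nu> * (t * sqrt t * u)) = of_real (pi\<^sup>2) / (4 * T\<^sup>2) * w"
    unfolding \<nu> by (simp add: w_def c_def T_def)
  have "1 / z - 1 / T - w / T\<^sup>2 = w\<^sup>2 / (T\<^sup>2 * z)"
  proof -
    have "1 / z - 1 / T - w / T\<^sup>2 = (T\<^sup>2 - T * z - w * z) / (T\<^sup>2 * z)"
      using T z0 by (simp add: diff_divide_distrib power2_eq_square)
    also have "T\<^sup>2 - T * z - w * z = w\<^sup>2" unfolding z by (simp add: power2_eq_square algebra_simps)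
    finally show ?thesis .
  qed
  also have "\<dots> = - of_real (u\<^sup>2) * (T / z)"
    unfolding w2 using T z0 by (simp add: power2_eq_square power3_eq_cube)
  finally have "of_real (pi\<^sup>2) / 4 * (1 / z - 1 / T - w / T\<^sup>2) = of_real (pi\<^sup>2) / 4 * (- of_real (u\<^sup>2) * (T / z))" by simp
  then show ?thesis unfolding \<nu>' T_def[symmetric] by (simp add: right_diff_distrib)
qed

text \<open>
  The integrand divided by its value at angle \<open>0\<close>. The contribution of \<open>mex_mean\<close> cancels, because it
  has the same limit at \<open>z\<close> and at \<open>t\<close>.
\<close>
lemma integrand_limit:
  fixes t :: "nat \<Rightarrow> real" and \<nu> :: "nat \<Rightarrow> nat" and u :: real
  assumes t: "\<And>n. 0 < t n" "\<And>n. t n \<le> 1" "t \<longlonglongrightarrow> 0"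
    and \<nu>: "\<And>n. real (\<nu> n) = pi\<^sup>2 / (4 * (t n)\<^sup>2)"
  defines "c \<equiv> \<lambda>n. t n * sqrt (t n)"
  shows "(\<lambda>n. sigma_integrand (\<nu> n) (t n) (c n * u) / of_real (exp (log_ovp_real (t n)) * mex_mean (\<nu> n) (exp (- t n))))
     \<longlonglongrightarrow> of_real (exp (- (pi\<^sup>2 / 4) * u\<^sup>2))"
    and "(\<lambda>n. sqrt (t n) * mex_mean (\<nu> n) (exp (- t n))) \<longlonglongrightarrow> sqrt pi / 2"
proof -
  define z where "z n = Complex (t n) (- (c n * u))" for n
  have sq: "(\<lambda>n. sqrt (t n)) \<longlonglongrightarrow> 0" using tendsto_real_sqrt[OF t(3)] by simp
  have z_eq: "z n = of_real (t n) * (1 - \<i> * of_real (sqrt (t n) * u))" for n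
    by (simp add: z_def c_def complex_eq_iff)
  have zt: "(\<lambda>n. z n / of_real (t n)) \<longlonglongrightarrow> 1"
  proof -
    have "(\<lambda>n. 1 - \<i> * complex_of_real (sqrt (t n) * u)) \<longlonglongrightarrow> 1 - \<i> * of_real (0 * u)"
      by (intro tendsto_intros tendsto_of_real sq)
    moreover have "z n / of_real (t n) = 1 - \<i> * complex_of_real (sqrt (t n) * u)" for n
      using t(1)[of n] by (simp add: z_eq)
    ultimately show ?thesis by simp
  qed
  have \<nu>_lim: "filterlim (\<lambda>n. real (\<nu> n) * sqrt (t n)) at_top sequentially"
  proof -
    have "filterlim t (at_right 0) sequentially"
    proof -
      have "t n \<in> {0<..} \<and> t n \<noteq> 0" for n using t(1)[of n] by simp
      then show ?thesis using t(3) by (simp add: filterlim_at)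
    qed
    moreover have "filterlim (\<lambda>t::real. pi\<^sup>2 / (4 * t\<^sup>2) * sqrt t) at_top (at_right 0)" by real_asymp
    ultimately show ?thesis unfolding \<nu> by (rule filterlim_compose[rotated])
  qed
  have small: "\<forall>\<^sub>F n in sequentially. \<bar>sqrt (t n) * u\<bar> \<le> 1"
  proof -
    have "(\<lambda>n. \<bar>sqrt (t n) * u\<bar>) \<longlonglongrightarrow> \<bar>0 * u\<bar>" by (intro tendsto_intros sq)
    then have "\<forall>\<^sub>F n in sequentially. \<bar>sqrt (t n) * u\<bar> < 1" by (rule order_tendstoD) simp
    then show ?thesis by eventually_elim simp
  qed
  have im: "\<bar>c n * u\<bar> \<le> t n" if "\<bar>sqrt (t n) * u\<bar> \<le> 1" for n
  proof -
    have "\<bar>c n * u\<bar> = t n * \<bar>sqrt (t n) * u\<bar>" using t(1)[of n] by (simp add: c_def abs_mult)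
    also have "\<dots> \<le> t n * 1" using that t(1)[of n] by (intro mult_left_mono) auto
    finally show ?thesis by simp
  qed
  have real_lim: "(\<lambda>n. of_real (sqrt (t n)) * mex_mean (\<nu> n) (exp (- complex_of_real (t n)))) \<longlonglongrightarrow> of_real (sqrt pi / 2)"
    unfolding mex_mean_def
  proof (rule mex_weight_sum_limit[OF t])
    have "complex_of_real (t n) / of_real (t n) = 1" for n using t(1)[of n] by simp
    then show "(\<lambda>n. complex_of_real (t n) / of_real (t n)) \<longlonglongrightarrow> 1" by simp
  qed (use t \<nu>_lim in \<open>auto intro: less_imp_le\<close>)
  then have "(\<lambda>n. complex_of_real (sqrt (t n) * mex_mean (\<nu> n) (exp (- t n)))) \<longlonglongrightarrow> of_real (sqrt pi / 2)"
    unfolding mex_mean_of_real of_real_mult[symmetric] .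
  then show real_lim': "(\<lambda>n. sqrt (t n) * mex_mean (\<nu> n) (exp (- t n))) \<longlonglongrightarrow> sqrt pi / 2"
    by (rule tendsto_of_real_iff[THEN iffD1])
  have mean_lim: "(\<lambda>n. of_real (sqrt (t n)) * mex_mean (\<nu> n) (exp (- z n))) \<longlonglongrightarrow> of_real (sqrt pi / 2)"
  proof -
    \<comment> \<open>\<open>mex_weight_sum_limit\<close> wants \<open>z\<close> in the sector for all \<open>n\<close>, which holds only eventually.\<close>
    define z' where "z' n = (if \<bar>sqrt (t n) * u\<bar> \<le> 1 then z n else of_real (t n))" for n
    have ev: "\<forall>\<^sub>F n in sequentially. z' n = z n" using small by eventually_elim (simp add: z'_def)
    have "(\<lambda>n. of_real (sqrt (t n)) * mex_mean (\<nu> n) (exp (- z' n))) \<longlonglongrightarrow> of_real (sqrt pi / 2)"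
      unfolding mex_mean_def
    proof (rule mex_weight_sum_limit[OF t])
      show "Re (z' n) = t n" for n by (simp add: z'_def z_def)
      show "\<bar>Im (z' n)\<bar> \<le> t n" for n using im[of n] t(1)[of n] by (auto simp: z'_def z_def)
      show "(\<lambda>n. z' n / of_real (t n)) \<longlonglongrightarrow> 1"
        by (rule Lim_transform_eventually[OF zt]) (use ev in \<open>eventually_elim, simp\<close>)
    qed (rule \<nu>_lim)
    then show ?thesis
      by (rule Lim_transform_eventually) (use ev in \<open>eventually_elim, simp\<close>)
  qed
  have exponent: "(\<lambda>n. log_ovp (z n) - of_real (log_ovp_real (t n)) - \<i> * of_real (real (\<nu> n) * (c n * u))) \<longlonglongrightarrow> - of_real (pi\<^sup>2 / 4 * u\<^sup>2)"
  proof -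
    let ?d = "\<lambda>n. (log_ovp (z n) - of_real (pi\<^sup>2) / (4 * z n)) - (log_ovp (of_real (t n)) - of_real (pi\<^sup>2) / (4 * of_real (t n)))"
    have "?d \<longlonglongrightarrow> 0"
    proof (rule Lim_null_comparison)
      show "\<forall>\<^sub>F n in sequentially. norm (?d n) \<le> 16 * \<bar>sqrt (t n) * u\<bar>"
        using small
      proof eventually_elim
        case (elim n)
        have "norm (?d n) \<le> 16 * \<bar>Im (z n)\<bar> / t n"
          using t(1)[of n] im[OF elim] by (intro log_ovp_diff_bound) (auto simp: z_def)
        also have "\<dots> = 16 * \<bar>sqrt (t n) * u\<bar>" using t(1)[of n] by (simp add: z_def c_def abs_mult)
        finally show ?case .
      qed
      have "(\<lambda>n. 16 * \<bar>sqrt (t n) * u\<bar>) \<longlonglongrightarrow> 16 * \<bar>0 * u\<bar>" by (intro tendsto_intros sq)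
      then show "(\<lambda>n. 16 * \<bar>sqrt (t n) * u\<bar>) \<longlonglongrightarrow> 0" by simp
    qed
    moreover have "(\<lambda>n. - of_real (pi\<^sup>2 / 4 * u\<^sup>2) * (of_real (t n) / z n)) \<longlonglongrightarrow> - of_real (pi\<^sup>2 / 4 * u\<^sup>2) * 1"
    proof (intro tendsto_mult tendsto_const)
      have "(\<lambda>n. inverse (z n / of_real (t n))) \<longlonglongrightarrow> inverse 1" by (intro tendsto_inverse zt) simp
      then show "(\<lambda>n. of_real (t n) / z n) \<longlonglongrightarrow> 1" by simp
    qed
    ultimately have lim: "(\<lambda>n. ?d n + - of_real (pi\<^sup>2 / 4 * u\<^sup>2) * (of_real (t n) / z n)) \<longlonglongrightarrow> 0 + - of_real (pi\<^sup>2 / 4 * u\<^sup>2) * 1"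
      by (rule tendsto_add)
    have ring_id: "(a - b) - (d - e) + (b - e - f) = a - d - f" for a b d e f :: complex
      by (simp add: algebra_simps)
    have eq: "?d n + - of_real (pi\<^sup>2 / 4 * u\<^sup>2) * (of_real (t n) / z n) =
        log_ovp (z n) - of_real (log_ovp_real (t n)) - \<i> * of_real (real (\<nu> n) * (c n * u))" for n
    proof -
      have "of_real (pi\<^sup>2) / (4 * z n) - of_real (pi\<^sup>2) / (4 * of_real (t n)) - \<i> * of_real (real (\<nu> n) * (c n * u))
          = - of_real (pi\<^sup>2 / 4 * u\<^sup>2) * (of_real (t n) / z n)"
        using saddle_exponent[OF t(1) \<nu>, of n u] by (simp only: z_def c_def)
      from this[symmetric] show ?thesis
        unfolding log_ovp_of_real[OF t(1)] by (simp only: ring_id)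
    qed
    show ?thesis using lim unfolding eq by simp
  qed
  have "(\<lambda>n. exp (log_ovp (z n) - of_real (log_ovp_real (t n)) - \<i> * of_real (real (\<nu> n) * (c n * u)))
      * (of_real (sqrt (t n)) * mex_mean (\<nu> n) (exp (- z n)) / (of_real (sqrt (t n) * mex_mean (\<nu> n) (exp (- t n))))))
      \<longlonglongrightarrow> exp (- of_real (pi\<^sup>2 / 4 * u\<^sup>2)) * (of_real (sqrt pi / 2) / of_real (sqrt pi / 2))"
    by (intro tendsto_mult tendsto_exp tendsto_divide exponent mean_lim tendsto_of_real real_lim') simp
  moreover have "\<forall>\<^sub>F n in sequentially. exp (log_ovp (z n) - of_real (log_ovp_real (t n)) - \<i> * of_real (real (\<nu> n) * (c n * u)))
      * (of_real (sqrt (t n)) * mex_mean (\<nu> n) (exp (- z n)) / (of_real (sqrt (t n) * mex_mean (\<nu> n) (exp (- t n)))))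
     = sigma_integrand (\<nu> n) (t n) (c n * u) / of_real (exp (log_ovp_real (t n)) * mex_mean (\<nu> n) (exp (- t n)))"
    using small
  proof eventually_elim
    case (elim n)
    have "\<bar>c n * u\<bar> \<le> pi" using im[OF elim] t(2)[of n] pi_gt3 by linarith
    then have "sigma_integrand (\<nu> n) (t n) (c n * u) = exp (log_ovp (z n)) * mex_mean (\<nu> n) (exp (- z n)) * exp (- (\<i> * of_real (real (\<nu> n) * (c n * u))))"
      by (simp add: sigma_integrand_def z_def abs_le_iff cis_conv_exp indicator_def)
    moreover have "complex_of_real (sqrt (t n)) \<noteq> 0" using t(1)[of n] by simp
    ultimately show ?case
      by (simp add: exp_diff exp_minus exp_of_real divide_inverse mult_ac)
  qed
  ultimately have "(\<lambda>n. sigma_integrand (\<nu> n) (t n) (c n * u) / of_real (exp (log_ovp_real (t n)) * mex_mean (\<nu> n) (exp (- t n))))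
     \<longlonglongrightarrow> exp (- of_real (pi\<^sup>2 / 4 * u\<^sup>2)) * (of_real (sqrt pi / 2) / of_real (sqrt pi / 2))"
    by (rule Lim_transform_eventually)
  moreover have "exp (- complex_of_real (pi\<^sup>2 / 4 * u\<^sup>2)) * (of_real (sqrt pi / 2) / of_real (sqrt pi / 2)) = of_real (exp (- (pi\<^sup>2 / 4) * u\<^sup>2))"
    by (simp flip: exp_of_real)
  ultimately show "(\<lambda>n. sigma_integrand (\<nu> n) (t n) (c n * u) / of_real (exp (log_ovp_real (t n)) * mex_mean (\<nu> n) (exp (- t n))))
     \<longlonglongrightarrow> of_real (exp (- (pi\<^sup>2 / 4) * u\<^sup>2))"
    by (simp only:)
qed

text \<open>
  Dominated convergence after the substitution \<open>\<theta> = c u\<close>.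
\<close>
lemma saddle_point_limit:
  fixes t :: "nat \<Rightarrow> real" and \<nu> :: "nat \<Rightarrow> nat"
  assumes t: "\<And>n. 0 < t n" "\<And>n. t n \<le> 1 / 8" "t \<longlonglongrightarrow> 0"
    and \<nu>: "\<And>n. real (\<nu> n) = pi\<^sup>2 / (4 * (t n)\<^sup>2)"
  defines "c \<equiv> \<lambda>n. t n * sqrt (t n)"
  defines "W \<equiv> \<lambda>n. exp (log_ovp_real (t n)) * mex_mean (\<nu> n) (exp (- t n))"
  shows "(\<lambda>n. 2 * pi * (real (sigma_mex_odd (\<nu> n)) * exp (- t n) ^ \<nu> n) / (W n * c n)) \<longlonglongrightarrow> 2 / sqrt pi"
proof -
  have c: "c n > 0" for n using t(1)[of n] by (simp add: c_def)
  have c2: "(c n)\<^sup>2 = t n ^ 3" for n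
    using t(1)[of n] by (simp add: c_def power_mult_distrib power2_eq_square power3_eq_cube)
  have W: "W n > 0" for n using t(1)[of n] by (simp add: W_def mex_mean_pos)
  have t1: "t n \<le> 1" for n using t(2)[of n] by simp
  obtain C where C: "C > 0" "\<And>n t \<theta>. 0 < t \<Longrightarrow> t \<le> 1 / 8 \<Longrightarrow>
     norm (sigma_integrand n t \<theta>) \<le> exp (log_ovp_real t) * mex_mean n (exp (- t)) * (C / (1 + \<theta>\<^sup>2 / t ^ 3))"
    using sigma_integrand_bound by blast
  define s where "s n u = sigma_integrand (\<nu> n) (t n) (c n * u) / of_real (W n)" for n u
  define f where "f u = complex_of_real (exp (- (pi\<^sup>2 / 4) * u\<^sup>2))" for u :: real
  have meas: "s n \<in> borel_measurable lborel" for n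
    unfolding s_def using sigma_integral(2)[OF t(1)[of n], of "\<nu> n"] by measurable
  have meas_f: "f \<in> borel_measurable lborel" unfolding f_def by measurable
  have int_bound: "integrable lborel (\<lambda>u::real. C * inverse (1 + u\<^sup>2))"
    using integrable_inverse_1_plus_square by (simp add: set_integrable_def einterval_def)
  have bound: "norm (s n u) \<le> C * inverse (1 + u\<^sup>2)" for n u
  proof -
    have "norm (sigma_integrand (\<nu> n) (t n) (c n * u)) \<le> W n * (C / (1 + (c n * u)\<^sup>2 / t n ^ 3))"
      unfolding W_def by (rule C(2)[OF t(1,2)])
    also have "(c n * u)\<^sup>2 / t n ^ 3 = u\<^sup>2" using t(1)[of n] by (simp add: power_mult_distrib c2)
    finally show ?thesis using W[of n] by (simp add: s_def norm_divide field_simps)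
  qed
  have lim: "(\<lambda>n. s n u) \<longlonglongrightarrow> f u" for u
    unfolding s_def f_def W_def c_def by (rule integrand_limit(1)[OF t(1) t1 t(3) \<nu>])
  have "AE u in lborel. (\<lambda>n. s n u) \<longlonglongrightarrow> f u" by (rule AE_I2) (rule lim)
  moreover have "AE u in lborel. norm (s n u) \<le> C * inverse (1 + u\<^sup>2)" for n by (rule AE_I2) (rule bound)
  ultimately have "(\<lambda>n. \<integral>u. s n u \<partial>lborel) \<longlonglongrightarrow> (\<integral>u. f u \<partial>lborel)"
    by (rule integral_dominated_convergence[OF meas_f meas int_bound])
  moreover have "(\<integral>u. s n u \<partial>lborel) = of_real (2 * pi * (real (sigma_mex_odd (\<nu> n)) * exp (- t n) ^ \<nu> n) / (W n * c n))" for n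
  proof -
    have "(\<integral>\<theta>. sigma_integrand (\<nu> n) (t n) \<theta> \<partial>lborel) = \<bar>c n\<bar> *\<^sub>R (\<integral>u. sigma_integrand (\<nu> n) (t n) (0 + c n * u) \<partial>lborel)"
      by (rule lborel_integral_real_affine) (use c[of n] in simp)
    then have "(\<integral>u. sigma_integrand (\<nu> n) (t n) (c n * u) \<partial>lborel) = of_real (2 * pi * (real (sigma_mex_odd (\<nu> n)) * exp (- t n) ^ \<nu> n)) / of_real (c n)"
      unfolding sigma_integral(1)[OF t(1)] using c[of n] by (simp add: scaleR_conv_of_real field_simps)
    then show ?thesis unfolding s_def integral_divide_zero by simp
  qed
  moreover have "(\<integral>u. f u \<partial>lborel) = of_real (2 / sqrt pi)"
    using gaussian_integral unfolding f_def integral_complex_of_real has_bochner_integral_iff by simp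
  ultimately have "(\<lambda>n. complex_of_real (2 * pi * (real (sigma_mex_odd (\<nu> n)) * exp (- t n) ^ \<nu> n) / (W n * c n))) \<longlonglongrightarrow> of_real (2 / sqrt pi)"
    by (simp only:)
  then show ?thesis by (rule tendsto_of_real_iff[THEN iffD1])
qed

lemma target_eq:
  fixes s :: real
  assumes "s > 0"
  defines "t \<equiv> pi / (2 * s)"
  shows "t * sqrt t * exp (t * s\<^sup>2) * exp (pi\<^sup>2 / (4 * t) + ln t / 2 - ln (4 * pi) / 2) / sqrt t / (2 * pi)
     = sqrt 2 / 16 * (s\<^sup>2) powr (- (3 / 4)) * exp (pi * s)"
proof -
  have t: "t > 0" using assms by (simp add: t_def)
  have "exp (ln t / 2) = sqrt t" "exp (ln (4 * pi) / 2) = sqrt (4 * pi)"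
    using t by (simp_all add: powr_half_sqrt[symmetric] powr_def)
  then have "exp (pi\<^sup>2 / (4 * t) + ln t / 2 - ln (4 * pi) / 2) = exp (pi\<^sup>2 / (4 * t)) * sqrt t / sqrt (4 * pi)"
    by (simp only: exp_add exp_diff)
  moreover have "exp (t * s\<^sup>2) * exp (pi\<^sup>2 / (4 * t)) = exp (pi * s)"
    using assms by (simp add: t_def power2_eq_square flip: exp_add)
  moreover have "t * sqrt t / (sqrt (4 * pi) * (2 * pi)) = sqrt 2 / 16 * (s\<^sup>2) powr (- (3 / 4))"
  proof -
    have pw: "(s\<^sup>2) powr (- (3 / 4)) = 1 / (s * sqrt s)"
    proof -
      have "(s\<^sup>2) powr (- (3 / 4)) = (s powr 2) powr (- (3 / 4))" using assms by simp
      also have "\<dots> = s powr (- (1 + 1 / 2))" by (simp add: powr_powr)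
      also have "\<dots> = 1 / (s powr 1 * s powr (1 / 2))" unfolding powr_minus powr_add by (simp add: inverse_eq_divide)
      finally show ?thesis using assms by (simp add: powr_half_sqrt)
    qed
    have st: "sqrt t = sqrt pi / (sqrt 2 * sqrt s)" by (simp add: t_def real_sqrt_divide real_sqrt_mult)
    have sp: "sqrt (4 * pi) = 2 * sqrt pi" by (simp add: real_sqrt_mult)
    show ?thesis unfolding pw st sp unfolding t_def using assms(1) by (simp add: field_simps)
  qed
  moreover have "t * sqrt t * a * (b * sqrt t / sqrt (4 * pi)) / sqrt t / (2 * pi) = t * sqrt t / (sqrt (4 * pi) * (2 * pi)) * (a * b)" for a b
    using t by simp
  ultimately show ?thesis by (simp only:)
qed

theorem theorem1p8:
  shows "(\<lambda>n :: nat. real (sigma_mex_odd n)) \<sim>[at_top]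
           (\<lambda>n :: nat. sqrt 2 / 16 * real n powr (- (3 / 4)) * exp (pi * sqrt (real n)))"
proof (rule asymp_equivI')
  let ?g = "\<lambda>n :: nat. sqrt 2 / 16 * real n powr (- (3 / 4)) * exp (pi * sqrt (real n))"
  \<comment> \<open>The shift makes \<open>t \<le> 1 / 8\<close> hold from the start.\<close>
  define \<nu> where "\<nu> n = n + 300" for n :: nat
  define t where "t n = pi / (2 * sqrt (real (\<nu> n)))" for n
  define W where "W n = exp (log_ovp_real (t n)) * mex_mean (\<nu> n) (exp (- t n))" for n
  define X where "X n = 2 * pi * (real (sigma_mex_odd (\<nu> n)) * exp (- t n) ^ \<nu> n) / (W n * (t n * sqrt (t n)))" for n
  define E where "E n = log_ovp_real (t n) - (pi\<^sup>2 / (4 * t n) + ln (t n) / 2 - ln (4 * pi) / 2)" for n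
  have \<nu>_pos: "real (\<nu> n) > 0" for n by (simp add: \<nu>_def)
  have t: "0 < t n" for n using \<nu>_pos[of n] by (simp add: t_def)
  have t8: "t n \<le> 1 / 8" for n
  proof -
    have "17 \<le> sqrt (real (\<nu> n))" by (rule real_le_rsqrt) (simp add: \<nu>_def)
    then have "pi / (2 * sqrt (real (\<nu> n))) \<le> 4 / (2 * 17)"
      using pi_less_4 by (intro frac_le) auto
    then show ?thesis by (simp add: t_def)
  qed
  have t0: "t \<longlonglongrightarrow> 0" unfolding t_def \<nu>_def by real_asymp
  have \<nu>_eq: "real (\<nu> n) = pi\<^sup>2 / (4 * (t n)\<^sup>2)" for n
    using \<nu>_pos[of n] by (simp add: t_def power_divide power_mult_distrib)
  have t_right: "filterlim t (at_right 0) sequentially"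
  proof -
    have "t n \<in> {0<..} \<and> t n \<noteq> 0" for n using t[of n] by simp
    then show ?thesis using t0 by (simp add: filterlim_at)
  qed
  have X: "X \<longlonglongrightarrow> 2 / sqrt pi"
    unfolding X_def W_def by (rule saddle_point_limit[OF t t8 t0 \<nu>_eq])
  have t1: "t n \<le> 1" for n using t8[of n] by simp
  have mean: "(\<lambda>n. sqrt (t n) * mex_mean (\<nu> n) (exp (- t n))) \<longlonglongrightarrow> sqrt pi / 2"
    by (rule integrand_limit(2)[OF t t1 t0 \<nu>_eq])
  have E: "E \<longlonglongrightarrow> 0" unfolding E_def by (rule filterlim_compose[OF log_ovp_real_asymp t_right])
  have "(\<lambda>n. X n * exp (E n) * (sqrt (t n) * mex_mean (\<nu> n) (exp (- t n)))) \<longlonglongrightarrow> 2 / sqrt pi * exp 0 * (sqrt pi / 2)"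
    by (intro tendsto_mult tendsto_exp X E mean)
  moreover have "X n * exp (E n) * (sqrt (t n) * mex_mean (\<nu> n) (exp (- t n))) = real (sigma_mex_odd (\<nu> n)) / ?g (\<nu> n)" for n
  proof -
    define M where "M = mex_mean (\<nu> n) (exp (- t n))"
    define A where "A = exp (pi\<^sup>2 / (4 * t n) + ln (t n) / 2 - ln (4 * pi) / 2)"
    have M: "M > 0" unfolding M_def using t[of n] by (intro mex_mean_pos) auto
    have A: "A > 0" by (simp add: A_def)
    have W_eq: "W n = exp (E n) * A * M" by (simp add: W_def M_def A_def E_def flip: exp_add)
    have pow: "exp (- t n) ^ \<nu> n = 1 / exp (t n * (sqrt (real (\<nu> n)))\<^sup>2)"
    proof -
      have "exp (- t n) ^ \<nu> n = exp (real (\<nu> n) * - t n)" by (rule exp_of_nat_mult[symmetric])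
      then show ?thesis by (simp add: exp_minus inverse_eq_divide mult.commute)
    qed
    have g: "?g (\<nu> n) = t n * sqrt (t n) * exp (t n * (sqrt (real (\<nu> n)))\<^sup>2) * A / sqrt (t n) / (2 * pi)"
      using target_eq[of "sqrt (real (\<nu> n))", folded t_def] \<nu>_pos[of n] by (simp add: A_def)
    show ?thesis
      unfolding g X_def W_eq pow M_def[symmetric] using t[of n] M A by (simp add: field_simps)
  qed
  ultimately have "(\<lambda>n. real (sigma_mex_odd (n + 300)) / ?g (n + 300)) \<longlonglongrightarrow> 1"
    by (simp add: \<nu>_def)
  then show "(\<lambda>n. real (sigma_mex_odd n) / ?g n) \<longlonglongrightarrow> 1"
    by (rule LIMSEQ_offset)
qed

end
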